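(* Let $M$ and $N$ be manifolds of class $C^2$, let $K_{T^*M\otimes TN}$ be a connection on the vector bundle $T^*M\otimes TN\to M\times N$, and let $u\colon M\to N$ be a twice colocally weakly differentiable map. Then the map $Tu\colon M\to T^*M\otimes TN$ has a colocal weak covariant derivative $D_K(Tu)\colon M\to T^*M\otimes T^*M\otimes TN$ if and only if the map $Tu\colon M\to T^*M\otimes TN$ has a colocal weak derivative $T^2u\colon TM\to T(T^*M\otimes TN)$. Furthermore, they are unique and almost everywhere in $M$ $$T^2u=\operatorname{Vert}\circ D_K(Tu)+\operatorname{Hor}_K\circ Tu\qquad\text{and}\qquad D_K(Tu)=K_{T^*M\otimes TN}\circ T^2u .$$
   Context: Manifolds are Hausdorff with a countable basis. Negligible sets, measurability, local integrability and weak differentiability on a manifold are understood in local charts. $\pi_M\colon TM\to M$ is the tangent bundle; $C^1_c$ denotes compactly supported $C^1$ functions. Colocal weak differentiability: a measurable map $u\colon M\to N$ between manifolds is colocally weakly differentiable if $f\circ u$ is weakly differentiable for every $f\in C^1_c(N,\mathbb{R})$. A colocal weak derivative of $u$ is a measurable bundle morphism $Tu\colon TM\to TN$ covering $u$ (i.e. $Tu(x)\colon T_xM\to T_{u(x)}N$ is linear for a.e. $x$) with $T(f\circ u)=Tf\circ Tu$ a.e. for every $f\in C^1_c(N,\mathbb{R})$; for a colocally weakly differentiable map it exists and is unique a.e. (known). $T^*M\otimes TN$ is the vector bundle over $M\times N$ with fibre $T_x^*M\otimes T_yN=\mathcal{L}(T_xM,T_yN)$ over $(x,y)$; it is a manifold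 of class $C^1$ and $Tu$ is regarded as a measurable map $M\to T^*M\otimes TN$. The map $u$ is twice colocally weakly differentiable if $u$ is colocally weakly differentiable and $Tu\colon M\to T^*M\otimes TN$ is colocally weakly differentiable; the colocal weak derivative of $Tu$ is denoted $T^2u$. Connections: for a vector bundle $\pi\colon E\to B$, a connection is a map $K\colon TE\to E$ that is a bundle morphism from $TE\to E$ to $E\to B$ covering $\pi$, a bundle morphism from $T\pi\colon TE\to TB$ to $E\to B$ covering the projection $TB\to B$, and satisfies $K(\operatorname{Vert}_e(\nu))=\nu$, where for $e,\nu$ in the same fibre, $\operatorname{Vert}_e(\nu)=\frac{d}{dt}(e+t\nu)\big|_{t=0}\in T_eE$ (vertical lift). For $e\in E$ and $w\in T_{\pi(e)}B$, the horizontal lift $\operatorname{Hor}_{K,e}(w)$ is the unique element of $T_eE\cap\ker K$ with $T\pi(\operatorname{Hor}_{K,e}(w))=w$. Here $E=T^*M\otimes TN$, $B=M\times N$; for a.e. $x$ and $e\in T_xM$, $(\operatorname{Vert}\circ D_K(Tu))(x)[e]=\operatorname{Vert}_{Tu(x)}(D_K(Tu)(x)[e])$ and $(\operatorname{Hor}_K\circ Tu)(x)[e]=\operatorname{Hor}_{K,Tu(x)}(e,Tu(x)[e])$. A colocal weak covariant derivative of $Tu$ is a measurable map $D_K(Tu)\colon M\to T^*M\otimes T^*M\otimes TN$ such that for a.e. $x\in M$, $D_K(Tu)(x)\colon T_xM\times T_xM\to T_{u(x)}N$ is bilinear (with $D_K(Tu)(x)[e]\in\mathcal{L}(T_xM,T_{u(x)}N)$)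 and for every $f\in C^1_c(T^*M\otimes TN,\mathbb{R})$, $$(Tf)(Tu)[\operatorname{Vert}\circ D_K(Tu)]=T(f\circ Tu)-(Tf)(Tu)[\operatorname{Hor}_K\circ Tu]\quad\text{a.e. in }M.$$ *)

theory Defs
  imports "HOL-Analysis.Analysis"
begin

section \<open>Manifolds as atlases\<close>

(* C^k on an open set S, by recursion over directional derivatives; on Euclidean spaces this is
   the usual class of k times continuously differentiable maps. *)
primrec Ck :: "nat \<Rightarrow> 'a::euclidean_space set \<Rightarrow> ('a \<Rightarrow> 'b::euclidean_space) \<Rightarrow> bool" where
  "Ck 0 S f \<longleftrightarrow> continuous_on S f"
| "Ck (Suc k) S f \<longleftrightarrow> (\<forall>z\<in>S. f differentiable (at z)) \<and>
     (\<forall>w. Ck k S (\<lambda>z. frechet_derivative f (at z) w))"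

(* A chart is a domain together with a coordinate map, of which only the values on the domain
   matter.  An atlas is a set of charts, not necessarily maximal; the underlying set of the manifold
   is the union of the chart domains and its topology is the one generated by the charts. *)
type_synonym ('p, 'a) chart = "'p set \<times> ('p \<Rightarrow> 'a)"
type_synonym ('p, 'a) atlas = "('p, 'a) chart set"

definition chart_image :: "('p, 'a) chart \<Rightarrow> 'a set" where
  "chart_image c = snd c ` fst c"

definition chart_inv :: "('p, 'a) chart \<Rightarrow> 'a \<Rightarrow> 'p" where
  "chart_inv c = inv_into (fst c) (snd c)"

definition points :: "('p, 'a) atlas \<Rightarrow> 'p set" where
  "points M = (\<Union>c\<in>M. fst c)"

definition mtop :: "('p, 'a::euclidean_space) atlas \<Rightarrow> 'p topology" where
  "mtop M = topology (\<lambda>W. W \<subseteq> points M \<and> (\<forall>c\<in>M. open (snd c ` (W \<inter> fst c))))"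

definition has_countable_basis :: "'p topology \<Rightarrow> bool" where
  "has_countable_basis X \<longleftrightarrow> (\<exists>\<B>. countable \<B> \<and> (\<forall>V\<in>\<B>. openin X V) \<and>
     (\<forall>W x. openin X W \<and> x \<in> W \<longrightarrow> (\<exists>V\<in>\<B>. x \<in> V \<and> V \<subseteq> W)))"

definition manifold :: "nat \<Rightarrow> ('p, 'a::euclidean_space) atlas \<Rightarrow> bool" where
  "manifold k M \<longleftrightarrow>
     (\<forall>c\<in>M. inj_on (snd c) (fst c) \<and> open (chart_image c)) \<and>
     (\<forall>c\<in>M. \<forall>d\<in>M. open (snd c ` (fst c \<inter> fst d)) \<and>
        Ck k (snd c ` (fst c \<inter> fst d)) (snd d \<circ> chart_inv c)) \<and>
     Hausdorff_space (mtop M) \<and> has_countable_basis (mtop M)"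

definition chart_at :: "('p, 'a) atlas \<Rightarrow> 'p \<Rightarrow> ('p, 'a) chart" where
  "chart_at M x = (SOME c. c \<in> M \<and> x \<in> fst c)"

definition prod_chart :: "('p, 'a) chart \<Rightarrow> ('q, 'b) chart \<Rightarrow> ('p \<times> 'q, 'a \<times> 'b) chart" where
  "prod_chart c d = (fst c \<times> fst d, \<lambda>(x, y). (snd c x, snd d y))"

definition prod_atlas :: "('p, 'a) atlas \<Rightarrow> ('q, 'b) atlas \<Rightarrow> ('p \<times> 'q, 'a \<times> 'b) atlas" where
  "prod_atlas M N = {prod_chart c d | c d. c \<in> M \<and> d \<in> N}"


section \<open>Measure-theoretic notions in local charts\<close>

definition ae_on :: "('p, 'a::euclidean_space) atlas \<Rightarrow> ('p \<Rightarrow> bool) \<Rightarrow> bool" where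
  "ae_on M P \<longleftrightarrow> (\<forall>c\<in>M. negligible (snd c ` {x \<in> fst c. \<not> P x}))"

definition measurable_set :: "('p, 'a::euclidean_space) atlas \<Rightarrow> 'p set \<Rightarrow> bool" where
  "measurable_set M S \<longleftrightarrow> (\<forall>c\<in>M. snd c ` (S \<inter> fst c) \<in> sets lebesgue)"

definition measurable_map ::
  "('p, 'a::euclidean_space) atlas \<Rightarrow> ('q, 'b::euclidean_space) atlas \<Rightarrow> ('p \<Rightarrow> 'q) \<Rightarrow> bool" where
  "measurable_map M N u \<longleftrightarrow> u \<in> points M \<rightarrow> points N \<and>
     (\<forall>W. openin (mtop N) W \<longrightarrow> measurable_set M {x \<in> points M. u x \<in> W})"


section \<open>Tangent spaces, tangent maps and vector bundles\<close>

(* A tangent vector at x is the family of its coordinate vectors in all charts of the atlas around x,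
   related by the derivatives of the chart changes, and 0 at all other charts. *)
type_synonym ('p, 'a) tvec = "('p, 'a) chart \<Rightarrow> 'a"

definition tangent_space :: "('p, 'a::euclidean_space) atlas \<Rightarrow> 'p \<Rightarrow> ('p, 'a) tvec set" where
  "tangent_space M x = {v.
     (\<forall>c\<in>M. \<forall>d\<in>M. x \<in> fst c \<and> x \<in> fst d \<longrightarrow>
        v d = frechet_derivative (snd d \<circ> chart_inv c) (at (snd c x)) (v c)) \<and>
     (\<forall>c. \<not> (c \<in> M \<and> x \<in> fst c) \<longrightarrow> v c = 0)}"

(* The tangent vector at x whose coordinate vector in the chart c is w. *)
definition tvec_of ::
  "('p, 'a::euclidean_space) atlas \<Rightarrow> ('p, 'a) chart \<Rightarrow> 'p \<Rightarrow> 'a \<Rightarrow> ('p, 'a) tvec" where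
  "tvec_of M c x w = (\<lambda>d. if d \<in> M \<and> x \<in> fst d
     then frechet_derivative (snd d \<circ> chart_inv c) (at (snd c x)) w else 0)"

definition tvec_zero :: "('p, 'a::euclidean_space) tvec" where
  "tvec_zero = (\<lambda>c. 0)"

definition tvec_add ::
  "('p, 'a::euclidean_space) tvec \<Rightarrow> ('p, 'a) tvec \<Rightarrow> ('p, 'a) tvec" where
  "tvec_add v w = (\<lambda>c. v c + w c)"

definition tvec_scale :: "real \<Rightarrow> ('p, 'a::euclidean_space) tvec \<Rightarrow> ('p, 'a) tvec" where
  "tvec_scale r v = (\<lambda>c. r *\<^sub>R v c)"

definition tangent_chart ::
  "('p, 'a::euclidean_space) atlas \<Rightarrow> ('p, 'a) chart \<Rightarrow> ('p \<times> ('p, 'a) tvec, 'a \<times> 'a) chart" where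
  "tangent_chart M c = ({(x, v). x \<in> fst c \<and> v \<in> tangent_space M x}, \<lambda>(x, v). (snd c x, v c))"

definition tangent_atlas ::
  "('p, 'a::euclidean_space) atlas \<Rightarrow> ('p \<times> ('p, 'a) tvec, 'a \<times> 'a) atlas" where
  "tangent_atlas M = tangent_chart M ` M"

(* The tangent map Tf : TM \<rightarrow> TN of a differentiable map f : M \<rightarrow> N. *)
definition tmap ::
  "('p, 'a::euclidean_space) atlas \<Rightarrow> ('q, 'b::euclidean_space) atlas \<Rightarrow> ('p \<Rightarrow> 'q) \<Rightarrow>
   'p \<times> ('p, 'a) tvec \<Rightarrow> 'q \<times> ('q, 'b) tvec" where
  "tmap M N f = (\<lambda>(x, v). let c = chart_at M x in
     (f x, \<lambda>d. if d \<in> N \<and> f x \<in> fst d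
        then frechet_derivative (snd d \<circ> f \<circ> chart_inv c) (at (snd c x)) (v c) else 0))"

(* Tf for real-valued f, with the fibres of T\<real> identified with \<real> (so the base point f x is dropped). *)
definition dreal ::
  "('p, 'a::euclidean_space) atlas \<Rightarrow> ('p \<Rightarrow> real) \<Rightarrow> 'p \<times> ('p, 'a) tvec \<Rightarrow> real" where
  "dreal M f = (\<lambda>(x, v). let c = chart_at M x in
     frechet_derivative (f \<circ> chart_inv c) (at (snd c x)) (v c))"

(* The vector (v, w) under the identification of T_(x,y) (M \<times> N) with T_x M \<times> T_y N. *)
definition tvec_pair ::
  "('p, 'a::euclidean_space) atlas \<Rightarrow> ('q, 'b::euclidean_space) atlas \<Rightarrow>
   'p \<times> ('p, 'a) tvec \<Rightarrow> 'q \<times> ('q, 'b) tvec \<Rightarrow> ('p \<times> 'q) \<times> ('p \<times> 'q, 'a \<times> 'b) tvec" where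
  "tvec_pair M N = (\<lambda>(x, v) (y, w). let c = chart_at M x; d = chart_at N y in
     ((x, y), tvec_of (prod_atlas M N) (prod_chart c d) (x, y) (v c, w d)))"

(* The tangent vector d/dt \<gamma>(t) at t = 0. *)
definition velocity ::
  "('p, 'a::euclidean_space) atlas \<Rightarrow> (real \<Rightarrow> 'p) \<Rightarrow> 'p \<times> ('p, 'a) tvec" where
  "velocity M \<gamma> = (\<gamma> 0, \<lambda>c. if c \<in> M \<and> \<gamma> 0 \<in> fst c
     then vector_derivative (\<lambda>t. snd c (\<gamma> t)) (at 0) else 0)"

(* The data of a vector bundle; vadd and vscale are the fibrewise operations and vadd is
   only meant to be applied to two elements of the same fibre. *)
record ('s, 'c, 'q, 'b) vbundle =
  bundle_total :: "('s, 'c) atlas"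
  bundle_base :: "('q, 'b) atlas"
  proj :: "'s \<Rightarrow> 'q"
  vadd :: "'s \<Rightarrow> 's \<Rightarrow> 's"
  vscale :: "real \<Rightarrow> 's \<Rightarrow> 's"

definition fibre :: "('s, 'c, 'q, 'b) vbundle \<Rightarrow> 'q \<Rightarrow> 's set" where
  "fibre E b = {e \<in> points (bundle_total E). proj E e = b}"

definition linear_on_fibre ::
  "('s, 'c, 'q, 'b) vbundle \<Rightarrow> ('s1, 'c1, 'q1, 'b1) vbundle \<Rightarrow> ('s \<Rightarrow> 's1) \<Rightarrow> 'q \<Rightarrow> bool" where
  "linear_on_fibre E E' F b \<longleftrightarrow>
     (\<forall>e1\<in>fibre E b. \<forall>e2\<in>fibre E b. F (vadd E e1 e2) = vadd E' (F e1) (F e2)) \<and>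
     (\<forall>r. \<forall>e\<in>fibre E b. F (vscale E r e) = vscale E' r (F e))"

definition bundle_morphism ::
  "('s, 'c::euclidean_space, 'q, 'b) vbundle \<Rightarrow> ('s1, 'c1::euclidean_space, 'q1, 'b1) vbundle \<Rightarrow>
   ('s \<Rightarrow> 's1) \<Rightarrow> ('q \<Rightarrow> 'q1) \<Rightarrow> bool" where
  "bundle_morphism E E' F f \<longleftrightarrow>
     continuous_map (mtop (bundle_total E)) (mtop (bundle_total E')) F \<and>
     (\<forall>e\<in>points (bundle_total E). proj E' (F e) = f (proj E e)) \<and>
     (\<forall>b\<in>points (bundle_base E). linear_on_fibre E E' F b)"

definition measurable_bundle_morphism ::
  "('s, 'c::euclidean_space, 'q, 'b::euclidean_space) vbundle \<Rightarrow>
   ('s1, 'c1::euclidean_space, 'q1, 'b1) vbundle \<Rightarrow> ('s \<Rightarrow> 's1) \<Rightarrow> ('q \<Rightarrow> 'q1) \<Rightarrow> bool" where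
  "measurable_bundle_morphism E E' F f \<longleftrightarrow>
     measurable_map (bundle_total E) (bundle_total E') F \<and>
     (\<forall>e\<in>points (bundle_total E). proj E' (F e) = f (proj E e)) \<and>
     ae_on (bundle_base E) (linear_on_fibre E E' F)"

definition tangent_bundle ::
  "('p, 'a::euclidean_space) atlas \<Rightarrow> ('p \<times> ('p, 'a) tvec, 'a \<times> 'a, 'p, 'a) vbundle" where
  "tangent_bundle M = \<lparr>bundle_total = tangent_atlas M, bundle_base = M, proj = fst,
     vadd = (\<lambda>(x, v) (y, w). (x, tvec_add v w)), vscale = (\<lambda>r (x, v). (x, tvec_scale r v))\<rparr>"

(* L(T_x M, T_y N); maps are extended by zero outside T_x M, so that equality of functions is
   equality of linear maps. *)
definition hom_space ::
  "('p, 'a::euclidean_space) atlas \<Rightarrow> ('q, 'b::euclidean_space) atlas \<Rightarrow> 'p \<Rightarrow> 'q \<Rightarrow>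
   (('p, 'a) tvec \<Rightarrow> ('q, 'b) tvec) set" where
  "hom_space M N x y = {L.
     (\<forall>v\<in>tangent_space M x. L v \<in> tangent_space N y) \<and>
     (\<forall>v\<in>tangent_space M x. \<forall>w\<in>tangent_space M x. L (tvec_add v w) = tvec_add (L v) (L w)) \<and>
     (\<forall>r. \<forall>v\<in>tangent_space M x. L (tvec_scale r v) = tvec_scale r (L v)) \<and>
     (\<forall>v. v \<notin> tangent_space M x \<longrightarrow> L v = tvec_zero)}"

type_synonym ('p, 'a, 'q, 'b) hom_point = "('p \<times> 'q) \<times> (('p, 'a) tvec \<Rightarrow> ('q, 'b) tvec)"

type_synonym ('m, 'n) hom_model = "((real^'m) \<times> (real^'n)) \<times> (real^'m^'n)"

type_synonym ('p, 'm, 'q, 'n) hom_tangent =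
  "('p, real^'m, 'q, real^'n) hom_point \<times>
   (('p, real^'m, 'q, real^'n) hom_point, ('m, 'n) hom_model) tvec"

(* Charts c of M and d of N induce the bundle chart in which a linear map is represented by its
   matrix with respect to the coordinate bases of c and d. *)
definition hom_chart ::
  "('p, real^'m::finite) atlas \<Rightarrow> ('q, real^'n::finite) atlas \<Rightarrow> ('p, real^'m) chart \<Rightarrow>
   ('q, real^'n) chart \<Rightarrow>
   (('p, real^'m, 'q, real^'n) hom_point, ('m, 'n) hom_model) chart" where
  "hom_chart M N c d =
     ({((x, y), L). x \<in> fst c \<and> y \<in> fst d \<and> L \<in> hom_space M N x y},
      \<lambda>((x, y), L). ((snd c x, snd d y), matrix (\<lambda>w. L (tvec_of M c x w) d)))"

(* The vector bundle T*M \<otimes> TN over M \<times> N. *)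
definition hom_bundle ::
  "('p, real^'m::finite) atlas \<Rightarrow> ('q, real^'n::finite) atlas \<Rightarrow>
   (('p, real^'m, 'q, real^'n) hom_point, ('m, 'n) hom_model,
    'p \<times> 'q, (real^'m) \<times> (real^'n)) vbundle" where
  "hom_bundle M N = \<lparr>bundle_total = {hom_chart M N c d | c d. c \<in> M \<and> d \<in> N},
     bundle_base = prod_atlas M N, proj = fst,
     vadd = (\<lambda>(b, L) (b', L'). (b, \<lambda>v. tvec_add (L v) (L' v))),
     vscale = (\<lambda>r (b, L). (b, \<lambda>v. tvec_scale r (L v)))\<rparr>"

(* Bilinear maps T_x M \<times> T_x M \<rightarrow> T_y N in curried form, extended by zero. *)
definition bilin_space ::
  "('p, 'a::euclidean_space) atlas \<Rightarrow> ('q, 'b::euclidean_space) atlas \<Rightarrow> 'p \<Rightarrow> 'q \<Rightarrow>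
   (('p, 'a) tvec \<Rightarrow> ('p, 'a) tvec \<Rightarrow> ('q, 'b) tvec) set" where
  "bilin_space M N x y = {B.
     (\<forall>e\<in>tangent_space M x. B e \<in> hom_space M N x y) \<and>
     (\<forall>e\<in>tangent_space M x. \<forall>e'\<in>tangent_space M x. \<forall>v.
        B (tvec_add e e') v = tvec_add (B e v) (B e' v)) \<and>
     (\<forall>r. \<forall>e\<in>tangent_space M x. \<forall>v. B (tvec_scale r e) v = tvec_scale r (B e v)) \<and>
     (\<forall>e. e \<notin> tangent_space M x \<longrightarrow> B e = (\<lambda>v. tvec_zero))}"

type_synonym ('p, 'a, 'q, 'b) bilin_point =
  "('p \<times> 'q) \<times> (('p, 'a) tvec \<Rightarrow> ('p, 'a) tvec \<Rightarrow> ('q, 'b) tvec)"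

type_synonym ('m, 'n) bilin_model = "((real^'m) \<times> (real^'n)) \<times> (real^'m^'n^'m)"

definition bilin_chart ::
  "('p, real^'m::finite) atlas \<Rightarrow> ('q, real^'n::finite) atlas \<Rightarrow> ('p, real^'m) chart \<Rightarrow>
   ('q, real^'n) chart \<Rightarrow>
   (('p, real^'m, 'q, real^'n) bilin_point, ('m, 'n) bilin_model) chart" where
  "bilin_chart M N c d =
     ({((x, y), B). x \<in> fst c \<and> y \<in> fst d \<and> B \<in> bilin_space M N x y},
      \<lambda>((x, y), B). ((snd c x, snd d y),
        \<chi> i. matrix (\<lambda>w. B (tvec_of M c x (axis i 1)) (tvec_of M c x w) d)))"

(* The total space of T*M \<otimes> T*M \<otimes> TN. *)
definition bilin_atlas ::
  "('p, real^'m::finite) atlas \<Rightarrow> ('q, real^'n::finite) atlas \<Rightarrow>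
   (('p, real^'m, 'q, real^'n) bilin_point, ('m, 'n) bilin_model) atlas" where
  "bilin_atlas M N = {bilin_chart M N c d | c d. c \<in> M \<and> d \<in> N}"


section \<open>Connections and lifts\<close>

(* The vector bundle T\<pi> : TE \<rightarrow> TB.  Its fibrewise operations are the tangent maps of the fibrewise
   operations of E.  All charts of the total space are assumed to be bundle charts, that is, with
   values (base coordinates, fibre coordinates), linear on fibres and defined on full preimages
   under proj, as those of hom_bundle are; in such charts these operations leave the base component
   of the velocity unchanged and are linear in the fibre component. *)
definition tangent_proj_bundle ::
  "('s, 'b::euclidean_space \<times> 'f::euclidean_space, 'q, 'b) vbundle \<Rightarrow>
   ('s \<times> ('s, 'b \<times> 'f) tvec, ('b \<times> 'f) \<times> ('b \<times> 'f), 'q \<times> ('q, 'b) tvec, 'b \<times> 'b) vbundle" where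
  "tangent_proj_bundle E = \<lparr>bundle_total = tangent_atlas (bundle_total E),
     bundle_base = tangent_atlas (bundle_base E),
     proj = tmap (bundle_total E) (bundle_base E) (proj E),
     vadd = (\<lambda>(e, V) (e', V'). (vadd E e e', \<lambda>c. (fst (V c), snd (V c) + snd (V' c)))),
     vscale = (\<lambda>r (e, V). (vscale E r e, \<lambda>c. (fst (V c), r *\<^sub>R snd (V c))))\<rparr>"

definition vertical_lift ::
  "('s, 'c::euclidean_space, 'q, 'b) vbundle \<Rightarrow> 's \<Rightarrow> 's \<Rightarrow> 's \<times> ('s, 'c) tvec" where
  "vertical_lift E e \<nu> = velocity (bundle_total E) (\<lambda>t. vadd E e (vscale E t \<nu>))"

definition connection ::
  "('s, 'b::euclidean_space \<times> 'f::euclidean_space, 'q, 'b) vbundle \<Rightarrow>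
   ('s \<times> ('s, 'b \<times> 'f) tvec \<Rightarrow> 's) \<Rightarrow> bool" where
  "connection E K \<longleftrightarrow>
     bundle_morphism (tangent_bundle (bundle_total E)) E K (proj E) \<and>
     bundle_morphism (tangent_proj_bundle E) E K (proj (tangent_bundle (bundle_base E))) \<and>
     (\<forall>e\<in>points (bundle_total E). \<forall>\<nu>\<in>points (bundle_total E). proj E e = proj E \<nu> \<longrightarrow>
        K (vertical_lift E e \<nu>) = \<nu>)"

(* Here w is an element of the tangent space of the base at proj E e, given with its base point,
   and vscale E 0 e is the zero of the fibre of e. *)
definition horizontal_lift ::
  "('s, 'b::euclidean_space \<times> 'f::euclidean_space, 'q, 'b) vbundle \<Rightarrow>
   ('s \<times> ('s, 'b \<times> 'f) tvec \<Rightarrow> 's) \<Rightarrow> 's \<Rightarrow> 'q \<times> ('q, 'b) tvec \<Rightarrow> 's \<times> ('s, 'b \<times> 'f) tvec" where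
  "horizontal_lift E K e w = (THE V. V \<in> points (tangent_atlas (bundle_total E)) \<and> fst V = e \<and>
     K V = vscale E 0 e \<and> tmap (bundle_total E) (bundle_base E) (proj E) V = w)"


section \<open>Weak differentiability\<close>

definition locally_integrable_on :: "'a::euclidean_space set \<Rightarrow> ('a \<Rightarrow> real) \<Rightarrow> bool" where
  "locally_integrable_on S g \<longleftrightarrow> (\<forall>C. compact C \<and> C \<subseteq> S \<longrightarrow> set_integrable lebesgue C g)"

definition test_function :: "'a::euclidean_space set \<Rightarrow> ('a \<Rightarrow> real) \<Rightarrow> bool" where
  "test_function S \<eta> \<longleftrightarrow> Ck 1 S \<eta> \<and> (\<exists>C. compact C \<and> C \<subseteq> S \<and> (\<forall>z\<in>S - C. \<eta> z = 0))"

(* G z w is the derivative at z in the direction w. *)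
definition has_weak_derivative_on ::
  "'a::euclidean_space set \<Rightarrow> ('a \<Rightarrow> real) \<Rightarrow> ('a \<Rightarrow> 'a \<Rightarrow> real) \<Rightarrow> bool" where
  "has_weak_derivative_on S g G \<longleftrightarrow> locally_integrable_on S g \<and>
     (\<forall>i\<in>Basis. locally_integrable_on S (\<lambda>z. G z i) \<and>
        (\<forall>\<eta>. test_function S \<eta> \<longrightarrow>
           set_lebesgue_integral lebesgue S (\<lambda>z. g z * frechet_derivative \<eta> (at z) i) =
           - set_lebesgue_integral lebesgue S (\<lambda>z. G z i * \<eta> z)))"

(* \<omega> : TM \<rightarrow> \<real> is a representative of the weak derivative Tg of g : M \<rightarrow> \<real>, which is
   determined up to a negligible subset of M. *)
definition has_weak_derivative ::
  "('p, 'a::euclidean_space) atlas \<Rightarrow> ('p \<Rightarrow> real) \<Rightarrow> ('p \<times> ('p, 'a) tvec \<Rightarrow> real) \<Rightarrow> bool" where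
  "has_weak_derivative M g \<omega> \<longleftrightarrow>
     ae_on M (\<lambda>x.
       (\<forall>v\<in>tangent_space M x. \<forall>w\<in>tangent_space M x. \<omega> (x, tvec_add v w) = \<omega> (x, v) + \<omega> (x, w)) \<and>
       (\<forall>r. \<forall>v\<in>tangent_space M x. \<omega> (x, tvec_scale r v) = r * \<omega> (x, v))) \<and>
     (\<forall>c\<in>M. has_weak_derivative_on (chart_image c) (g \<circ> chart_inv c)
        (\<lambda>z w. \<omega> (chart_inv c z, tvec_of M c (chart_inv c z) w)))"

definition weakly_differentiable :: "('p, 'a::euclidean_space) atlas \<Rightarrow> ('p \<Rightarrow> real) \<Rightarrow> bool" where
  "weakly_differentiable M g \<longleftrightarrow> (\<exists>\<omega>. has_weak_derivative M g \<omega>)"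

definition C1c :: "('p, 'a::euclidean_space) atlas \<Rightarrow> ('p \<Rightarrow> real) set" where
  "C1c M = {f. (\<forall>c\<in>M. Ck 1 (chart_image c) (f \<circ> chart_inv c)) \<and>
     compactin (mtop M) (mtop M closure_of {x \<in> points M. f x \<noteq> 0})}"

definition colocally_weakly_differentiable ::
  "('p, 'a::euclidean_space) atlas \<Rightarrow> ('q, 'b::euclidean_space) atlas \<Rightarrow> ('p \<Rightarrow> 'q) \<Rightarrow> bool" where
  "colocally_weakly_differentiable M N u \<longleftrightarrow>
     measurable_map M N u \<and> (\<forall>f\<in>C1c N. weakly_differentiable M (f \<circ> u))"

(* A is a colocal weak derivative of u.  Here and below \<omega> ranges over the representatives of the
   weak derivative; one exists by the first conjunct. *)
definition has_colocal_weak_derivative ::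
  "('p, 'a::euclidean_space) atlas \<Rightarrow> ('q, 'b::euclidean_space) atlas \<Rightarrow> ('p \<Rightarrow> 'q) \<Rightarrow>
   ('p \<times> ('p, 'a) tvec \<Rightarrow> 'q \<times> ('q, 'b) tvec) \<Rightarrow> bool" where
  "has_colocal_weak_derivative M N u A \<longleftrightarrow>
     colocally_weakly_differentiable M N u \<and>
     measurable_bundle_morphism (tangent_bundle M) (tangent_bundle N) A u \<and>
     (\<forall>f\<in>C1c N. \<forall>\<omega>. has_weak_derivative M (f \<circ> u) \<omega> \<longrightarrow>
        ae_on M (\<lambda>x. \<forall>v\<in>tangent_space M x. \<omega> (x, v) = dreal N f (A (x, v))))"

(* A measurable bundle morphism A : TM \<rightarrow> TN covering u, regarded as a map M \<rightarrow> T*M \<otimes> TN.  On the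
   negligible set where A is not linear the value is the zero map. *)
definition hom_section ::
  "('p, 'a::euclidean_space) atlas \<Rightarrow> ('q, 'b::euclidean_space) atlas \<Rightarrow> ('p \<Rightarrow> 'q) \<Rightarrow>
   ('p \<times> ('p, 'a) tvec \<Rightarrow> 'q \<times> ('q, 'b) tvec) \<Rightarrow> 'p \<Rightarrow> ('p, 'a, 'q, 'b) hom_point" where
  "hom_section M N u A x =
     (let L = (\<lambda>v. if v \<in> tangent_space M x then snd (A (x, v)) else tvec_zero)
      in ((x, u x), if L \<in> hom_space M N x (u x) then L else (\<lambda>v. tvec_zero)))"

(* Tu is a representative of the colocal weak derivative of u, which is unique almost everywhere. *)
definition twice_colocally_weakly_differentiable ::
  "('p, real^'m::finite) atlas \<Rightarrow> ('q, real^'n::finite) atlas \<Rightarrow> ('p \<Rightarrow> 'q) \<Rightarrow>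
   ('p \<times> ('p, real^'m) tvec \<Rightarrow> 'q \<times> ('q, real^'n) tvec) \<Rightarrow> bool" where
  "twice_colocally_weakly_differentiable M N u Tu \<longleftrightarrow>
     colocally_weakly_differentiable M N u \<and>
     has_colocal_weak_derivative M N u Tu \<and>
     colocally_weakly_differentiable M (bundle_total (hom_bundle M N)) (hom_section M N u Tu)"

(* D(x)[e] as an element of T*M \<otimes> TN. *)
definition contract ::
  "('p \<Rightarrow> ('p, 'a, 'q, 'b) bilin_point) \<Rightarrow> 'p \<Rightarrow> ('p, 'a) tvec \<Rightarrow> ('p, 'a, 'q, 'b) hom_point" where
  "contract D x e = (fst (D x), snd (D x) e)"

(* For U : M \<rightarrow> T*M \<otimes> TN the maps (x, e) \<mapsto> (Vert \<circ> D)(x)[e] and (x, e) \<mapsto> (Hor_K \<circ> U)(x)[e]; the base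
   point of U x is (x, u x). *)
definition vert_comp ::
  "('p, real^'m::finite) atlas \<Rightarrow> ('q, real^'n::finite) atlas \<Rightarrow>
   ('p \<Rightarrow> ('p, real^'m, 'q, real^'n) hom_point) \<Rightarrow> ('p \<Rightarrow> ('p, real^'m, 'q, real^'n) bilin_point) \<Rightarrow>
   'p \<Rightarrow> ('p, real^'m) tvec \<Rightarrow>
   ('p, 'm, 'q, 'n) hom_tangent" where
  "vert_comp M N U D x e = vertical_lift (hom_bundle M N) (U x) (contract D x e)"

definition hor_comp ::
  "('p, real^'m::finite) atlas \<Rightarrow> ('q, real^'n::finite) atlas \<Rightarrow>
   (('p, 'm, 'q, 'n) hom_tangent \<Rightarrow>
    ('p, real^'m, 'q, real^'n) hom_point) \<Rightarrow>
   ('p \<Rightarrow> ('p, real^'m, 'q, real^'n) hom_point) \<Rightarrow> 'p \<Rightarrow> ('p, real^'m) tvec \<Rightarrow>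
   ('p, 'm, 'q, 'n) hom_tangent" where
  "hor_comp M N K U x e = horizontal_lift (hom_bundle M N) K (U x)
     (tvec_pair M N (x, e) (snd (fst (U x)), snd (U x) e))"

(* D is a colocal weak covariant derivative D_K(Tu), where u : M \<rightarrow> N and U is Tu regarded as a map
   M \<rightarrow> T*M \<otimes> TN.  Bilinearity of D x is part of being a point of T*M \<otimes> T*M \<otimes> TN. *)
definition has_colocal_weak_covariant_derivative ::
  "('p, real^'m::finite) atlas \<Rightarrow> ('q, real^'n::finite) atlas \<Rightarrow>
   (('p, 'm, 'q, 'n) hom_tangent \<Rightarrow>
    ('p, real^'m, 'q, real^'n) hom_point) \<Rightarrow>
   ('p \<Rightarrow> 'q) \<Rightarrow> ('p \<Rightarrow> ('p, real^'m, 'q, real^'n) hom_point) \<Rightarrow>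
   ('p \<Rightarrow> ('p, real^'m, 'q, real^'n) bilin_point) \<Rightarrow> bool" where
  "has_colocal_weak_covariant_derivative M N K u U D \<longleftrightarrow>
     colocally_weakly_differentiable M (bundle_total (hom_bundle M N)) U \<and>
     measurable_map M (bilin_atlas M N) D \<and>
     ae_on M (\<lambda>x. fst (D x) = (x, u x)) \<and>
     (\<forall>f\<in>C1c (bundle_total (hom_bundle M N)). \<forall>\<omega>. has_weak_derivative M (f \<circ> U) \<omega> \<longrightarrow>
        ae_on M (\<lambda>x. \<forall>e\<in>tangent_space M x.
          dreal (bundle_total (hom_bundle M N)) f (vert_comp M N U D x e) =
          \<omega> (x, e) - dreal (bundle_total (hom_bundle M N)) f (hor_comp M N K U x e)))"

end

theory Submission
  imports Defs
begin

text \<open>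
  All weak derivatives involved are tested on countably many compactly supported functions on
  \<open>H = T\<^sup>*M \<otimes> TN\<close>, namely bumps and products of bumps with coordinates, which separate tangent
  vectors. Uniqueness of \<open>T\<^sup>2u\<close> and the measurability of its coordinates follow from this. A covariant
  derivative \<open>D\<close> yields the colocal weak derivative \<open>Vert \<circ> D + Hor \<circ> Tu\<close>, and applying \<open>K\<close> recovers
  \<open>D\<close>, since \<open>K\<close> inverts \<open>Vert\<close> and vanishes on horizontal vectors.

  Conversely \<open>D = K \<circ> T\<^sup>2u\<close> requires that \<open>T\<pi> \<circ> T\<^sup>2u = (id, Tu)\<close> almost everywhere. Functions pulled back
  along the projection \<open>\<pi>\<close> of \<open>H\<close> to \<open>M \<times> N\<close> are not compactly supported, so the definition of
  \<open>T\<^sup>2u\<close> does not apply to them. Multiplying by a bump \<open>\<beta>\<close> and comparing the chain rule on \<open>H\<close> with the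
  product rule for bounded weakly differentiable functions, which is proved by mollification, gives the
  identity where \<open>\<beta>\<close> is positive.
\<close>

section \<open>Calculus of C1 maps\<close>

text \<open>A colocal derivative has to be measurable on all of TM, but
  \<open>Vert \<circ> D + Hor \<circ> Tu\<close> shows no measurability of its own, since horizontal
  lifts are definite descriptions. The locale \<open>colocal_derivative\<close> therefore asks only
  for pointwise values, linearity a.e. and the chain rule on test functions. Weak derivatives are
  locally integrable, hence measurable in charts, and a coordinate of a tangent vector is a quotient
  built from two differentials of compactly supported functions
  (\<open>coordinate_of_dreal\<close>), so measurability follows from the chain rule. In the other
  direction it comes from the continuity of \<open>K\<close>. In the product rule the derivatives
  are only locally integrable and just the two functions are bounded. It suffices to mollify one
  factor: L1 convergence handles the terms with a bounded cofactor, a subsequence converging a.e.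
  the remaining one. Chart changes of \<open>H\<close> contain first derivatives of those of
  \<open>M\<close> and \<open>N\<close>, so \<open>H\<close> is only C1; test functions of class C1
  are what it can carry.\<close>

lemma Ck1_iff: "Ck 1 S f \<longleftrightarrow> (\<forall>z\<in>S. f differentiable (at z)) \<and>
    (\<forall>w. continuous_on S (\<lambda>z. frechet_derivative f (at z) w))"
  by (simp only: One_nat_def Ck.simps)

lemma Ck1I:
  assumes "\<And>z. z \<in> S \<Longrightarrow> (f has_derivative f' z) (at z)"
    and "\<And>w. continuous_on S (\<lambda>z. f' z w)"
  shows "Ck 1 S f"
proof -
  have "frechet_derivative f (at z) = f' z" if "z \<in> S" for z
    using assms(1)[OF that] by (rule frechet_derivative_at[symmetric])
  then have "continuous_on S (\<lambda>z. frechet_derivative f (at z) w)" for w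
    using assms(2)[of w] by (simp cong: continuous_on_cong)
  then show ?thesis
    using assms(1) by (auto simp: Ck1_iff differentiable_def)
qed

lemma Ck1_has_derivative:
  "Ck 1 S f \<Longrightarrow> z \<in> S \<Longrightarrow> (f has_derivative frechet_derivative f (at z)) (at z)"
  by (simp add: Ck1_iff frechet_derivative_works[symmetric])

lemma Ck1_continuous_derivative:
  "Ck 1 S f \<Longrightarrow> continuous_on S (\<lambda>z. frechet_derivative f (at z) w)"
  by (simp add: Ck1_iff)

lemma Ck1_continuous_on: "Ck 1 S f \<Longrightarrow> continuous_on S f"
  by (meson Ck1_has_derivative continuous_at_imp_continuous_on has_derivative_continuous)

lemma Ck1_mono: "Ck 1 T f \<Longrightarrow> S \<subseteq> T \<Longrightarrow> Ck 1 S f"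
  by (auto simp: Ck1_iff intro: continuous_on_subset)

lemma Ck1_cong_open:
  assumes "open S" "\<And>z. z \<in> S \<Longrightarrow> f z = g z" "Ck 1 S f"
  shows "Ck 1 S g"
proof (rule Ck1I)
  show "(g has_derivative frechet_derivative f (at z)) (at z)" if "z \<in> S" for z
    using has_derivative_transform_within_open[OF Ck1_has_derivative[OF assms(3) that] assms(1) that assms(2)]
    by simp
qed (rule Ck1_continuous_derivative[OF assms(3)])

lemma Ck1_Un_open:
  assumes "open S" "open T" "Ck 1 S f" "Ck 1 T f"
  shows "Ck 1 (S \<union> T) f"
  using assms by (auto simp: Ck1_iff intro: continuous_on_open_Un)

lemma linear_expand_Basis:
  assumes "linear L"
  shows "L v = (\<Sum>b\<in>Basis. (v \<bullet> b) *\<^sub>R L (b::'a::euclidean_space))"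
proof -
  have "L v = L (\<Sum>b\<in>Basis. (v \<bullet> b) *\<^sub>R b)" by (simp add: euclidean_representation)
  then show ?thesis by (simp add: linear_sum[OF assms] linear_scale[OF assms])
qed

lemma Ck1_compose:
  assumes f: "Ck 1 S f" and g: "Ck 1 T g" and sub: "f ` S \<subseteq> T"
  shows "Ck 1 S (g \<circ> f)"
proof (rule Ck1I)
  show "(g \<circ> f has_derivative (\<lambda>w. frechet_derivative g (at (f z)) (frechet_derivative f (at z) w))) (at z)"
    if "z \<in> S" for z
    using diff_chain_at[OF Ck1_has_derivative[OF f that] Ck1_has_derivative[OF g]] sub that
    by (auto simp: o_def)
  fix w
  \<comment> \<open>\<open>Ck\<close> gives continuity of the derivative of \<open>g\<close> for
    each fixed direction only, while here the direction moves with \<open>z\<close>. Expanding it in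
    \<open>Basis\<close> leaves fixed directions with continuous coefficients.\<close>
  have "frechet_derivative g (at (f z)) (frechet_derivative f (at z) w) =
     (\<Sum>b\<in>Basis. (frechet_derivative f (at z) w \<bullet> b) *\<^sub>R frechet_derivative g (at (f z)) b)"
    if "z \<in> S" for z
    using sub that
    by (intro linear_expand_Basis has_derivative_linear[OF Ck1_has_derivative[OF g]]) auto
  moreover have "continuous_on S (\<lambda>z. frechet_derivative g (at (f z)) b)" for b
    using continuous_on_compose2[OF Ck1_continuous_derivative[OF g] Ck1_continuous_on[OF f]] sub by auto
  then have "continuous_on S (\<lambda>z. \<Sum>b\<in>Basis. (frechet_derivative f (at z) w \<bullet> b) *\<^sub>R
      frechet_derivative g (at (f z)) b)"
    by (intro continuous_intros Ck1_continuous_derivative[OF f])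
  ultimately show "continuous_on S (\<lambda>z. frechet_derivative g (at (f z)) (frechet_derivative f (at z) w))"
    by (simp cong: continuous_on_cong)
qed

lemma Ck1_bounded_linear: "bounded_linear L \<Longrightarrow> Ck 1 S L"
  by (rule Ck1I[OF bounded_linear_imp_has_derivative]) auto

lemma Ck1_const: "Ck 1 S (\<lambda>z. c)"
  by (rule Ck1I[OF has_derivative_const]) auto

lemma Ck1_linear_compose:
  assumes "bounded_linear L" "Ck 1 S f" shows "Ck 1 S (\<lambda>z. L (f z))"
  using Ck1_compose[OF assms(2) Ck1_bounded_linear[OF assms(1)], of UNIV] by (simp add: o_def)

lemma Ck1_add:
  assumes f: "Ck 1 S f" and g: "Ck 1 S g" shows "Ck 1 S (\<lambda>z. f z + g z)"
  by (rule Ck1I[OF has_derivative_add[OF Ck1_has_derivative[OF f] Ck1_has_derivative[OF g]]])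
    (assumption | intro continuous_intros Ck1_continuous_derivative[OF f] Ck1_continuous_derivative[OF g])+

lemma Ck1_sum:
  assumes "\<And>i. i \<in> I \<Longrightarrow> Ck 1 S (f i)" shows "Ck 1 S (\<lambda>z. \<Sum>i\<in>I. f i z)"
proof (cases "finite I")
  case True then show ?thesis using assms
    by (induction I rule: finite_induct) (auto intro: Ck1_add Ck1_const simp del: One_nat_def)
qed (simp add: Ck1_const del: One_nat_def)

lemma Ck1_mult:
  fixes f g :: "'a::euclidean_space \<Rightarrow> real"
  assumes f: "Ck 1 S f" and g: "Ck 1 S g" shows "Ck 1 S (\<lambda>z. f z * g z)"
  by (rule Ck1I[OF has_derivative_mult[OF Ck1_has_derivative[OF f] Ck1_has_derivative[OF g]]])
    (assumption | intro continuous_intros Ck1_continuous_derivative[OF f] Ck1_continuous_derivative[OF g]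
      Ck1_continuous_on[OF f] Ck1_continuous_on[OF g])+

lemma Ck1_scaleR_const: "Ck 1 S f \<Longrightarrow> Ck 1 S (\<lambda>z. f z *\<^sub>R c)"
  by (rule Ck1_linear_compose[OF bounded_linear_scaleR_left])

lemma Ck1_componentwise:
  fixes f :: "'a::euclidean_space \<Rightarrow> 'b::euclidean_space"
  assumes "\<And>b. b \<in> Basis \<Longrightarrow> Ck 1 S (\<lambda>z. f z \<bullet> b)"
  shows "Ck 1 S f"
proof -
  have "Ck 1 S (\<lambda>z. \<Sum>b\<in>Basis. (f z \<bullet> b) *\<^sub>R b)"
    by (intro Ck1_sum Ck1_scaleR_const assms)
  then show ?thesis by (simp add: euclidean_representation)
qed

lemma Ck1_Pair:
  assumes "Ck 1 S f" "Ck 1 S g" shows "Ck 1 S (\<lambda>z. (f z, g z))"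
  by (rule Ck1I[OF has_derivative_Pair[OF Ck1_has_derivative[OF assms(1)] Ck1_has_derivative[OF assms(2)]]])
    (assumption | intro continuous_intros Ck1_continuous_derivative[OF assms(1)] Ck1_continuous_derivative[OF assms(2)])+

lemma Ck2_imp_Ck1: "Ck 2 S f \<Longrightarrow> Ck 1 S f"
  and Ck2_derivative: "Ck 2 S f \<Longrightarrow> Ck 1 S (\<lambda>z. frechet_derivative f (at z) w)"
proof -
  assume "Ck 2 S f"
  then have "Ck (Suc 1) S f" by (simp only: Suc_1)
  then show "Ck 1 S f" "Ck 1 S (\<lambda>z. frechet_derivative f (at z) w)"
    unfolding Ck1_iff[of S f] Ck.simps(2) by (auto intro: Ck1_continuous_on)
qed

section \<open>C1 bump functions\<close>

definition bump :: "'a::euclidean_space \<Rightarrow> real \<Rightarrow> 'a \<Rightarrow> real" where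
  "bump q r z = (max 0 (r\<^sup>2 - (norm (z - q))\<^sup>2))\<^sup>2"

lemma bump_nonneg: "bump q r z \<ge> 0"
  by (simp add: bump_def)

lemma bump_pos: "z \<in> ball q r \<Longrightarrow> bump q r z > 0"
  unfolding bump_def mem_ball dist_norm
  using power_strict_mono[of "norm (z - q)" r 2] by (simp add: norm_minus_commute)

lemma bump_eq_0: "z \<notin> ball q r \<Longrightarrow> r \<ge> 0 \<Longrightarrow> bump q r z = 0"
  unfolding bump_def mem_ball dist_norm
  by (simp add: norm_minus_commute power_mono max_def)

lemma DERIV_max_0_square: "((\<lambda>s::real. (max 0 s)\<^sup>2) has_real_derivative 2 * max 0 s) (at s)"
proof -
  consider "s > 0" | "s < 0" | "s = 0" by linarith
  then show ?thesis
  proof cases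
    case 1
    have "((\<lambda>s::real. s\<^sup>2) has_real_derivative 2 * s) (at s)"
      by (auto intro!: derivative_eq_intros)
    then show ?thesis
      using 1 by (subst DERIV_cong_ev[OF refl _ refl, of _ "\<lambda>s. s\<^sup>2"])
        (auto intro!: eventually_mono[OF eventually_nhds_in_open[of "{0<..}" s]])
  next
    case 2
    have "((\<lambda>s::real. 0) has_real_derivative 0) (at s)" by simp
    then show ?thesis
      using 2 by (subst DERIV_cong_ev[OF refl _ refl, of _ "\<lambda>s. 0"])
        (auto intro!: eventually_mono[OF eventually_nhds_in_open[of "{..<0}" s]])
  next
    case 3
    have "((\<lambda>h::real. (max 0 h)\<^sup>2 / h) \<longlongrightarrow> 0) (at 0)"
    proof (rule Lim_null_comparison)
      show "\<forall>\<^sub>F h in at 0. norm ((max 0 h)\<^sup>2 / h) \<le> \<bar>h\<bar>"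
        by (auto simp: eventually_at_filter max_def power2_eq_square)
      show "((\<lambda>h::real. \<bar>h\<bar>) \<longlongrightarrow> 0) (at 0)"
        by (auto intro!: tendsto_eq_intros)
    qed
    then show ?thesis using 3 by (simp add: DERIV_def)
  qed
qed

text \<open>The positive part has a corner on the sphere, but its square is C1 there
  (\<open>DERIV_max_0_square\<close>). Test functions and \<open>C1c\<close> ask for C1 only, so
  this explicit formula can stand in for a smooth bump.\<close>

lemma Ck1_bump: "Ck 1 S (bump q r)"
proof (rule Ck1I)
  fix z
  have "((\<lambda>z. r\<^sup>2 - (norm (z - q))\<^sup>2) has_derivative (\<lambda>w. - (2 * ((z - q) \<bullet> w)))) (at z)"
    unfolding power2_norm_eq_inner
    by (auto intro!: derivative_eq_intros simp: inner_commute)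
  from DERIV_compose_FDERIV[OF DERIV_max_0_square this]
  show "(bump q r has_derivative
      (\<lambda>w. - (2 * ((z - q) \<bullet> w)) * (2 * max 0 (r\<^sup>2 - (norm (z - q))\<^sup>2)))) (at z)"
    unfolding bump_def[abs_def] .
qed (intro continuous_intros)

section \<open>Mollification\<close>

lemma lborel_integrable_translate:
  fixes f :: "'a::euclidean_space \<Rightarrow> real"
  assumes "integrable lborel f"
  shows "integrable lborel (\<lambda>x. f (x + t))" and "(\<integral>x. f (x + t) \<partial>lborel) = (\<integral>x. f x \<partial>lborel)"
proof -
  have [measurable]: "f \<in> borel_measurable borel" using assms by auto
  have "integrable (distr lborel borel ((+) t)) f"
    using assms by (simp add: lborel_distr_plus)
  then show "integrable lborel (\<lambda>x. f (x + t))"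
    by (subst (asm) integrable_distr_eq) (auto simp: add.commute)
  have "(\<integral>x. f x \<partial>lborel) = (\<integral>x. f x \<partial>distr lborel borel ((+) t))"
    by (simp add: lborel_distr_plus)
  then show "(\<integral>x. f (x + t) \<partial>lborel) = (\<integral>x. f x \<partial>lborel)"
    by (subst (asm) integral_distr) (auto simp: add.commute)
qed

text \<open>By translation invariance the mass entering \<open>U\<close> equals the mass leaving it,
  so the integral is twice that of \<open>?g n\<close>, the indicator of the points of
  \<open>U\<close> whose translate lies outside. For open \<open>U\<close> it tends to 0 pointwise,
  dominated by the indicator of \<open>U\<close>; the entering part could fail to do so on the
  boundary.\<close>

lemma translation_L1_open:
  fixes U :: "'a::euclidean_space set"
  assumes "open U" and fin: "emeasure lborel U < \<infinity>" and X: "X \<longlonglongrightarrow> 0"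
  shows "(\<lambda>n. \<integral>x. \<bar>indicator U (x + X n) - indicator U x :: real\<bar> \<partial>lborel) \<longlonglongrightarrow> 0"
proof -
  have [measurable]: "U \<in> sets borel" using assms by simp
  have iU: "integrable lborel (indicator U :: 'a \<Rightarrow> real)"
    using fin by (simp add: integrable_real_indicator)
  let ?g = "\<lambda>n x. indicator U x * (1 - indicator U (x + X n)) :: real"
  have ig: "integrable lborel (?g n)" for n
    by (rule Bochner_Integration.integrable_bound[OF iU]) (auto simp: indicator_def)
  have "\<bar>indicator U (x + X n) - indicator U x :: real\<bar> =
      2 * ?g n x + (indicator U (x + X n) - indicator U x)" for n x
    by (auto simp: indicator_def)
  then have eq: "(\<integral>x. \<bar>indicator U (x + X n) - indicator U x :: real\<bar> \<partial>lborel) = 2 * (\<integral>x. ?g n x \<partial>lborel)" for n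
    using lborel_integrable_translate[OF iU, of "X n"] iU ig[of n]
    by (simp add: Bochner_Integration.integral_add Bochner_Integration.integral_diff)
  have "(\<lambda>n. \<integral>x. ?g n x \<partial>lborel) \<longlonglongrightarrow> (\<integral>x. 0 \<partial>(lborel::'a measure))"
  proof (rule integral_dominated_convergence[OF _ _ iU])
    show "AE x in lborel. (\<lambda>n. ?g n x) \<longlonglongrightarrow> 0"
    proof (rule AE_I2)
      fix x
      show "(\<lambda>n. ?g n x) \<longlonglongrightarrow> 0"
      proof (cases "x \<in> U")
        case True
        have "(\<lambda>n. x + X n) \<longlonglongrightarrow> x" using tendsto_add[OF tendsto_const X, of x] by simp
        then have "\<forall>\<^sub>F n in sequentially. x + X n \<in> U"
          using \<open>open U\<close> True by (auto dest: topological_tendstoD)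
        then have "\<forall>\<^sub>F n in sequentially. ?g n x = 0"
          by eventually_elim auto
        then show ?thesis by (rule tendsto_eventually)
      qed simp
    qed
  qed (auto simp: indicator_def)
  then show ?thesis unfolding eq by (auto intro!: tendsto_eq_intros)
qed

lemma tendsto_0_approx:
  fixes a :: "nat \<Rightarrow> real"
  assumes "\<And>n. a n \<ge> 0"
    and "\<And>e. e > 0 \<Longrightarrow> \<exists>b. b \<longlonglongrightarrow> 0 \<and> (\<forall>\<^sub>F n in sequentially. a n \<le> b n + e)"
  shows "a \<longlonglongrightarrow> 0"
proof (rule tendstoI)
  fix e :: real assume "e > 0"
  then obtain b where b: "b \<longlonglongrightarrow> 0" "\<forall>\<^sub>F n in sequentially. a n \<le> b n + e/2"
    using assms(2)[of "e/2"] by auto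
  from order_tendstoD(2)[OF b(1), of "e/2"] \<open>e > 0\<close> have "\<forall>\<^sub>F n in sequentially. b n < e/2" by simp
  with b(2) show "\<forall>\<^sub>F n in sequentially. dist (a n) 0 < e"
    by eventually_elim (use assms(1) in \<open>auto simp: dist_real_def abs_of_nonneg\<close>)
qed

text \<open>Continuity of translations in L1, by density: a Borel set of finite measure is
  approximated from outside by open sets, and the claim survives sums and dominated limits.
  Sequences of translations are used because dominated convergence is.\<close>

lemma translation_L1:
  fixes f :: "'a::euclidean_space \<Rightarrow> real"
  assumes "integrable lborel f" and X: "X \<longlonglongrightarrow> 0"
  shows "(\<lambda>n. \<integral>x. \<bar>f (x + X n) - f x\<bar> \<partial>lborel) \<longlonglongrightarrow> 0"
  using assms(1)
proof (induction rule: integrable_induct)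
  case (base A c)
  then have [measurable]: "A \<in> sets borel" by simp
  have iA: "integrable lborel (indicator A :: 'a \<Rightarrow> real)"
    using base by (simp add: integrable_real_indicator)
  have "(\<lambda>n. \<integral>x. \<bar>indicator A (x + X n) - indicator A x :: real\<bar> \<partial>lborel) \<longlonglongrightarrow> 0"
  proof (rule tendsto_0_approx)
    fix e :: real assume "e > 0"
    \<comment> \<open>Replacing \<open>A\<close> by \<open>U\<close> changes the integrand by at
      most the indicator of \<open>U - A\<close> at \<open>x\<close> and at its translate, each of
      integral at most \<open>e/2\<close>.\<close>
    obtain U where U: "open U" "A \<subseteq> U" "emeasure lborel (U - A) < e/2"
      using outer_regular_lborel[of A "e/2"] \<open>e > 0\<close> by auto
    have [measurable]: "U \<in> sets borel" using U by simp
    have "U = A \<union> (U - A)" using U by auto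
    moreover have "emeasure lborel (A \<union> (U - A)) \<le> emeasure lborel A + emeasure lborel (U - A)"
      by (rule emeasure_subadditive) auto
    ultimately have finU: "emeasure lborel U < \<infinity>"
      using base(2) less_trans[OF U(3) ennreal_less_top]
      by (metis ennreal_add_eq_top infinity_ennreal_def less_top order_le_less_trans)
    have iU: "integrable lborel (indicator U :: 'a \<Rightarrow> real)"
      using finU by (simp add: integrable_real_indicator)
    let ?d = "\<lambda>x. indicator (U - A) x :: real"
    have finD: "emeasure lborel (U - A) < \<infinity>" using U(3) by (auto intro: less_trans)
    then have id: "integrable lborel ?d" by (simp add: integrable_real_indicator)
    have "(\<integral>x. ?d x \<partial>lborel) = measure lborel (U - A)" by simp
    moreover have "measure lborel (U - A) \<le> e/2"
      unfolding measure_def using U(3) \<open>e > 0\<close> by (intro enn2real_leI) auto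
    ultimately have d: "(\<integral>x. ?d x \<partial>lborel) \<le> e/2" by simp
    have "(\<integral>x. \<bar>indicator A (x + X n) - indicator A x :: real\<bar> \<partial>lborel) \<le>
        (\<integral>x. \<bar>indicator U (x + X n) - indicator U x :: real\<bar> \<partial>lborel) + e" for n
    proof -
      have "(\<integral>x. \<bar>indicator A (x + X n) - indicator A x :: real\<bar> \<partial>lborel) \<le>
        (\<integral>x. (\<bar>indicator U (x + X n) - indicator U x :: real\<bar> + ?d (x + X n)) + ?d x \<partial>lborel)"
        using U(2) by (intro integral_mono Bochner_Integration.integrable_add integrable_abs Bochner_Integration.integrable_diff
            lborel_integrable_translate iA iU id) (auto simp: indicator_def)
      also have "\<dots> = (\<integral>x. \<bar>indicator U (x + X n) - indicator U x :: real\<bar> \<partial>lborel) + (\<integral>x. ?d (x + X n) \<partial>lborel) + (\<integral>x. ?d x \<partial>lborel)"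
        by (intro Bochner_Integration.integral_add[THEN trans] arg_cong2[of _ _ _ _ "(+)"] refl
          Bochner_Integration.integral_add Bochner_Integration.integrable_add integrable_abs Bochner_Integration.integrable_diff
            lborel_integrable_translate iA iU id)
      finally show ?thesis
        using d lborel_integrable_translate(2)[OF id, of "X n"] by simp
    qed
    then show "\<exists>b. b \<longlonglongrightarrow> 0 \<and> (\<forall>\<^sub>F n in sequentially.
        (\<integral>x. \<bar>indicator A (x + X n) - indicator A x :: real\<bar> \<partial>lborel) \<le> b n + e)"
      using translation_L1_open[OF U(1) finU X] by (auto intro!: always_eventually)
  qed simp
  then have "(\<lambda>n. (\<integral>x. \<bar>indicator A (x + X n) - indicator A x :: real\<bar> \<partial>lborel) * \<bar>c\<bar>) \<longlonglongrightarrow> 0"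
    by (auto intro!: tendsto_eq_intros)
  then show ?case
    by (simp add: left_diff_distrib[symmetric] abs_mult)
next
  case (add f g)
  have *: "(\<lambda>n. (\<integral>x. \<bar>f (x + X n) - f x\<bar> \<partial>lborel) + (\<integral>x. \<bar>g (x + X n) - g x\<bar> \<partial>lborel)) \<longlonglongrightarrow> 0"
    using tendsto_add[OF add(3,4)] by simp
  show ?case
  proof (rule tendsto_sandwich[OF _ _ tendsto_const *])
    show "\<forall>\<^sub>F n in sequentially. (\<integral>x. \<bar>f (x + X n) + g (x + X n) - (f x + g x)\<bar> \<partial>lborel) \<le>
       (\<integral>x. \<bar>f (x + X n) - f x\<bar> \<partial>lborel) + (\<integral>x. \<bar>g (x + X n) - g x\<bar> \<partial>lborel)"
    proof (intro always_eventually allI)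
      fix n
      note int = integrable_abs Bochner_Integration.integrable_diff lborel_integrable_translate(1) add(1,2)
      have "(\<integral>x. \<bar>f (x + X n) + g (x + X n) - (f x + g x)\<bar> \<partial>lborel) \<le>
          (\<integral>x. \<bar>f (x + X n) - f x\<bar> + \<bar>g (x + X n) - g x\<bar> \<partial>lborel)"
        by (intro integral_mono Bochner_Integration.integrable_add int) auto
      also have "\<dots> = (\<integral>x. \<bar>f (x + X n) - f x\<bar> \<partial>lborel) + (\<integral>x. \<bar>g (x + X n) - g x\<bar> \<partial>lborel)"
        by (intro Bochner_Integration.integral_add int)
      finally show "(\<integral>x. \<bar>f (x + X n) + g (x + X n) - (f x + g x)\<bar> \<partial>lborel) \<le>
          (\<integral>x. \<bar>f (x + X n) - f x\<bar> \<partial>lborel) + (\<integral>x. \<bar>g (x + X n) - g x\<bar> \<partial>lborel)" .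
    qed
  qed auto
next
  case (lim f s)
  show ?case
  proof (rule tendsto_0_approx)
    fix e :: real assume "e > 0"
    have "(\<lambda>i. \<integral>x. \<bar>s i x - f x\<bar> \<partial>lborel) \<longlonglongrightarrow> (\<integral>x. 0 \<partial>(lborel::'a measure))"
    proof (rule integral_dominated_convergence)
      \<comment> \<open>The induction rule bounds the simple functions \<open>s i\<close> by twice
        the absolute value of \<open>f\<close>; subtracting \<open>f\<close> costs one more.\<close>
      show "integrable lborel (\<lambda>x. 3 * \<bar>f x\<bar>)" using lim(4) by auto
      show "AE x in lborel. (\<lambda>i. \<bar>s i x - f x\<bar>) \<longlonglongrightarrow> 0"
        using lim(2) by (auto intro!: AE_I2 tendsto_rabs_zero simp: LIM_zero_iff)
      show "AE x in lborel. norm \<bar>s i x - f x\<bar> \<le> 3 * \<bar>f x\<bar>" for i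
      proof (rule AE_I2)
        show "norm \<bar>s i x - f x\<bar> \<le> 3 * \<bar>f x\<bar>" for x using lim(3)[of x i] by simp
      qed
    qed (use lim(1,4) in auto)
    then have "\<forall>\<^sub>F i in sequentially. (\<integral>x. \<bar>s i x - f x\<bar> \<partial>lborel) < e/2"
      using \<open>e > 0\<close> by (intro order_tendstoD) auto
    then obtain i where i: "(\<integral>x. \<bar>s i x - f x\<bar> \<partial>lborel) < e/2"
      by (auto simp: eventually_sequentially)
    let ?d = "\<lambda>x. \<bar>s i x - f x\<bar>"
    have id: "integrable lborel ?d" using lim(1,4) by auto
    have "(\<integral>x. \<bar>f (x + X n) - f x\<bar> \<partial>lborel) \<le> (\<integral>x. \<bar>s i (x + X n) - s i x\<bar> \<partial>lborel) + e" for n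
    proof -
      note int = integrable_abs Bochner_Integration.integrable_diff lborel_integrable_translate lim(1,4) id
      have "(\<integral>x. \<bar>f (x + X n) - f x\<bar> \<partial>lborel) \<le> (\<integral>x. (\<bar>s i (x + X n) - s i x\<bar> + ?d (x + X n)) + ?d x \<partial>lborel)"
        by (intro integral_mono Bochner_Integration.integrable_add int) auto
      also have "\<dots> = (\<integral>x. \<bar>s i (x + X n) - s i x\<bar> \<partial>lborel) + (\<integral>x. ?d (x + X n) \<partial>lborel) + (\<integral>x. ?d x \<partial>lborel)"
        by (intro Bochner_Integration.integral_add[THEN trans] arg_cong2[of _ _ _ _ "(+)"] refl
          Bochner_Integration.integral_add Bochner_Integration.integrable_add int)
      finally show ?thesis
        using i lborel_integrable_translate(2)[OF id, of "X n"] by simp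
    qed
    then show "\<exists>b. b \<longlonglongrightarrow> 0 \<and> (\<forall>\<^sub>F n in sequentially. (\<integral>x. \<bar>f (x + X n) - f x\<bar> \<partial>lborel) \<le> b n + e)"
      using lim(5)[of i] by (auto intro!: always_eventually)
  qed simp
qed

text \<open>A mollifier averages over a whole ball of translations, so the bound must hold for all
  small \<open>t\<close> at once. A failure would yield a null sequence contradicting
  \<open>translation_L1\<close>.\<close>

lemma translation_L1_uniform:
  fixes f :: "'a::euclidean_space \<Rightarrow> real"
  assumes "integrable lborel f" "e > 0"
  shows "\<exists>d>0. \<forall>t. norm t < d \<longrightarrow> (\<integral>x. \<bar>f (x + t) - f x\<bar> \<partial>lborel) \<le> e"
proof (rule ccontr)
  assume "\<not> ?thesis"
  then have "\<exists>t. norm t < 1 / real (Suc n) \<and> (\<integral>x. \<bar>f (x + t) - f x\<bar> \<partial>lborel) > e" for n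
    by (metis not_le zero_less_divide_1_iff of_nat_0_less_iff zero_less_Suc)
  then obtain X where X: "\<And>n. norm (X n) < 1 / real (Suc n)"
      "\<And>n. (\<integral>x. \<bar>f (x + X n) - f x\<bar> \<partial>lborel) > e" by metis
  have "X \<longlonglongrightarrow> 0"
    by (rule Lim_null_comparison[OF _ LIMSEQ_inverse_real_of_nat])
      (auto intro!: always_eventually less_imp_le[OF order.strict_trans2[OF X(1)]] simp: inverse_eq_divide)
  from order_tendstoD(2)[OF translation_L1[OF assms(1) this] assms(2)] X(2)
  show False by (auto simp: eventually_sequentially dest: less_asym)
qed

text \<open>A tensor product of integrable functions times a bounded kernel. It licenses the
  exchange of integrals in \<open>kernel_swap\<close>.\<close>

lemma integrable_kernel:
  fixes a b k :: "'a::euclidean_space \<Rightarrow> real"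
  assumes a: "integrable lborel a" and b: "integrable lborel b"
    and k[measurable]: "k \<in> borel_measurable borel" and B: "\<And>v. \<bar>k v\<bar> \<le> B"
  shows "integrable (lborel \<Otimes>\<^sub>M lborel) (\<lambda>(x, y). a x * k (y - x) * b y)"
proof -
  have [measurable]: "a \<in> borel_measurable borel" "b \<in> borel_measurable borel" using a b by auto
  have "integrable (lborel \<Otimes>\<^sub>M lborel) (\<lambda>(x, y). a x * b y)"
    by (rule lborel_pair.Fubini_integrable) (use a b in \<open>auto simp: abs_mult\<close>)
  then have "integrable (lborel \<Otimes>\<^sub>M lborel) (\<lambda>p. B * (case p of (x, y) \<Rightarrow> a x * b y))"
    by (rule integrable_mult_right)
  then show ?thesis
  proof (rule Bochner_Integration.integrable_bound)
    show "AE p in lborel \<Otimes>\<^sub>M lborel. norm (case p of (x, y) \<Rightarrow> a x * k (y - x) * b y) \<le>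
        norm (B * (case p of (x, y) \<Rightarrow> a x * b y))"
    proof (intro AE_I2, clarsimp simp: abs_mult)
      fix x y
      have "\<bar>a x\<bar> * \<bar>k (y - x)\<bar> * \<bar>b y\<bar> = \<bar>k (y - x)\<bar> * (\<bar>a x\<bar> * \<bar>b y\<bar>)" by simp
      also have "\<dots> \<le> \<bar>B\<bar> * (\<bar>a x\<bar> * \<bar>b y\<bar>)"
        using B[of "y - x"] by (intro mult_right_mono) auto
      finally show "\<bar>a x\<bar> * \<bar>k (y - x)\<bar> * \<bar>b y\<bar> \<le> \<bar>B\<bar> * (\<bar>a x\<bar> * \<bar>b y\<bar>)" .
    qed
  qed measurable
qed

text \<open>Convolution with the reflected kernel. In this form the kernel is a translate of
  \<open>k\<close> as a function of the integration variable \<open>y\<close>, hence directly a test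
  function.\<close>

definition mollify :: "('a::euclidean_space \<Rightarrow> real) \<Rightarrow> ('a \<Rightarrow> real) \<Rightarrow> 'a \<Rightarrow> real" where
  "mollify k f x = (\<integral>y. k (y - x) * f y \<partial>lborel)"

text \<open>Fubini moves the mollification from \<open>b\<close> to \<open>a\<close>. In the product
  rule this permits testing in \<open>x\<close> with \<open>y\<close> held fixed, so that no
  derivative is taken under an integral sign.\<close>

lemma kernel_swap:
  fixes a b k :: "'a::euclidean_space \<Rightarrow> real"
  assumes a: "integrable lborel a" and b: "integrable lborel b"
    and k: "k \<in> borel_measurable borel" and B: "\<And>v. \<bar>k v\<bar> \<le> B"
  shows "(\<integral>x. a x * mollify k b x \<partial>lborel) = (\<integral>y. b y * (\<integral>x. a x * k (y - x) \<partial>lborel) \<partial>lborel)"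
proof -
  have "(\<integral>x. a x * mollify k b x \<partial>lborel) = (\<integral>x. \<integral>y. a x * k (y - x) * b y \<partial>lborel \<partial>lborel)"
    by (simp add: mollify_def mult.assoc flip: integral_mult_right_zero)
  also have "\<dots> = (\<integral>y. \<integral>x. a x * k (y - x) * b y \<partial>lborel \<partial>lborel)"
    by (rule lborel_pair.Fubini_integral[OF integrable_kernel[OF assms], symmetric])
  also have "\<dots> = (\<integral>y. b y * (\<integral>x. a x * k (y - x) \<partial>lborel) \<partial>lborel)"
    by (simp add: mult.commute[of "b _"] flip: integral_mult_left_zero)
  finally show ?thesis .
qed

lemma borel_measurable_mollify:
  assumes [measurable]: "k \<in> borel_measurable borel" "f \<in> borel_measurable borel"
  shows "mollify k f \<in> borel_measurable borel"
  unfolding mollify_def[abs_def] by measurable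

definition mollifier :: "real \<Rightarrow> 'a::euclidean_space \<Rightarrow> real" where
  "mollifier d v = bump 0 d v / (\<integral>v. bump 0 d (v::'a) \<partial>lborel)"

lemma integrable_bump: "d > 0 \<Longrightarrow> integrable lborel (bump (q::'a::euclidean_space) d)"
proof -
  assume "d > 0"
  have "integrable lborel (\<lambda>x. indicator (cball q d) x *\<^sub>R bump q d x)"
    by (rule borel_integrable_compact[OF compact_cball Ck1_continuous_on[OF Ck1_bump]])
  moreover have "(\<lambda>x. indicator (cball q d) x *\<^sub>R bump q d x) = bump q d"
    using \<open>d > 0\<close> bump_eq_0[of _ q d] by (auto simp: indicator_def fun_eq_iff)
  ultimately show ?thesis by simp
qed

lemma integral_bump_pos: "d > 0 \<Longrightarrow> (\<integral>v. bump (q::'a::euclidean_space) d v \<partial>lborel) > 0"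
proof -
  assume "d > 0"
  have "(\<integral>v. bump q d v \<partial>lborel) \<noteq> 0"
  proof
    assume "(\<integral>v. bump q d v \<partial>lborel) = 0"
    then have "AE v in lborel. bump q d v = 0"
      using integral_nonneg_eq_0_iff_AE[OF integrable_bump[OF \<open>d > 0\<close>, of q]] by (simp add: bump_nonneg)
    then have "AE v in lborel. v \<notin> ball q d"
      by eventually_elim (use bump_pos[of _ q d] in force)
    then have "emeasure lborel (ball q d) = 0"
      by (subst (asm) AE_iff_measurable[of "ball q d"]) auto
    moreover have "\<not> negligible (ball q d)"
      using open_not_negligible[of "ball q d"] \<open>d > 0\<close> by auto
    ultimately show False
      by (simp add: negligible_iff_null_sets null_sets_def)
  qed
  moreover have "(\<integral>v. bump q d v \<partial>lborel) \<ge> 0"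
    by (intro Bochner_Integration.integral_nonneg) (simp add: bump_nonneg)
  ultimately show ?thesis by simp
qed

lemma
  assumes "d > 0"
  shows mollifier_nonneg: "mollifier d v \<ge> 0"
    and mollifier_eq_0: "norm v \<ge> d \<Longrightarrow> mollifier d v = 0"
    and integrable_mollifier: "integrable lborel (mollifier d :: 'a::euclidean_space \<Rightarrow> real)"
    and integral_mollifier: "(\<integral>v. mollifier d (v::'a) \<partial>lborel) = 1"
    and Ck1_mollifier: "Ck 1 S (mollifier d :: 'a \<Rightarrow> real)"
    and borel_measurable_mollifier: "(mollifier d :: 'a \<Rightarrow> real) \<in> borel_measurable borel"
    and mollifier_bounded: "\<exists>B. \<forall>v::'a. \<bar>mollifier d v\<bar> \<le> B"
proof -
  let ?c = "(\<integral>v. bump 0 d (v::'a) \<partial>lborel)"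
  have c: "?c > 0" by (rule integral_bump_pos[OF assms])
  show "mollifier d v \<ge> 0"
    unfolding mollifier_def by (auto intro!: divide_nonneg_nonneg Bochner_Integration.integral_nonneg simp: bump_nonneg)
  show "norm v \<ge> d \<Longrightarrow> mollifier d v = 0"
    using assms by (auto simp: mollifier_def intro!: bump_eq_0)
  have eq: "mollifier d = (\<lambda>v::'a. bump 0 d v * (1 / ?c))"
    by (auto simp: mollifier_def)
  show "integrable lborel (mollifier d :: 'a \<Rightarrow> real)"
    unfolding eq by (intro integrable_mult_left integrable_bump assms)
  show "(\<integral>v. mollifier d (v::'a) \<partial>lborel) = 1"
    unfolding eq using c by simp
  show C: "Ck 1 S (mollifier d :: 'a \<Rightarrow> real)" for S
    unfolding eq by (intro Ck1_mult Ck1_bump Ck1_const)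
  then have cont: "continuous_on UNIV (mollifier d :: 'a \<Rightarrow> real)" by (rule Ck1_continuous_on)
  then show "(mollifier d :: 'a \<Rightarrow> real) \<in> borel_measurable borel"
    by (rule borel_measurable_continuous_onI)
  have "bump 0 d v \<le> (d\<^sup>2)\<^sup>2" for v :: 'a
    unfolding bump_def by (intro power_mono) auto
  then have "\<bar>mollifier d v\<bar> \<le> (d\<^sup>2)\<^sup>2 / ?c" for v :: 'a
    unfolding mollifier_def using c by (simp add: divide_right_mono bump_nonneg)
  then show "\<exists>B. \<forall>v::'a. \<bar>mollifier d v\<bar> \<le> B" by blast
qed

lemma integrable_mollify:
  fixes f :: "'a::euclidean_space \<Rightarrow> real"
  assumes f: "integrable lborel f" and "d > 0"
  shows "integrable lborel (\<lambda>y. mollifier d (y - x) * f y)"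
proof -
  obtain B where B: "\<And>v::'a. \<bar>mollifier d v\<bar> \<le> B" using mollifier_bounded[OF \<open>d > 0\<close>] by blast
  have [measurable]: "(mollifier d :: 'a \<Rightarrow> real) \<in> borel_measurable borel"
    by (rule borel_measurable_mollifier[OF \<open>d > 0\<close>])
  have [measurable]: "f \<in> borel_measurable borel" using f by auto
  show ?thesis
  proof (rule Bochner_Integration.integrable_bound[OF integrable_mult_right[OF f, of B]])
    show "AE y in lborel. norm (mollifier d (y - x) * f y) \<le> norm (B * f y)"
    proof (rule AE_I2)
      fix y
      have "\<bar>mollifier d (y - x)\<bar> * \<bar>f y\<bar> \<le> \<bar>B\<bar> * \<bar>f y\<bar>"
        using B[of "y - x"] by (intro mult_right_mono) auto
      then show "norm (mollifier d (y - x) * f y) \<le> norm (B * f y)" by (simp add: abs_mult)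
    qed
  qed measurable
qed

text \<open>The mollifier has mass 1, so the difference is the average of
  \<open>f (x + v) - f x\<close> over small \<open>v\<close>, and Tonelli bounds its L1 norm by the
  average of the translation errors. The bound holds for every \<open>d\<close> below a threshold so
  that several functions can share one mollifier.\<close>

lemma mollify_L1:
  fixes f :: "'a::euclidean_space \<Rightarrow> real"
  assumes f: "integrable lborel f" and "e > 0"
  shows "\<exists>d0>0. \<forall>d. 0 < d \<and> d \<le> d0 \<longrightarrow> integrable lborel (\<lambda>x. mollify (mollifier d) f x - f x) \<and>
     (\<integral>x. \<bar>mollify (mollifier d) f x - f x\<bar> \<partial>lborel) \<le> e"
proof -
  obtain d0 where d0: "d0 > 0" "\<And>t. norm t < d0 \<Longrightarrow> (\<integral>x. \<bar>f (x + t) - f x\<bar> \<partial>lborel) \<le> e"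
    using translation_L1_uniform[OF assms] by blast
  have "integrable lborel (\<lambda>x. mollify (mollifier d) f x - f x) \<and>
     (\<integral>x. \<bar>mollify (mollifier d) f x - f x\<bar> \<partial>lborel) \<le> e" if "0 < d" "d \<le> d0" for d
  proof -
    let ?k = "mollifier d :: 'a \<Rightarrow> real"
    have k[measurable]: "?k \<in> borel_measurable borel" by (rule borel_measurable_mollifier[OF \<open>0 < d\<close>])
    have fb[measurable]: "f \<in> borel_measurable borel" using f by auto
    have [measurable]: "mollify ?k f \<in> borel_measurable borel"
      by (rule borel_measurable_mollify[OF k fb])
    have bd: "ennreal \<bar>mollify ?k f x - f x\<bar> \<le> (\<integral>\<^sup>+v. ennreal (?k v * \<bar>f (x + v) - f x\<bar>) \<partial>lborel)" for x
    proof -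
      have i1: "integrable lborel (\<lambda>v. ?k v * f (x + v))"
        using lborel_integrable_translate(1)[OF integrable_mollify[OF f \<open>0 < d\<close>, of x], of x]
        by (simp add: add.commute)
      have i2: "integrable lborel (\<lambda>v. ?k v * f x)"
        by (intro integrable_mult_left integrable_mollifier \<open>0 < d\<close>)
      have "mollify ?k f x = (\<integral>v. ?k v * f (x + v) \<partial>lborel)"
        unfolding mollify_def
        using lborel_integrable_translate(2)[OF integrable_mollify[OF f \<open>0 < d\<close>, of x], of x]
        by (simp add: add.commute)
      moreover have "f x = (\<integral>v. ?k v * f x \<partial>lborel)"
        using integral_mollifier[OF \<open>0 < d\<close>, where 'a = 'a] by simp
      ultimately have "mollify ?k f x - f x = (\<integral>v. ?k v * (f (x + v) - f x) \<partial>lborel)"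
        using Bochner_Integration.integral_diff[OF i1 i2] by (simp add: right_diff_distrib)
      moreover have "integrable lborel (\<lambda>v. ?k v * (f (x + v) - f x))"
        using Bochner_Integration.integrable_diff[OF i1 i2] by (simp add: right_diff_distrib)
      ultimately have "ennreal (norm (mollify ?k f x - f x)) \<le>
          (\<integral>\<^sup>+v. ennreal (norm (?k v * (f (x + v) - f x))) \<partial>lborel)"
        using integral_norm_bound_ennreal by metis
      then show ?thesis by (simp add: abs_mult mollifier_nonneg[OF \<open>0 < d\<close>])
    qed
    have it: "integrable lborel (\<lambda>x. \<bar>f (x + v) - f x\<bar>)" for v
      using lborel_integrable_translate(1)[OF f, of v] f by auto
    have "(\<integral>\<^sup>+x. ennreal \<bar>mollify ?k f x - f x\<bar> \<partial>lborel) \<le>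
       (\<integral>\<^sup>+x. \<integral>\<^sup>+v. ennreal (?k v * \<bar>f (x + v) - f x\<bar>) \<partial>lborel \<partial>lborel)"
      by (intro nn_integral_mono bd)
    also have "\<dots> = (\<integral>\<^sup>+v. \<integral>\<^sup>+x. ennreal (?k v * \<bar>f (x + v) - f x\<bar>) \<partial>lborel \<partial>lborel)"
      by (rule lborel_pair.Fubini'[symmetric]) measurable
    also have "\<dots> \<le> (\<integral>\<^sup>+v. ennreal (?k v * e) \<partial>lborel)"
    proof (rule nn_integral_mono)
      fix v :: 'a
      have "(\<integral>\<^sup>+x. ennreal (?k v * \<bar>f (x + v) - f x\<bar>) \<partial>lborel) = ennreal (\<integral>x. ?k v * \<bar>f (x + v) - f x\<bar> \<partial>lborel)"
        by (rule nn_integral_eq_integral) (auto intro!: integrable_mult_right it mult_nonneg_nonneg mollifier_nonneg \<open>0 < d\<close>)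
      also have "\<dots> = ennreal (?k v * (\<integral>x. \<bar>f (x + v) - f x\<bar> \<partial>lborel))" by simp
      also have "\<dots> \<le> ennreal (?k v * e)"
      proof (cases "norm v < d0")
        case True then show ?thesis
          by (intro ennreal_leI mult_left_mono d0(2) mollifier_nonneg \<open>0 < d\<close>)
      next
        case False then show ?thesis using mollifier_eq_0[OF \<open>0 < d\<close>, of v] \<open>d \<le> d0\<close> by simp
      qed
      finally show "(\<integral>\<^sup>+x. ennreal (?k v * \<bar>f (x + v) - f x\<bar>) \<partial>lborel) \<le> ennreal (?k v * e)" .
    qed
    also have "\<dots> = ennreal (\<integral>v. ?k v * e \<partial>lborel)"
      using \<open>e > 0\<close> by (intro nn_integral_eq_integral integrable_mult_left integrable_mollifier \<open>0 < d\<close>)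
        (auto intro!: mult_nonneg_nonneg mollifier_nonneg \<open>0 < d\<close>)
    also have "\<dots> = ennreal e" using integral_mollifier[OF \<open>0 < d\<close>, where 'a = 'a] by simp
    finally have le: "(\<integral>\<^sup>+x. ennreal \<bar>mollify ?k f x - f x\<bar> \<partial>lborel) \<le> ennreal e" .
    \<comment> \<open>Integrability of the difference becomes available only here, from the
      finiteness of the nonnegative integral.\<close>
    have int: "integrable lborel (\<lambda>x. mollify ?k f x - f x)"
      by (rule integrableI_bounded) (use le in \<open>auto simp: order_le_less_trans\<close>)
    moreover have "ennreal (\<integral>x. \<bar>mollify ?k f x - f x\<bar> \<partial>lborel) \<le> ennreal e"
      using le nn_integral_eq_integral[OF integrable_abs[OF int]] by simp
    ultimately show ?thesis using \<open>e > 0\<close> by (simp add: ennreal_le_iff)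
  qed
  then show ?thesis using d0(1) by blast
qed

section \<open>Weak derivatives on open sets\<close>

lemma AE_lebesgue_iff_negligible: "(AE x in lebesgue. P x) \<longleftrightarrow> negligible {x. \<not> P x}"
proof
  assume "AE x in lebesgue. P x"
  then obtain N where "{x \<in> space lebesgue. \<not> P x} \<subseteq> N" "N \<in> null_sets lebesgue"
    by (auto elim: AE_E3 simp: eventually_ae_filter)
  then show "negligible {x. \<not> P x}"
    using negligible_subset[of N "{x. \<not> P x}"] by (auto simp: negligible_iff_null_sets)
next
  assume "negligible {x. \<not> P x}"
  then show "AE x in lebesgue. P x"
    using AE_not_in[of "{x. \<not> P x}" lebesgue] by (auto simp: negligible_iff_null_sets)
qed

text \<open>Locally integrable functions are only Lebesgue measurable, and integrable only on
  compact subsets, while translation, Fubini and mollification act on \<open>lborel\<close> over the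
  whole space. \<open>g'\<close> is an integrable Borel version of \<open>g\<close> cut off to
  \<open>C\<close>.\<close>

definition borel_rep :: "'a::euclidean_space set \<Rightarrow> ('a \<Rightarrow> real) \<Rightarrow> ('a \<Rightarrow> real) \<Rightarrow> bool" where
  "borel_rep C g g' \<longleftrightarrow> integrable lborel g' \<and> (AE x in lebesgue. indicator C x * g x = g' x)"

lemma borel_rep_measurable [dest]: "borel_rep C g g' \<Longrightarrow> g' \<in> borel_measurable borel"
  by (auto simp: borel_rep_def)

lemma borel_rep_exists:
  assumes "set_integrable lebesgue C g" shows "\<exists>g'. borel_rep C g g'"
proof -
  have F: "integrable lebesgue (\<lambda>x. indicator C x * g x)"
    using assms by (simp add: set_integrable_def)
  then obtain g' where g': "g' \<in> borel_measurable lborel" "AE x in lborel. indicator C x * g x = g' x"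
    using completion_ex_borel_measurable_real[of "\<lambda>x. indicator C x * g x" lborel] by auto
  have ae: "AE x in lebesgue. indicator C x * g x = g' x" using g'(2) by (rule AE_completion)
  have "g' \<in> borel_measurable lebesgue" using g'(1) by (rule measurable_completion)
  then have "integrable lebesgue g'"
    using integrable_cong_AE[OF _ _ ae] F by auto
  then have "integrable lborel g'" using integrable_completion[OF g'(1)] by simp
  with ae show ?thesis by (auto simp: borel_rep_def)
qed

text \<open>As \<open>\<phi>\<close> vanishes off \<open>C\<close>, only the values of
  \<open>g\<close> on \<open>C\<close> enter, and these agree a.e. with \<open>g'\<close>.\<close>

lemma borel_rep_integral:
  assumes rep: "borel_rep C g g'" and int: "set_integrable lebesgue C g"
    and \<phi>: "\<phi> \<in> borel_measurable borel" and supp: "\<And>z. z \<notin> C \<Longrightarrow> \<phi> z = 0" and "C \<subseteq> S"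
  shows "set_lebesgue_integral lebesgue S (\<lambda>z. g z * \<phi> z) = (\<integral>z. g' z * \<phi> z \<partial>lborel)"
proof -
  have [measurable]: "\<phi> \<in> borel_measurable lebesgue" using \<phi> by (simp add: measurable_completion)
  have g'b: "g' \<in> borel_measurable borel" using rep by auto
  have [measurable]: "g' \<in> borel_measurable lebesgue" using g'b by (simp add: measurable_completion)
  have [measurable]: "(\<lambda>x. indicator C x * g x) \<in> borel_measurable lebesgue"
    using int by (auto simp: set_integrable_def)
  have "set_lebesgue_integral lebesgue S (\<lambda>z. g z * \<phi> z) = (\<integral>z. (indicator C z * g z) * \<phi> z \<partial>lebesgue)"
    unfolding set_lebesgue_integral_def
    using supp \<open>C \<subseteq> S\<close> by (intro Bochner_Integration.integral_cong refl) (auto simp: indicator_def)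
  also have "\<dots> = (\<integral>z. g' z * \<phi> z \<partial>lebesgue)"
    using rep by (intro integral_cong_AE) (auto simp: borel_rep_def)
  also have "\<dots> = (\<integral>z. g' z * \<phi> z \<partial>lborel)"
    using borel_measurable_times[OF g'b \<phi>] by (intro integral_completion) simp
  finally show ?thesis .
qed

text \<open>Differentiability is not assumed: both functions have the same derivatives at
  \<open>z\<close>, so \<open>frechet_derivative\<close> chooses from the same set.\<close>

lemma frechet_derivative_cong_open:
  assumes "open S" "z \<in> S" "\<And>x. x \<in> S \<Longrightarrow> f x = g x"
  shows "frechet_derivative f (at z) = frechet_derivative g (at z)"
proof -
  have "(f has_derivative D) (at z) \<longleftrightarrow> (g has_derivative D) (at z)" for D
    using has_derivative_transform_within_open[OF _ assms(1,2), of f D UNIV g]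
      has_derivative_transform_within_open[OF _ assms(1,2), of g D UNIV f] assms(3) by auto
  then show ?thesis by (simp add: frechet_derivative_def)
qed

lemma frechet_derivative_outside_support:
  assumes "closed C" "\<And>z. z \<notin> C \<Longrightarrow> \<eta> z = 0" "z \<notin> C"
  shows "frechet_derivative \<eta> (at z) w = 0"
proof -
  have "frechet_derivative \<eta> (at z) = frechet_derivative (\<lambda>z. 0) (at z)"
    by (rule frechet_derivative_cong_open[of "- C"]) (use assms in auto)
  then show ?thesis by simp
qed

text \<open>The open sets \<open>S\<close> and \<open>- C\<close> cover the space; the extension is
  \<open>\<eta>\<close> on the first and 0 on the second.\<close>

lemma Ck1_zero_extension:
  assumes "open S" "Ck 1 S \<eta>" "closed C" "C \<subseteq> S" "\<And>z. z \<in> S - C \<Longrightarrow> \<eta> z = 0"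
  shows "Ck 1 UNIV (\<lambda>z. if z \<in> S then \<eta> z else 0)" (is "Ck 1 UNIV ?e")
proof -
  have "Ck 1 (S \<union> - C) ?e"
  proof (rule Ck1_Un_open)
    show "Ck 1 S ?e" by (rule Ck1_cong_open[OF \<open>open S\<close> _ \<open>Ck 1 S \<eta>\<close>]) auto
    show "Ck 1 (- C) ?e" by (rule Ck1_cong_open[OF _ _ Ck1_const[of _ 0]]) (use assms in auto)
  qed (use assms in auto)
  moreover have "S \<union> - C = UNIV" using assms by auto
  ultimately show ?thesis by simp
qed

text \<open>\<open>test_function\<close> leaves the values outside \<open>S\<close> arbitrary.
  Setting them to 0 yields a C1 function on the whole space with compact support, which can be
  convolved and integrated without reference to \<open>S\<close>.\<close>

lemma test_function_extend:
  assumes "open S" "test_function S \<eta>"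
  obtains \<eta>' C where "Ck 1 UNIV \<eta>'" "compact C" "C \<subseteq> S" "\<And>z. z \<notin> C \<Longrightarrow> \<eta>' z = 0"
    "\<And>z. z \<in> S \<Longrightarrow> \<eta>' z = \<eta> z"
    "\<And>z. z \<in> S \<Longrightarrow> frechet_derivative \<eta> (at z) = frechet_derivative \<eta>' (at z)"
proof -
  obtain C where C: "Ck 1 S \<eta>" "compact C" "C \<subseteq> S" "\<And>z. z \<in> S - C \<Longrightarrow> \<eta> z = 0"
    using assms(2) by (auto simp: test_function_def)
  let ?e = "\<lambda>z. if z \<in> S then \<eta> z else 0"
  show ?thesis
  proof (rule that[of ?e C])
    show "Ck 1 UNIV ?e" by (rule Ck1_zero_extension[OF assms(1) C(1) compact_imp_closed[OF C(2)] C(3,4)])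
    show "\<And>z. z \<in> S \<Longrightarrow> frechet_derivative \<eta> (at z) = frechet_derivative ?e (at z)"
      by (rule frechet_derivative_cong_open[OF assms(1)]) auto
  qed (use C in auto)
qed

lemma continuous_compact_support_bounded:
  fixes \<psi> :: "'a::euclidean_space \<Rightarrow> real"
  assumes "continuous_on UNIV \<psi>" "compact C" "\<And>z. z \<notin> C \<Longrightarrow> \<psi> z = 0"
  shows "\<exists>B. \<forall>z. \<bar>\<psi> z\<bar> \<le> B"
proof -
  have "compact (\<psi> ` C)" using assms by (intro compact_continuous_image) (auto intro: continuous_on_subset)
  then obtain B where B: "\<And>z. z \<in> C \<Longrightarrow> \<bar>\<psi> z\<bar> \<le> B"
    by (meson bounded_real compact_imp_bounded imageI)
  have "\<bar>\<psi> z\<bar> \<le> max B 0" for z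
    using B[of z] assms(3)[of z] by (cases "z \<in> C") auto
  then show ?thesis by blast
qed

lemma weak_derivative_test:
  assumes g: "has_weak_derivative_on S g G" and "open S" "i \<in> Basis"
    and \<eta>: "Ck 1 UNIV \<eta>" "\<And>z. z \<notin> C \<Longrightarrow> \<eta> z = 0" and C: "compact C" "C \<subseteq> S"
    and rep: "borel_rep C g g'" "borel_rep C (\<lambda>z. G z i) G'"
  shows "(\<integral>x. g' x * frechet_derivative \<eta> (at x) i \<partial>lborel) = - (\<integral>x. G' x * \<eta> x \<partial>lborel)"
proof -
  have int: "set_integrable lebesgue C g" "set_integrable lebesgue C (\<lambda>z. G z i)"
    using g C \<open>i \<in> Basis\<close> by (auto simp: has_weak_derivative_on_def locally_integrable_on_def)
  have "test_function S \<eta>"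
    using \<eta> C Ck1_mono[OF \<eta>(1)] by (auto simp: test_function_def simp del: One_nat_def)
  then have "set_lebesgue_integral lebesgue S (\<lambda>z. g z * frechet_derivative \<eta> (at z) i) =
           - set_lebesgue_integral lebesgue S (\<lambda>z. G z i * \<eta> z)"
    using g \<open>i \<in> Basis\<close> by (auto simp: has_weak_derivative_on_def)
  moreover have "(\<lambda>z. frechet_derivative \<eta> (at z) i) \<in> borel_measurable borel"
    by (rule borel_measurable_continuous_onI[OF Ck1_continuous_derivative[OF \<eta>(1)]])
  moreover have "\<eta> \<in> borel_measurable borel"
    by (rule borel_measurable_continuous_onI[OF Ck1_continuous_on[OF \<eta>(1)]])
  ultimately show ?thesis
    using borel_rep_integral[OF rep(1) int(1) _ _ C(2), of "\<lambda>z. frechet_derivative \<eta> (at z) i"]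
      borel_rep_integral[OF rep(2) int(2) _ _ C(2), of \<eta>] \<eta>(2)
      frechet_derivative_outside_support[OF compact_imp_closed[OF C(1)] \<eta>(2)]
    by simp
qed

lemma Ck1_translated_mollifier:
  assumes "d > 0"
  shows "Ck 1 UNIV (\<lambda>y::'a::euclidean_space. mollifier d (y - x))"
    and "frechet_derivative (\<lambda>y. mollifier d (y - x)) (at y) = frechet_derivative (mollifier d) (at (y - x))"
    and "Ck 1 UNIV (\<lambda>x. mollifier d (y - x))"
    and "((\<lambda>x. mollifier d (y - x)) has_derivative (\<lambda>w. - frechet_derivative (mollifier d) (at (y - x)) w)) (at x)"
proof -
  note C = Ck1_mollifier[OF assms, where S = UNIV and 'a = 'a]
  have t: "((\<lambda>y. y - x) has_derivative (\<lambda>w. w)) (at y)" for x y :: 'a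
    by (auto intro!: derivative_eq_intros)
  have t': "((\<lambda>x. y - x) has_derivative (\<lambda>w. - w)) (at x)" for x y :: 'a
    by (auto intro!: derivative_eq_intros)
  have "Ck 1 UNIV (\<lambda>y. y - x)" for x :: 'a
    by (rule Ck1I[OF t]) auto
  from Ck1_compose[OF this C] show "Ck 1 UNIV (\<lambda>y::'a. mollifier d (y - x))" by (simp add: o_def)
  have "Ck 1 UNIV (\<lambda>x. y - x)" for y :: 'a
    by (rule Ck1I[OF t']) (auto intro: continuous_intros)
  from Ck1_compose[OF this C] show "Ck 1 UNIV (\<lambda>x. mollifier d (y - x))" by (simp add: o_def)
  have "((\<lambda>y. mollifier d (y - x)) has_derivative frechet_derivative (mollifier d) (at (y - x))) (at y)"
    using diff_chain_at[OF t Ck1_has_derivative[OF C]] by (simp add: o_def)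
  then show "frechet_derivative (\<lambda>y. mollifier d (y - x)) (at y) = frechet_derivative (mollifier d) (at (y - x))"
    by (rule frechet_derivative_at[symmetric])
  have lin: "linear (frechet_derivative (mollifier d) (at v))" for v :: 'a
    by (rule has_derivative_linear[OF Ck1_has_derivative[OF C]]) simp
  have "((\<lambda>x. mollifier d (y - x)) has_derivative (\<lambda>w. frechet_derivative (mollifier d) (at (y - x)) (- w))) (at x)"
    using diff_chain_at[OF t' Ck1_has_derivative[OF C]] by (simp add: o_def)
  then show "((\<lambda>x. mollifier d (y - x)) has_derivative (\<lambda>w. - frechet_derivative (mollifier d) (at (y - x)) w)) (at x)"
    by (simp only: linear_neg[OF lin])
qed

text \<open>The fundamental lemma of the calculus of variations. Near a point of \<open>S\<close>
  the translated mollifiers are test functions, so all mollifications of small radius vanish there,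
  and by L1 convergence so does the function. A set that is negligible near each of its points is
  negligible.\<close>

lemma weak_zero:
  assumes "open S" and f: "locally_integrable_on S f"
    and test: "\<And>\<eta>. test_function S \<eta> \<Longrightarrow> set_lebesgue_integral lebesgue S (\<lambda>z. f z * \<eta> z) = 0"
  shows "negligible {z \<in> S. f z \<noteq> 0}"
proof -
  have loc: "\<exists>r>0. negligible {z \<in> ball z0 r. f z \<noteq> 0}" if z0: "z0 \<in> S" for z0
  proof -
    obtain R where R: "R > 0" "cball z0 R \<subseteq> S"
      using open_contains_cball_eq[OF \<open>open S\<close>] z0 by blast
    let ?C = "cball z0 R"
    have int: "set_integrable lebesgue ?C f"
      using f R by (auto simp: locally_integrable_on_def)
    then obtain f' where f': "borel_rep ?C f f'" using borel_rep_exists by blast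
    then have f'i: "integrable lborel f'" by (simp add: borel_rep_def)
    have m0: "mollify (mollifier d) f' x = 0" if x: "x \<in> ball z0 (R/2)" and d: "0 < d" "d \<le> R/2" for x d
    proof -
      have supp: "mollifier d (y - x) = 0" if "y \<notin> ?C" for y
      proof (rule mollifier_eq_0[OF d(1)])
        have "R < dist z0 y" using that by simp
        also have "dist z0 y \<le> dist z0 x + dist x y" by (rule dist_triangle)
        finally show "d \<le> norm (y - x)" using x d by (simp add: dist_norm norm_minus_commute)
      qed
      have "test_function S (\<lambda>y. mollifier d (y - x))"
        using Ck1_mono[OF Ck1_translated_mollifier(1)[OF d(1), of x], of S] R supp
        by (auto simp: test_function_def simp del: One_nat_def intro!: exI[of _ ?C])
      from test[OF this] have "set_lebesgue_integral lebesgue S (\<lambda>y. f y * mollifier d (y - x)) = 0" .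
      moreover have "(\<lambda>y. mollifier d (y - x)) \<in> borel_measurable borel"
        by (rule borel_measurable_continuous_onI[OF Ck1_continuous_on[OF Ck1_translated_mollifier(1)[OF d(1)]]])
      ultimately have "(\<integral>y. f' y * mollifier d (y - x) \<partial>lborel) = 0"
        using borel_rep_integral[OF f' int _ supp R(2)] by simp
      then show ?thesis by (simp add: mollify_def mult.commute)
    qed
    have ib: "integrable lborel (\<lambda>x. indicator (ball z0 (R/2)) x * \<bar>f' x\<bar>)"
      using integrable_mult_indicator[OF _ integrable_abs[OF f'i], of "ball z0 (R/2)"] by simp
    have "(\<integral>x. indicator (ball z0 (R/2)) x * \<bar>f' x\<bar> \<partial>lborel) \<le> e" if e: "e > 0" for e
    proof -
      obtain d0 where d0: "d0 > 0" "\<And>d. 0 < d \<Longrightarrow> d \<le> d0 \<Longrightarrow>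
          integrable lborel (\<lambda>x. mollify (mollifier d) f' x - f' x) \<and>
          (\<integral>x. \<bar>mollify (mollifier d) f' x - f' x\<bar> \<partial>lborel) \<le> e"
        using mollify_L1[OF f'i e] by blast
      \<comment> \<open>\<open>d0\<close> keeps the L1 error below \<open>e\<close>;
        \<open>R/2\<close> keeps the mollifiers centred in the half ball supported in
        \<open>?C\<close>.\<close>
      define d where "d = min d0 (R/2)"
      have d: "0 < d" "d \<le> d0" "d \<le> R/2" using d0 R by (auto simp: d_def)
      have "(\<integral>x. indicator (ball z0 (R/2)) x * \<bar>f' x\<bar> \<partial>lborel) \<le>
          (\<integral>x. \<bar>mollify (mollifier d) f' x - f' x\<bar> \<partial>lborel)"
        using d0(2)[OF d(1,2)] m0[OF _ d(1,3)]
        by (intro integral_mono ib integrable_abs) (auto simp: indicator_def)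
      then show ?thesis using d0(2)[OF d(1,2)] by linarith
    qed
    then have "(\<integral>x. indicator (ball z0 (R/2)) x * \<bar>f' x\<bar> \<partial>lborel) \<le> 0"
      by (rule field_le_epsilon[of _ 0, simplified])
    moreover have "(\<integral>x. indicator (ball z0 (R/2)) x * \<bar>f' x\<bar> \<partial>lborel) \<ge> 0"
      by (intro Bochner_Integration.integral_nonneg) auto
    ultimately have "AE x in lborel. indicator (ball z0 (R/2)) x * \<bar>f' x\<bar> = 0"
      using integral_nonneg_eq_0_iff_AE[OF ib] by simp
    then have "AE x in lebesgue. indicator (ball z0 (R/2)) x * \<bar>f' x\<bar> = 0" by (rule AE_completion)
    moreover have "AE x in lebesgue. indicator ?C x * f x = f' x" using f' by (simp add: borel_rep_def)
    ultimately have "AE x in lebesgue. x \<in> ball z0 (R/2) \<longrightarrow> f x = 0"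
      by eventually_elim (use R in \<open>auto simp: indicator_def split: if_splits\<close>)
    then have "negligible {z \<in> ball z0 (R/2). f z \<noteq> 0}"
      unfolding AE_lebesgue_iff_negligible by (rule negligible_subset) auto
    then show ?thesis using R by (intro exI[of _ "R/2"]) simp
  qed
  show ?thesis
    unfolding locally_negligible_alt[of "{z \<in> S. f z \<noteq> 0}"]
  proof
    fix x assume x: "x \<in> {z \<in> S. f z \<noteq> 0}"
    then obtain r where r: "r > 0" "negligible {z \<in> ball x r. f z \<noteq> 0}" using loc by blast
    show "\<exists>U. openin (top_of_set {z \<in> S. f z \<noteq> 0}) U \<and> x \<in> U \<and> negligible U"
      using x r by (intro exI[of _ "{z \<in> S. f z \<noteq> 0} \<inter> ball x r"])
        (auto intro!: openin_open_Int negligible_subset[OF r(2)])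
  qed
qed

lemma set_integrable_mult_test:
  assumes "locally_integrable_on S f" "open S" "test_function S \<eta>"
  shows "set_integrable lebesgue S (\<lambda>z. f z * \<eta> z)"
proof -
  obtain \<eta>' C where \<eta>': "Ck 1 UNIV \<eta>'" "compact C" "C \<subseteq> S" "\<And>z. z \<notin> C \<Longrightarrow> \<eta>' z = 0"
    "\<And>z. z \<in> S \<Longrightarrow> \<eta>' z = \<eta> z"
    using test_function_extend[OF assms(2,3)] by metis
  have cont: "continuous_on UNIV \<eta>'" by (rule Ck1_continuous_on[OF \<eta>'(1)])
  obtain B where B: "\<And>z. \<bar>\<eta>' z\<bar> \<le> B"
    using continuous_compact_support_bounded[OF cont \<eta>'(2,4)] by blast
  have int: "integrable lebesgue (\<lambda>z. indicator C z * f z)"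
    using assms(1) \<eta>'(2,3) by (auto simp: locally_integrable_on_def set_integrable_def)
  have m: "\<eta>' \<in> borel_measurable lebesgue"
    by (simp add: measurable_completion borel_measurable_continuous_onI[OF cont])
  have "integrable lebesgue (\<lambda>z. (indicator C z * f z) * \<eta>' z)"
  proof (rule Bochner_Integration.integrable_bound[OF integrable_mult_right[OF int, of B]])
    show "(\<lambda>z. (indicator C z * f z) * \<eta>' z) \<in> borel_measurable lebesgue"
      using int m by (auto intro: borel_measurable_times)
    show "AE z in lebesgue. norm (indicator C z * f z * \<eta>' z) \<le> norm (B * (indicator C z * f z))"
    proof (rule AE_I2)
      fix z
      have "\<bar>indicator C z * f z\<bar> * \<bar>\<eta>' z\<bar> \<le> \<bar>indicator C z * f z\<bar> * \<bar>B\<bar>"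
        using B[of z] by (intro mult_left_mono) auto
      then show "norm (indicator C z * f z * \<eta>' z) \<le> norm (B * (indicator C z * f z))"
        by (simp add: abs_mult mult_ac)
    qed
  qed
  moreover have "(indicator C z * f z) * \<eta>' z = indicator S z *\<^sub>R (f z * \<eta> z)" for z
    using \<eta>'(3) \<eta>'(4)[of z] \<eta>'(5)[of z] by (auto simp: indicator_def)
  ultimately show ?thesis by (simp add: set_integrable_def)
qed

lemma locally_integrable_diff:
  "locally_integrable_on S f \<Longrightarrow> locally_integrable_on S g \<Longrightarrow> locally_integrable_on S (\<lambda>z. f z - g z)"
  by (auto simp: locally_integrable_on_def)

lemma has_weak_derivative_on_unique:
  assumes "open S" "has_weak_derivative_on S g G" "has_weak_derivative_on S g G'" "i \<in> Basis"
  shows "negligible {z \<in> S. G z i \<noteq> G' z i}"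
proof -
  have li: "locally_integrable_on S (\<lambda>z. G z i)" "locally_integrable_on S (\<lambda>z. G' z i)"
    using assms by (auto simp: has_weak_derivative_on_def)
  have "negligible {z \<in> S. G z i - G' z i \<noteq> 0}"
  proof (rule weak_zero[OF \<open>open S\<close> locally_integrable_diff[OF li]])
    fix \<eta> assume \<eta>: "test_function S \<eta>"
    have "set_lebesgue_integral lebesgue S (\<lambda>z. G z i * \<eta> z) = set_lebesgue_integral lebesgue S (\<lambda>z. G' z i * \<eta> z)"
      using assms \<eta> unfolding has_weak_derivative_on_def by fastforce
    then show "set_lebesgue_integral lebesgue S (\<lambda>z. (G z i - G' z i) * \<eta> z) = 0"
      using set_integrable_mult_test[OF li(1) \<open>open S\<close> \<eta>] set_integrable_mult_test[OF li(2) \<open>open S\<close> \<eta>]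
      by (simp add: left_diff_distrib set_integral_diff)
  qed
  then show ?thesis by simp
qed

section \<open>Product rule for bounded weakly differentiable functions\<close>

lemma locally_integrable_mult:
  assumes a: "locally_integrable_on S a" and b: "locally_integrable_on S b"
    and B: "\<And>z. z \<in> S \<Longrightarrow> \<bar>a z\<bar> \<le> B"
  shows "locally_integrable_on S (\<lambda>z. a z * b z)"
  unfolding locally_integrable_on_def
proof (intro allI impI)
  fix C assume C: "compact C \<and> C \<subseteq> S"
  have ia: "integrable lebesgue (\<lambda>z. indicator C z * a z)" and ib: "integrable lebesgue (\<lambda>z. indicator C z * b z)"
    using a b C by (auto simp: locally_integrable_on_def set_integrable_def)
  have "integrable lebesgue (\<lambda>z. (indicator C z * a z) * (indicator C z * b z))"
  proof (rule Bochner_Integration.integrable_bound[OF integrable_mult_right[OF ib, of B]])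
    show "(\<lambda>z. (indicator C z * a z) * (indicator C z * b z)) \<in> borel_measurable lebesgue"
      using ia ib by (auto intro: borel_measurable_times)
    show "AE z in lebesgue. norm (indicator C z * a z * (indicator C z * b z)) \<le> norm (B * (indicator C z * b z))"
    proof (rule AE_I2)
      fix z
      have "\<bar>indicator C z * a z\<bar> * \<bar>indicator C z * b z\<bar> \<le> \<bar>B\<bar> * \<bar>indicator C z * b z\<bar>"
        using B[of z] C by (intro mult_right_mono) (auto simp: indicator_def)
      then show "norm (indicator C z * a z * (indicator C z * b z)) \<le> norm (B * (indicator C z * b z))"
        by (simp only: real_norm_def abs_mult)
    qed
  qed
  moreover have "(indicator C z * a z) * (indicator C z * b z) = indicator C z *\<^sub>R (a z * b z)" for z
    by (auto simp: indicator_def)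
  ultimately show "set_integrable lebesgue C (\<lambda>z. a z * b z)"
    unfolding set_integrable_def by simp
qed

lemma integrable_mult_bounded:
  fixes f g :: "'a::euclidean_space \<Rightarrow> real"
  assumes f: "integrable lborel f" and g: "g \<in> borel_measurable borel" and B: "AE x in lborel. \<bar>g x\<bar> \<le> B"
  shows "integrable lborel (\<lambda>x. f x * g x)"
proof (rule Bochner_Integration.integrable_bound[OF integrable_mult_right[OF f, of B]])
  have "f \<in> borel_measurable borel" using f by auto
  with g show "(\<lambda>x. f x * g x) \<in> borel_measurable lborel" by simp
  show "AE x in lborel. norm (f x * g x) \<le> norm (B * f x)"
    using B
  proof eventually_elim
    fix x assume "\<bar>g x\<bar> \<le> B"
    then have "\<bar>f x\<bar> * \<bar>g x\<bar> \<le> \<bar>f x\<bar> * \<bar>B\<bar>" by (intro mult_left_mono) auto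
    then show "norm (f x * g x) \<le> norm (B * f x)" by (simp add: abs_mult mult.commute)
  qed
qed

lemma borel_rep_bounded:
  assumes "borel_rep C g g'" and "\<And>z. z \<in> C \<Longrightarrow> \<bar>g z\<bar> \<le> B"
  shows "AE x in lborel. \<bar>g' x\<bar> \<le> \<bar>B\<bar>"
proof -
  have "AE x in lebesgue. indicator C x * g x = g' x" using assms(1) by (simp add: borel_rep_def)
  then have "AE x in lebesgue. \<bar>g' x\<bar> \<le> \<bar>B\<bar>"
  proof eventually_elim
    fix x assume "indicator C x * g x = g' x"
    then show "\<bar>g' x\<bar> \<le> \<bar>B\<bar>" using assms(2)[of x] by (cases "x \<in> C") auto
  qed
  then show ?thesis by (simp only: AE_completion_iff)
qed

lemma borel_rep_mult:
  assumes g: "borel_rep C g g'" and h: "borel_rep C h h'" and B: "\<And>z. z \<in> C \<Longrightarrow> \<bar>h z\<bar> \<le> B"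
  shows "borel_rep C (\<lambda>z. g z * h z) (\<lambda>z. g' z * h' z)"
  unfolding borel_rep_def
proof
  show "integrable lborel (\<lambda>z. g' z * h' z)"
    using g by (intro integrable_mult_bounded[OF _ borel_rep_measurable[OF h] borel_rep_bounded[OF h B]])
      (auto simp: borel_rep_def)
  have "AE x in lebesgue. indicator C x * g x = g' x" "AE x in lebesgue. indicator C x * h x = h' x"
    using g h by (auto simp: borel_rep_def)
  then show "AE x in lebesgue. indicator C x * (g x * h x) = g' x * h' x"
    by eventually_elim (auto simp: indicator_def split: if_splits)
qed

lemma borel_rep_add:
  assumes g: "borel_rep C g g'" and h: "borel_rep C h h'"
  shows "borel_rep C (\<lambda>z. g z + h z) (\<lambda>z. g' z + h' z)"
  unfolding borel_rep_def
proof
  show "integrable lborel (\<lambda>z. g' z + h' z)" using g h by (auto simp: borel_rep_def)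
  have "AE x in lebesgue. indicator C x * g x = g' x" "AE x in lebesgue. indicator C x * h x = h' x"
    using g h by (auto simp: borel_rep_def)
  then show "AE x in lebesgue. indicator C x * (g x + h x) = g' x + h' x"
    by eventually_elim (auto simp: indicator_def split: if_splits)
qed

lemma integrable_kernel_snd:
  fixes a b k :: "'a::euclidean_space \<Rightarrow> real"
  assumes a: "integrable lborel a" and b: "integrable lborel b"
    and k: "k \<in> borel_measurable borel" and B: "\<And>v. \<bar>k v\<bar> \<le> B"
  shows "integrable lborel (\<lambda>y. b y * (\<integral>x. a x * k (y - x) \<partial>lborel))"
proof -
  have "integrable lborel (\<lambda>y. \<integral>x. a x * k (y - x) * b y \<partial>lborel)"
    by (rule lborel_pair.integrable_snd[OF integrable_kernel[OF assms]])
  moreover have "(\<integral>x. a x * k (y - x) * b y \<partial>lborel) = b y * (\<integral>x. a x * k (y - x) \<partial>lborel)" for y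
    by (simp add: mult.commute[of "b _"] flip: integral_mult_left_zero)
  ultimately show ?thesis by (simp only:)
qed

text \<open>Averaging against a nonnegative kernel of mass 1 preserves a bound that holds a.e. This
  supplies the dominating function for the term of the product rule whose other factor is merely
  integrable.\<close>

lemma mollify_bounded:
  fixes f :: "'a::euclidean_space \<Rightarrow> real"
  assumes f: "integrable lborel f" and "d > 0" and B: "AE x in lborel. \<bar>f x\<bar> \<le> B"
  shows "\<bar>mollify (mollifier d) f x\<bar> \<le> B"
proof -
  let ?k = "mollifier d :: 'a \<Rightarrow> real"
  note ik = integrable_mollifier[OF \<open>d > 0\<close>, where 'a = 'a]
  have i: "integrable lborel (\<lambda>y. ?k (y - x) * f y)" by (rule integrable_mollify[OF f \<open>d > 0\<close>])
  have ik': "integrable lborel (\<lambda>y. ?k (y - x))"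
    using lborel_integrable_translate(1)[OF ik, of "- x"] by simp
  have "\<bar>mollify ?k f x\<bar> \<le> (\<integral>y. \<bar>?k (y - x) * f y\<bar> \<partial>lborel)"
    unfolding mollify_def by (rule integral_abs_bound)
  also have "\<dots> \<le> (\<integral>y. ?k (y - x) * B \<partial>lborel)"
  proof (rule integral_mono_AE[OF integrable_abs[OF i] integrable_mult_left[OF ik']])
    show "AE y in lborel. \<bar>?k (y - x) * f y\<bar> \<le> ?k (y - x) * B"
      using B by eventually_elim (auto simp: abs_mult mollifier_nonneg[OF \<open>d > 0\<close>] intro: mult_left_mono)
  qed
  also have "\<dots> = B"
    using lborel_integrable_translate(2)[OF ik, of "- x"] integral_mollifier[OF \<open>d > 0\<close>, where 'a = 'a] by simp
  finally show ?thesis .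
qed

text \<open>The product rule with \<open>h\<close> mollified, obtained without differentiating a
  mollified function. The derivative falls on the kernel, which depends on \<open>y - x\<close>, and
  so can be passed from \<open>x\<close> to \<open>y\<close> at the price of a sign. The radius
  \<open>d\<close> is small enough for kernels centred in \<open>C0\<close> to be supported in
  \<open>C\<close>, where the representatives live.\<close>

lemma mollified_product_rule:
  fixes i :: "'a::euclidean_space"
  assumes g: "has_weak_derivative_on S g G" and h: "has_weak_derivative_on S h H"
    and S: "open S" and i: "i \<in> Basis"
    and \<eta>: "Ck 1 UNIV \<eta>" "compact C0" "\<And>z. z \<notin> C0 \<Longrightarrow> \<eta> z = 0"
    and d: "d > 0" "(\<Union>x\<in>C0. cball x d) \<subseteq> C" and C: "compact C" "C \<subseteq> S"
    and g': "borel_rep C g g'" and G': "borel_rep C (\<lambda>z. G z i) G'"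
    and h': "borel_rep C h h'" and H': "borel_rep C (\<lambda>z. H z i) H'"
  shows "(\<integral>x. (g' x * frechet_derivative \<eta> (at x) i) * mollify (mollifier d) h' x \<partial>lborel) =
    - (\<integral>x. (g' x * \<eta> x) * mollify (mollifier d) H' x \<partial>lborel)
    - (\<integral>x. (G' x * \<eta> x) * mollify (mollifier d) h' x \<partial>lborel)"
proof -
  let ?k = "mollifier d :: 'a \<Rightarrow> real" and ?k' = "\<lambda>v. frechet_derivative (mollifier d) (at v) i"
  let ?D = "\<lambda>x. frechet_derivative \<eta> (at x) i"
  have "C0 \<subseteq> C" using d by force
  then have \<eta>C: "\<eta> z = 0" if "z \<notin> C" for z using \<eta>(3) that by auto
  have cD: "continuous_on UNIV ?D" by (rule Ck1_continuous_derivative[OF \<eta>(1)])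
  have c\<eta>: "continuous_on UNIV \<eta>" by (rule Ck1_continuous_on[OF \<eta>(1)])
  have D0: "?D z = 0" if "z \<notin> C0" for z
    by (rule frechet_derivative_outside_support[OF compact_imp_closed[OF \<eta>(2)] \<eta>(3) that])
  obtain BD where BD: "\<And>z. \<bar>?D z\<bar> \<le> BD"
    using continuous_compact_support_bounded[OF cD \<eta>(2) D0] by blast
  obtain B\<eta> where B\<eta>: "\<And>z. \<bar>\<eta> z\<bar> \<le> B\<eta>"
    using continuous_compact_support_bounded[OF c\<eta> \<eta>(2) \<eta>(3)] by blast
  have g'i: "integrable lborel g'" and G'i: "integrable lborel G'" and h'i: "integrable lborel h'" and H'i: "integrable lborel H'"
    using g' G' h' H' by (auto simp: borel_rep_def)
  have i1: "integrable lborel (\<lambda>x. g' x * ?D x)"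
    by (rule integrable_mult_bounded[OF g'i borel_measurable_continuous_onI[OF cD], of BD]) (simp add: BD)
  have i2: "integrable lborel (\<lambda>x. g' x * \<eta> x)"
    by (rule integrable_mult_bounded[OF g'i borel_measurable_continuous_onI[OF c\<eta>], of B\<eta>]) (simp add: B\<eta>)
  have i3: "integrable lborel (\<lambda>x. G' x * \<eta> x)"
    by (rule integrable_mult_bounded[OF G'i borel_measurable_continuous_onI[OF c\<eta>], of B\<eta>]) (simp add: B\<eta>)
  note kb = borel_measurable_mollifier[OF d(1), where 'a = 'a]
  obtain Bk where Bk: "\<And>v::'a. \<bar>?k v\<bar> \<le> Bk" using mollifier_bounded[OF d(1)] by blast
  have ck': "continuous_on UNIV ?k'" by (rule Ck1_continuous_derivative[OF Ck1_mollifier[OF d(1)]])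
  have k'0: "?k' v = 0" if "v \<notin> cball 0 d" for v
    by (rule frechet_derivative_outside_support[of "cball 0 d"]) (use that in \<open>auto intro!: mollifier_eq_0[OF d(1)]\<close>)
  obtain Bk' where Bk': "\<And>v. \<bar>?k' v\<bar> \<le> Bk'"
    using continuous_compact_support_bounded[OF ck' compact_cball k'0] by blast
  note k'b = borel_measurable_continuous_onI[OF ck']
  \<comment> \<open>The weak derivative of \<open>g\<close> is tested with
    \<open>\<lambda>x. \<eta> x * ?k (y - x)\<close> for fixed \<open>y\<close>. The derivative of
    the kernel in \<open>x\<close> is minus \<open>?k'\<close>, which puts it on the other side with
    a plus sign.\<close>
  have inner: "(\<integral>x. (g' x * ?D x) * ?k (y - x) \<partial>lborel) =
     (\<integral>x. (g' x * \<eta> x) * ?k' (y - x) \<partial>lborel) - (\<integral>x. (G' x * \<eta> x) * ?k (y - x) \<partial>lborel)" for y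
  proof -
    let ?\<psi> = "\<lambda>x. \<eta> x * ?k (y - x)"
    have C1: "Ck 1 UNIV ?\<psi>" by (rule Ck1_mult[OF \<eta>(1) Ck1_translated_mollifier(3)[OF d(1)]])
    have "(?\<psi> has_derivative (\<lambda>w. \<eta> x * - frechet_derivative ?k (at (y - x)) w + frechet_derivative \<eta> (at x) w * ?k (y - x))) (at x)" for x
      by (rule has_derivative_mult[OF Ck1_has_derivative[OF \<eta>(1)] Ck1_translated_mollifier(4)[OF d(1)]]) simp
    from frechet_derivative_at[OF this]
    have D: "frechet_derivative ?\<psi> (at x) i = - (\<eta> x * ?k' (y - x)) + ?D x * ?k (y - x)" for x
      by (metis (mono_tags, lifting) mult_minus_right)
    have "(\<integral>x. g' x * frechet_derivative ?\<psi> (at x) i \<partial>lborel) = - (\<integral>x. G' x * ?\<psi> x \<partial>lborel)"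
      using \<eta>C by (intro weak_derivative_test[OF g S i C1 _ C g' G']) auto
    moreover have "(\<integral>x. g' x * frechet_derivative ?\<psi> (at x) i \<partial>lborel) =
        (\<integral>x. (g' x * ?D x) * ?k (y - x) - (g' x * \<eta> x) * ?k' (y - x) \<partial>lborel)"
      unfolding D by (rule Bochner_Integration.integral_cong) (auto simp: algebra_simps)
    moreover have "\<dots> = (\<integral>x. (g' x * ?D x) * ?k (y - x) \<partial>lborel) - (\<integral>x. (g' x * \<eta> x) * ?k' (y - x) \<partial>lborel)"
      using kb k'b Bk Bk'
      by (intro Bochner_Integration.integral_diff integrable_mult_bounded[OF i1, of _ Bk] integrable_mult_bounded[OF i2, of _ Bk']) auto
    ultimately show ?thesis by (simp add: mult.assoc)
  qed
  \<comment> \<open>Now the weak derivative of \<open>h\<close> is tested with the kernel as a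
    function of \<open>y\<close>. This is possible for \<open>x\<close> in \<open>C0\<close> only;
    elsewhere \<open>\<eta>\<close> is 0.\<close>
  have Hk: "(g' x * \<eta> x) * mollify ?k' h' x = - ((g' x * \<eta> x) * mollify ?k H' x)" for x
  proof (cases "x \<in> C0")
    case True
    have supp: "?k (y - x) = 0" if "y \<notin> C" for y
    proof (rule mollifier_eq_0[OF d(1)])
      have "y \<notin> cball x d" using that d(2) True by blast
      then show "d \<le> norm (y - x)" by (simp add: dist_norm norm_minus_commute)
    qed
    have "(\<integral>y. h' y * frechet_derivative (\<lambda>y. ?k (y - x)) (at y) i \<partial>lborel) = - (\<integral>y. H' y * ?k (y - x) \<partial>lborel)"
      by (rule weak_derivative_test[OF h S i Ck1_translated_mollifier(1)[OF d(1)] supp C h' H'])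
    then have "mollify ?k' h' x = - mollify ?k H' x"
      unfolding Ck1_translated_mollifier(2)[OF d(1)] mollify_def by (simp add: mult.commute)
    then show ?thesis by simp
  qed (simp add: \<eta>(3))
  have "(\<integral>x. (g' x * ?D x) * mollify ?k h' x \<partial>lborel) =
      (\<integral>y. h' y * (\<integral>x. (g' x * ?D x) * ?k (y - x) \<partial>lborel) \<partial>lborel)"
    by (rule kernel_swap[OF i1 h'i kb Bk])
  also have "\<dots> = (\<integral>y. h' y * (\<integral>x. (g' x * \<eta> x) * ?k' (y - x) \<partial>lborel) -
      h' y * (\<integral>x. (G' x * \<eta> x) * ?k (y - x) \<partial>lborel) \<partial>lborel)"
    unfolding inner by (simp add: right_diff_distrib)
  also have "\<dots> = (\<integral>y. h' y * (\<integral>x. (g' x * \<eta> x) * ?k' (y - x) \<partial>lborel) \<partial>lborel) -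
      (\<integral>y. h' y * (\<integral>x. (G' x * \<eta> x) * ?k (y - x) \<partial>lborel) \<partial>lborel)"
    by (rule Bochner_Integration.integral_diff[OF integrable_kernel_snd[OF i2 h'i k'b Bk'] integrable_kernel_snd[OF i3 h'i kb Bk]])
  also have "\<dots> = (\<integral>x. (g' x * \<eta> x) * mollify ?k' h' x \<partial>lborel) - (\<integral>x. (G' x * \<eta> x) * mollify ?k h' x \<partial>lborel)"
    using kernel_swap[OF i2 h'i k'b Bk'] kernel_swap[OF i3 h'i kb Bk] by simp
  finally show ?thesis unfolding Hk by simp
qed

text \<open>L1 convergence pairs with a bounded factor. It covers the two terms of the product rule
  in which \<open>a\<close> is \<open>g'\<close> times a bounded function.\<close>

lemma integral_mollify_limit:
  fixes a b :: "'a::euclidean_space \<Rightarrow> real"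
  assumes a: "integrable lborel a" and B: "AE x in lborel. \<bar>a x\<bar> \<le> B" and b: "integrable lborel b"
    and d: "\<And>n. d n > 0" and int: "\<And>n. integrable lborel (\<lambda>x. mollify (mollifier (d n)) b x - b x)"
    and lim: "(\<lambda>n. \<integral>x. \<bar>mollify (mollifier (d n)) b x - b x\<bar> \<partial>lborel) \<longlonglongrightarrow> 0"
  shows "(\<lambda>n. \<integral>x. a x * mollify (mollifier (d n)) b x \<partial>lborel) \<longlonglongrightarrow> (\<integral>x. a x * b x \<partial>lborel)"
proof -
  have ab: "a \<in> borel_measurable borel" using a by auto
  let ?m = "\<lambda>n x. mollify (mollifier (d n)) b x - b x"
  have i1: "integrable lborel (\<lambda>x. ?m n x * a x)" for n
    by (rule integrable_mult_bounded[OF int ab B])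
  have i2: "integrable lborel (\<lambda>x. b x * a x)"
    by (rule integrable_mult_bounded[OF b ab B])
  have "(\<integral>x. a x * mollify (mollifier (d n)) b x \<partial>lborel) = (\<integral>x. ?m n x * a x + b x * a x \<partial>lborel)" for n
    by (rule Bochner_Integration.integral_cong) (auto simp: algebra_simps)
  then have eq: "(\<integral>x. a x * mollify (mollifier (d n)) b x \<partial>lborel) =
      (\<integral>x. ?m n x * a x \<partial>lborel) + (\<integral>x. a x * b x \<partial>lborel)" for n
    using Bochner_Integration.integral_add[OF i1[of n] i2] by (simp add: mult.commute)
  have "(\<lambda>n. \<integral>x. ?m n x * a x \<partial>lborel) \<longlonglongrightarrow> 0"
  proof (rule Lim_null_comparison)
    show "(\<lambda>n. (\<integral>x. \<bar>?m n x\<bar> \<partial>lborel) * B) \<longlonglongrightarrow> 0"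
      using tendsto_mult_left_zero[OF lim] .
    show "\<forall>\<^sub>F n in sequentially. norm (\<integral>x. ?m n x * a x \<partial>lborel) \<le> (\<integral>x. \<bar>?m n x\<bar> \<partial>lborel) * B"
    proof (rule always_eventually, rule allI)
      fix n
      have "norm (\<integral>x. ?m n x * a x \<partial>lborel) \<le> (\<integral>x. \<bar>?m n x * a x\<bar> \<partial>lborel)"
        using integral_abs_bound by simp
      also have "\<dots> \<le> (\<integral>x. \<bar>?m n x\<bar> * B \<partial>lborel)"
      proof (rule integral_mono_AE[OF integrable_abs[OF i1] integrable_mult_left[OF integrable_abs[OF int]]])
        show "AE x in lborel. \<bar>?m n x * a x\<bar> \<le> \<bar>?m n x\<bar> * B"
          using B by eventually_elim (auto simp: abs_mult intro: mult_left_mono)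
      qed
      finally show "norm (\<integral>x. ?m n x * a x \<partial>lborel) \<le> (\<integral>x. \<bar>?m n x\<bar> \<partial>lborel) * B" by simp
    qed
  qed
  then show ?thesis unfolding eq by (auto intro!: tendsto_eq_intros)
qed

text \<open>Passing to the limit in \<open>mollified_product_rule\<close>. In the two terms
  containing \<open>g'\<close> the cofactor is bounded and L1 convergence suffices. In the term
  containing \<open>G'\<close>, which is only integrable, convergence a.e. along a subsequence is
  combined with the bound on the mollified \<open>h'\<close>.\<close>

lemma has_weak_derivative_on_mult:
  fixes S :: "'a::euclidean_space set"
  assumes S: "open S" and g: "has_weak_derivative_on S g G" and h: "has_weak_derivative_on S h H"
    and Bg: "\<And>z. z \<in> S \<Longrightarrow> \<bar>g z\<bar> \<le> B" and Bh: "\<And>z. z \<in> S \<Longrightarrow> \<bar>h z\<bar> \<le> B"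
  shows "has_weak_derivative_on S (\<lambda>z. g z * h z) (\<lambda>z w. G z w * h z + H z w * g z)"
proof -
  have lg: "locally_integrable_on S g" and lh: "locally_integrable_on S h"
    using g h by (auto simp: has_weak_derivative_on_def)
  have lG: "locally_integrable_on S (\<lambda>z. G z i)" and lH: "locally_integrable_on S (\<lambda>z. H z i)" if "i \<in> Basis" for i
    using g h that by (auto simp: has_weak_derivative_on_def)
  have li: "locally_integrable_on S (\<lambda>z. G z i * h z + H z i * g z)" if "i \<in> Basis" for i
    using locally_integrable_mult[OF lh lG[OF that] Bh] locally_integrable_mult[OF lg lH[OF that] Bg]
    by (simp add: locally_integrable_on_def mult.commute set_integral_add)
  have lgh: "locally_integrable_on S (\<lambda>z. g z * h z)"
    by (rule locally_integrable_mult[OF lg lh Bg])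
  have main: "set_lebesgue_integral lebesgue S (\<lambda>z. (g z * h z) * frechet_derivative \<eta>0 (at z) i) =
           - set_lebesgue_integral lebesgue S (\<lambda>z. (G z i * h z + H z i * g z) * \<eta>0 z)"
    if i: "i \<in> Basis" and \<eta>0: "test_function S \<eta>0" for i \<eta>0
  proof -
    obtain \<eta> C0 where \<eta>: "Ck 1 UNIV \<eta>" "compact C0" and C0: "C0 \<subseteq> S"
      and \<eta>0': "\<And>z. z \<notin> C0 \<Longrightarrow> \<eta> z = 0"
      and eq: "\<And>z. z \<in> S \<Longrightarrow> \<eta> z = \<eta>0 z"
        "\<And>z. z \<in> S \<Longrightarrow> frechet_derivative \<eta>0 (at z) = frechet_derivative \<eta> (at z)"
      by (rule test_function_extend[OF S \<eta>0], rule that)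
    note \<eta> = \<eta> \<eta>0'
    obtain r where r: "r > 0" "(\<Union>x\<in>C0. cball x r) \<subseteq> S"
      using compact_subset_open_imp_cball_epsilon_subset[OF \<eta>(2) S C0] by blast
    \<comment> \<open>The closed \<open>r\<close>-neighbourhood of the support, which contains all
      kernels of radius at most \<open>r\<close> centred in \<open>C0\<close>. It is compact as the
      sum of \<open>C0\<close> and a closed ball.\<close>
    define C where "C = (\<Union>x\<in>C0. cball x r)"
    have "C = {x + y |x y. x \<in> C0 \<and> y \<in> cball 0 r}" (is "_ = ?sum")
    proof (rule antisym)
      show "C \<subseteq> ?sum"
      proof
        fix z assume "z \<in> C"
        then obtain x where "x \<in> C0" "dist x z \<le> r" by (auto simp: C_def)
        then have "z = x + (z - x)" "x \<in> C0" "z - x \<in> cball 0 r" by (auto simp: dist_norm norm_minus_commute)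
        then show "z \<in> ?sum" by blast
      qed
      show "?sum \<subseteq> C" by (auto simp: C_def dist_norm)
    qed
    then have C: "compact C" "C \<subseteq> S"
      using r(2) compact_sums[OF \<eta>(2) compact_cball[of 0 r]] unfolding C_def by (simp_all only:)
    have C0C: "C0 \<subseteq> C" using r(1) by (force simp: C_def)
    have ig: "set_integrable lebesgue C g" "set_integrable lebesgue C (\<lambda>z. G z i)"
      "set_integrable lebesgue C h" "set_integrable lebesgue C (\<lambda>z. H z i)"
      using lg lh lG[OF i] lH[OF i] C by (auto simp: locally_integrable_on_def)
    obtain g' G' h' H' where g': "borel_rep C g g'" and G': "borel_rep C (\<lambda>z. G z i) G'"
      and h': "borel_rep C h h'" and H': "borel_rep C (\<lambda>z. H z i) H'"
      using ig[THEN borel_rep_exists] by blast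
    have g'i: "integrable lborel g'" and G'i: "integrable lborel G'" and h'i: "integrable lborel h'" and H'i: "integrable lborel H'"
      using g' G' h' H' by (auto simp: borel_rep_def)
    have Bg': "AE x in lborel. \<bar>g' x\<bar> \<le> \<bar>B\<bar>" by (rule borel_rep_bounded[OF g']) (use Bg C in auto)
    have Bh': "AE x in lborel. \<bar>h' x\<bar> \<le> \<bar>B\<bar>" by (rule borel_rep_bounded[OF h']) (use Bh C in auto)
    let ?D = "\<lambda>x. frechet_derivative \<eta> (at x) i"
    have cD: "continuous_on UNIV ?D" by (rule Ck1_continuous_derivative[OF \<eta>(1)])
    have c\<eta>: "continuous_on UNIV \<eta>" by (rule Ck1_continuous_on[OF \<eta>(1)])
    have D0: "?D z = 0" if "z \<notin> C0" for z
      by (rule frechet_derivative_outside_support[OF compact_imp_closed[OF \<eta>(2)] \<eta>(3) that])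
    obtain BD where BD: "\<And>z. \<bar>?D z\<bar> \<le> BD"
      using continuous_compact_support_bounded[OF cD \<eta>(2) D0] by blast
    obtain B\<eta> where B\<eta>: "\<And>z. \<bar>\<eta> z\<bar> \<le> B\<eta>"
      using continuous_compact_support_bounded[OF c\<eta> \<eta>(2) \<eta>(3)] by blast
    have i1: "integrable lborel (\<lambda>x. g' x * ?D x)"
      by (rule integrable_mult_bounded[OF g'i borel_measurable_continuous_onI[OF cD], of BD]) (simp add: BD)
    have i2: "integrable lborel (\<lambda>x. g' x * \<eta> x)"
      by (rule integrable_mult_bounded[OF g'i borel_measurable_continuous_onI[OF c\<eta>], of B\<eta>]) (simp add: B\<eta>)
    have i3: "integrable lborel (\<lambda>x. G' x * \<eta> x)"
      by (rule integrable_mult_bounded[OF G'i borel_measurable_continuous_onI[OF c\<eta>], of B\<eta>]) (simp add: B\<eta>)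
    have B1: "AE x in lborel. \<bar>g' x * ?D x\<bar> \<le> \<bar>B\<bar> * BD"
      using Bg' by eventually_elim (use BD in \<open>auto simp: abs_mult intro!: mult_mono\<close>)
    have B2: "AE x in lborel. \<bar>g' x * \<eta> x\<bar> \<le> \<bar>B\<bar> * B\<eta>"
      using Bg' by eventually_elim (use B\<eta> in \<open>auto simp: abs_mult intro!: mult_mono\<close>)
    \<comment> \<open>One radius has to serve \<open>h'\<close> and its derivative \<open>H'\<close>
      at the same time and to stay below \<open>r\<close>.\<close>
    let ?P = "\<lambda>n d. 0 < d \<and> d \<le> r \<and>
        (integrable lborel (\<lambda>x. mollify (mollifier d) h' x - h' x) \<and>
        (\<integral>x. \<bar>mollify (mollifier d) h' x - h' x\<bar> \<partial>lborel) \<le> inverse (real (Suc n))) \<and>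
        (integrable lborel (\<lambda>x. mollify (mollifier d) H' x - H' x) \<and>
        (\<integral>x. \<bar>mollify (mollifier d) H' x - H' x\<bar> \<partial>lborel) \<le> inverse (real (Suc n)))"
    have "\<exists>d. ?P n d" for n
    proof -
      have "inverse (real (Suc n)) > 0" by simp
      from mollify_L1[OF h'i this] mollify_L1[OF H'i this] obtain d1 d2 where
        d1: "d1 > 0" "\<And>d. 0 < d \<and> d \<le> d1 \<Longrightarrow> integrable lborel (\<lambda>x. mollify (mollifier d) h' x - h' x) \<and>
        (\<integral>x. \<bar>mollify (mollifier d) h' x - h' x\<bar> \<partial>lborel) \<le> inverse (real (Suc n))" and
        d2: "d2 > 0" "\<And>d. 0 < d \<and> d \<le> d2 \<Longrightarrow> integrable lborel (\<lambda>x. mollify (mollifier d) H' x - H' x) \<and>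
        (\<integral>x. \<bar>mollify (mollifier d) H' x - H' x\<bar> \<partial>lborel) \<le> inverse (real (Suc n))" by blast
      show ?thesis
        using d1(1) d2(1) r(1) d1(2)[of "min r (min d1 d2)"] d2(2)[of "min r (min d1 d2)"]
        by (intro exI[of _ "min r (min d1 d2)"]) auto
    qed
    then have "\<exists>d. \<forall>n. ?P n (d n)" by (intro choice allI)
    then obtain d where dP: "\<forall>n. ?P n (d n)" by (rule exE)
    have d: "0 < d n" "d n \<le> r"
      and dh: "integrable lborel (\<lambda>x. mollify (mollifier (d n)) h' x - h' x)"
        "(\<integral>x. \<bar>mollify (mollifier (d n)) h' x - h' x\<bar> \<partial>lborel) \<le> inverse (real (Suc n))"
      and dH: "integrable lborel (\<lambda>x. mollify (mollifier (d n)) H' x - H' x)"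
        "(\<integral>x. \<bar>mollify (mollifier (d n)) H' x - H' x\<bar> \<partial>lborel) \<le> inverse (real (Suc n))" for n
      using spec[OF dP, of n] by (iprover elim: conjE)+
    have limh: "(\<lambda>n. \<integral>x. \<bar>mollify (mollifier (d n)) h' x - h' x\<bar> \<partial>lborel) \<longlonglongrightarrow> 0"
      by (rule tendsto_sandwich[OF _ _ tendsto_const LIMSEQ_inverse_real_of_nat])
        (use dh(2) in \<open>auto intro!: always_eventually\<close>)
    have limH: "(\<lambda>n. \<integral>x. \<bar>mollify (mollifier (d n)) H' x - H' x\<bar> \<partial>lborel) \<longlonglongrightarrow> 0"
      by (rule tendsto_sandwich[OF _ _ tendsto_const LIMSEQ_inverse_real_of_nat])
        (use dH(2) in \<open>auto intro!: always_eventually\<close>)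
    obtain s :: "nat \<Rightarrow> nat" where s: "strict_mono s"
      and ae: "AE x in lborel. (\<lambda>n. mollify (mollifier (d (s n))) h' x - h' x) \<longlonglongrightarrow> 0"
      using tendsto_L1_AE_subseq[of lborel "\<lambda>n x. mollify (mollifier (d n)) h' x - h' x", OF dh(1)] limh by auto
    have l1: "(\<lambda>n. \<integral>x. (g' x * ?D x) * mollify (mollifier (d (s n))) h' x \<partial>lborel) \<longlonglongrightarrow> (\<integral>x. (g' x * ?D x) * h' x \<partial>lborel)"
      using LIMSEQ_subseq_LIMSEQ[OF integral_mollify_limit[OF i1 B1 h'i d(1) dh(1) limh] s] by (simp add: o_def)
    have l2: "(\<lambda>n. \<integral>x. (g' x * \<eta> x) * mollify (mollifier (d (s n))) H' x \<partial>lborel) \<longlonglongrightarrow> (\<integral>x. (g' x * \<eta> x) * H' x \<partial>lborel)"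
      using LIMSEQ_subseq_LIMSEQ[OF integral_mollify_limit[OF i2 B2 H'i d(1) dH(1) limH] s] by (simp add: o_def)
    have l3: "(\<lambda>n. \<integral>x. (G' x * \<eta> x) * mollify (mollifier (d (s n))) h' x \<partial>lborel) \<longlonglongrightarrow> (\<integral>x. (G' x * \<eta> x) * h' x \<partial>lborel)"
    proof (rule integral_dominated_convergence)
      have h'b: "h' \<in> borel_measurable borel" using h'i by auto
      have G\<eta>b: "(\<lambda>x. G' x * \<eta> x) \<in> borel_measurable borel" using i3 by auto
      show "(\<lambda>x. (G' x * \<eta> x) * h' x) \<in> borel_measurable lborel"
        using G\<eta>b h'b by simp
      show "(\<lambda>x. (G' x * \<eta> x) * mollify (mollifier (d (s n))) h' x) \<in> borel_measurable lborel" for n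
        using G\<eta>b borel_measurable_mollify[OF borel_measurable_mollifier[OF d(1)] h'b] by simp
      show "integrable lborel (\<lambda>x. \<bar>G' x * \<eta> x\<bar> * \<bar>B\<bar>)" using i3 by (intro integrable_mult_left integrable_abs)
      show "AE x in lborel. (\<lambda>n. (G' x * \<eta> x) * mollify (mollifier (d (s n))) h' x) \<longlonglongrightarrow> (G' x * \<eta> x) * h' x"
        using ae by eventually_elim (auto intro!: tendsto_mult_left simp: LIM_zero_iff)
      show "AE x in lborel. norm ((G' x * \<eta> x) * mollify (mollifier (d (s n))) h' x) \<le> \<bar>G' x * \<eta> x\<bar> * \<bar>B\<bar>" for n
      proof (rule AE_I2)
        fix x
        show "norm ((G' x * \<eta> x) * mollify (mollifier (d (s n))) h' x) \<le> \<bar>G' x * \<eta> x\<bar> * \<bar>B\<bar>"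
          using mollify_bounded[OF h'i d(1) Bh', of "s n" x] by (simp only: abs_mult real_norm_def) (intro mult_left_mono; simp)
      qed
    qed
    have "(\<Union>x\<in>C0. cball x (d n)) \<subseteq> C" for n
      using d(2)[of n] by (auto simp: C_def intro: order_trans)
    from mollified_product_rule[OF g h S i \<eta> d(1) this C g' G' h' H']
    have "(\<integral>x. (g' x * ?D x) * mollify (mollifier (d (s n))) h' x \<partial>lborel) =
      - (\<integral>x. (g' x * \<eta> x) * mollify (mollifier (d (s n))) H' x \<partial>lborel)
      - (\<integral>x. (G' x * \<eta> x) * mollify (mollifier (d (s n))) h' x \<partial>lborel)" for n .
    with tendsto_diff[OF tendsto_minus[OF l2] l3]
    have "(\<lambda>n. \<integral>x. (g' x * ?D x) * mollify (mollifier (d (s n))) h' x \<partial>lborel) \<longlonglongrightarrow>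
        - (\<integral>x. (g' x * \<eta> x) * H' x \<partial>lborel) - (\<integral>x. (G' x * \<eta> x) * h' x \<partial>lborel)" by simp
    from LIMSEQ_unique[OF l1 this]
    have fin: "(\<integral>x. (g' x * ?D x) * h' x \<partial>lborel) =
        - (\<integral>x. (g' x * \<eta> x) * H' x \<partial>lborel) - (\<integral>x. (G' x * \<eta> x) * h' x \<partial>lborel)" .
    have hb: "h' \<in> borel_measurable borel" and gb: "g' \<in> borel_measurable borel"
      and \<eta>b: "\<eta> \<in> borel_measurable borel" and Db: "?D \<in> borel_measurable borel"
      using h'i g'i c\<eta> cD by (auto intro: borel_measurable_continuous_onI)
    have rep1: "borel_rep C (\<lambda>z. g z * h z) (\<lambda>z. g' z * h' z)"
      by (rule borel_rep_mult[OF g' h']) (use Bh C in auto)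
    have rep2: "borel_rep C (\<lambda>z. G z i * h z + H z i * g z) (\<lambda>z. G' z * h' z + H' z * g' z)"
      by (intro borel_rep_add borel_rep_mult[OF G' h', of B] borel_rep_mult[OF H' g', of B]) (use Bg Bh C in auto)
    have "set_lebesgue_integral lebesgue S (\<lambda>z. (g z * h z) * frechet_derivative \<eta>0 (at z) i) =
        set_lebesgue_integral lebesgue S (\<lambda>z. (g z * h z) * ?D z)"
      unfolding set_lebesgue_integral_def using eq(2) by (intro Bochner_Integration.integral_cong) (auto simp: indicator_def)
    also have "\<dots> = (\<integral>z. (g' z * h' z) * ?D z \<partial>lborel)"
      by (rule borel_rep_integral[OF rep1 _ Db _ C(2)])
        (use lgh C D0 C0C in \<open>auto simp: locally_integrable_on_def\<close>)
    also have "\<dots> = (\<integral>x. (g' x * ?D x) * h' x \<partial>lborel)" by (simp add: mult_ac)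
    also have "\<dots> = - ((\<integral>x. (g' x * \<eta> x) * H' x \<partial>lborel) + (\<integral>x. (G' x * \<eta> x) * h' x \<partial>lborel))"
      using fin by simp
    also have "(\<integral>x. (g' x * \<eta> x) * H' x \<partial>lborel) + (\<integral>x. (G' x * \<eta> x) * h' x \<partial>lborel) =
        (\<integral>x. H' x * (g' x * \<eta> x) + (G' x * \<eta> x) * h' x \<partial>lborel)"
      using integrable_mult_bounded[OF H'i _ B2] integrable_mult_bounded[OF i3 hb Bh'] gb \<eta>b
      by (subst Bochner_Integration.integral_add) (auto simp: mult_ac)
    also have "\<dots> = (\<integral>z. (G' z * h' z + H' z * g' z) * \<eta> z \<partial>lborel)"
      by (rule Bochner_Integration.integral_cong) (auto simp: algebra_simps)
    also have "\<dots> = set_lebesgue_integral lebesgue S (\<lambda>z. (G z i * h z + H z i * g z) * \<eta> z)"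
      by (rule borel_rep_integral[OF rep2 _ \<eta>b _ C(2), symmetric])
        (use li[OF i] C \<eta>(3) C0C in \<open>auto simp: locally_integrable_on_def\<close>)
    also have "\<dots> = set_lebesgue_integral lebesgue S (\<lambda>z. (G z i * h z + H z i * g z) * \<eta>0 z)"
      unfolding set_lebesgue_integral_def using eq(1) by (intro Bochner_Integration.integral_cong) (auto simp: indicator_def)
    finally show ?thesis .
  qed
  show ?thesis
    unfolding has_weak_derivative_on_def using lgh li main by auto
qed

text \<open>Difference quotients in direction \<open>e\<close> have integral 0 by translation
  invariance, and dominated convergence carries this over to the derivative. This replaces
  integration by parts along coordinate lines.\<close>

lemma integral_directional_derivative_eq_0:
  fixes \<phi> :: "'a::euclidean_space \<Rightarrow> real"
  assumes \<phi>: "Ck 1 UNIV \<phi>" "compact C" "\<And>z. z \<notin> C \<Longrightarrow> \<phi> z = 0"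
  shows "(\<integral>x. frechet_derivative \<phi> (at x) e \<partial>lborel) = 0"
    and "integrable lborel (\<lambda>x. frechet_derivative \<phi> (at x) e)"
proof -
  let ?D = "\<lambda>x. frechet_derivative \<phi> (at x) e"
  have cD: "continuous_on UNIV ?D" by (rule Ck1_continuous_derivative[OF \<phi>(1)])
  have D0: "?D z = 0" if "z \<notin> C" for z
    by (rule frechet_derivative_outside_support[OF compact_imp_closed[OF \<phi>(2)] \<phi>(3) that])
  obtain B where B: "\<And>z. \<bar>?D z\<bar> \<le> B"
    using continuous_compact_support_bounded[OF cD \<phi>(2) D0] by blast
  have "integrable lborel (\<lambda>x. indicator C x *\<^sub>R ?D x)"
    by (rule borel_integrable_compact[OF \<phi>(2) continuous_on_subset[OF cD]]) simp
  moreover have "(\<lambda>x. indicator C x *\<^sub>R ?D x) = ?D"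
    using D0 by (auto simp: indicator_def fun_eq_iff)
  ultimately show "integrable lborel ?D" by simp
  obtain R where R: "\<And>z. z \<in> C \<Longrightarrow> norm z \<le> R"
    using compact_imp_bounded[OF \<phi>(2)] by (auto simp: bounded_iff)
  let ?t = "\<lambda>n. inverse (real (Suc n))"
  let ?q = "\<lambda>n x. (\<phi> (x + ?t n *\<^sub>R e) - \<phi> x) / ?t n"
  have c\<phi>: "continuous_on UNIV \<phi>" by (rule Ck1_continuous_on[OF \<phi>(1)])
  have "integrable lborel (\<lambda>x. indicator C x *\<^sub>R \<phi> x)"
    by (rule borel_integrable_compact[OF \<phi>(2) continuous_on_subset[OF c\<phi>]]) simp
  moreover have "(\<lambda>x. indicator C x *\<^sub>R \<phi> x) = \<phi>"
    using \<phi>(3) by (auto simp: indicator_def fun_eq_iff)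
  ultimately have i\<phi>: "integrable lborel \<phi>" by simp
  have q0: "(\<integral>x. ?q n x \<partial>lborel) = 0" for n
    using lborel_integrable_translate[OF i\<phi>, of "?t n *\<^sub>R e"] i\<phi>
    by (simp add: Bochner_Integration.integral_diff)
  have line: "((\<lambda>s. \<phi> (x + s *\<^sub>R e)) has_real_derivative ?D (x + s *\<^sub>R e)) (at s)" for x s
  proof -
    have "((\<lambda>s. x + s *\<^sub>R e) has_derivative (\<lambda>h. h *\<^sub>R e)) (at s)"
      by (auto intro!: derivative_eq_intros)
    from diff_chain_at[OF this Ck1_has_derivative[OF \<phi>(1)]]
    have "((\<lambda>s. \<phi> (x + s *\<^sub>R e)) has_derivative (\<lambda>h. frechet_derivative \<phi> (at (x + s *\<^sub>R e)) (h *\<^sub>R e))) (at s)"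
      by (simp add: o_def)
    moreover have "frechet_derivative \<phi> (at (x + s *\<^sub>R e)) (h *\<^sub>R e) = ?D (x + s *\<^sub>R e) * h" for h
      using linear_scale[OF has_derivative_linear[OF Ck1_has_derivative[OF \<phi>(1)]]] by simp
    ultimately show ?thesis by (simp add: has_field_derivative_def)
  qed
  have mvt: "\<exists>z. 0 < z \<and> z < ?t n \<and> ?q n x = ?D (x + z *\<^sub>R e)" for n x
  proof -
    have "\<exists>z. 0 < z \<and> z < ?t n \<and> \<phi> (x + ?t n *\<^sub>R e) - \<phi> (x + 0 *\<^sub>R e) = (?t n - 0) * ?D (x + z *\<^sub>R e)"
      by (rule MVT2) (auto intro: line)
    then show ?thesis by (auto simp: field_simps)
  qed
  have "(\<lambda>n. \<integral>x. ?q n x \<partial>lborel) \<longlonglongrightarrow> (\<integral>x. ?D x \<partial>lborel)"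
  proof (rule integral_dominated_convergence)
    show "?D \<in> borel_measurable lborel"
      using borel_measurable_continuous_onI[OF cD] by simp
    have "\<phi> \<in> borel_measurable borel" using borel_measurable_continuous_onI[OF c\<phi>] .
    then show "?q n \<in> borel_measurable lborel" for n by measurable
    \<comment> \<open>The steps \<open>?t n\<close> are at most 1, so the quotient vanishes unless
      \<open>x\<close> lies within \<open>norm e\<close> of the support, which is contained in
      \<open>cball 0 R\<close>. On that ball the mean value theorem bounds it by
      \<open>B\<close>.\<close>
    have "integrable lborel (\<lambda>x. indicator (cball (0::'a) (R + norm e)) x *\<^sub>R (\<bar>B\<bar>::real))"
      by (rule borel_integrable_compact) auto
    then show "integrable lborel (\<lambda>x. indicator (cball (0::'a) (R + norm e)) x * \<bar>B\<bar>)" by simp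
    show "AE x in lborel. (\<lambda>n. ?q n x) \<longlonglongrightarrow> ?D x"
    proof (rule AE_I2)
      fix x
      have "((\<lambda>h. (\<phi> (x + (0 + h) *\<^sub>R e) - \<phi> (x + 0 *\<^sub>R e)) / h) \<longlongrightarrow> ?D (x + 0 *\<^sub>R e)) (at 0)"
        using line[of x 0] unfolding DERIV_def .
      moreover have "filterlim ?t (at 0) sequentially"
        using LIMSEQ_inverse_real_of_nat by (auto simp: filterlim_at intro!: always_eventually)
      ultimately show "(\<lambda>n. ?q n x) \<longlonglongrightarrow> ?D x"
        using filterlim_compose by fastforce
    qed
    show "AE x in lborel. norm (?q n x) \<le> indicator (cball 0 (R + norm e)) x * \<bar>B\<bar>" for n
    proof (rule AE_I2)
      fix x
      obtain z where z: "0 < z" "z < ?t n" "?q n x = ?D (x + z *\<^sub>R e)" using mvt by blast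
      show "norm (?q n x) \<le> indicator (cball 0 (R + norm e)) x * \<bar>B\<bar>"
      proof (cases "x \<in> cball 0 (R + norm e)")
        case True then show ?thesis using z(3) B[of "x + z *\<^sub>R e"] by simp
      next
        case False
        have "?t n \<le> 1" by (simp add: field_simps)
        then have "norm (z *\<^sub>R e) \<le> norm e" using z by (simp add: mult_left_le_one_le)
        moreover have "norm x \<le> norm (x + z *\<^sub>R e) + norm (z *\<^sub>R e)"
          using norm_triangle_ineq4[of "x + z *\<^sub>R e" "z *\<^sub>R e"] by simp
        ultimately have "x + z *\<^sub>R e \<notin> C" using R[of "x + z *\<^sub>R e"] False by auto
        then show ?thesis using D0 z(3) by simp
      qed
    qed
  qed
  then show "(\<integral>x. ?D x \<partial>lborel) = 0" unfolding q0 by (simp add: LIMSEQ_const_iff)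
qed

text \<open>The product of \<open>f\<close> with a test function extends by zero to a C1 function of
  compact support, whose derivative integrates to 0. It provides the weak derivatives of functions
  of the base point alone.\<close>

lemma Ck1_has_weak_derivative_on:
  fixes S :: "'a::euclidean_space set"
  assumes S: "open S" and f: "Ck 1 S f"
  shows "has_weak_derivative_on S f (\<lambda>z. frechet_derivative f (at z))"
proof -
  have li: "locally_integrable_on S g" if "continuous_on S g" for g
    unfolding locally_integrable_on_def set_integrable_def
  proof (intro allI impI)
    fix C assume C: "compact C \<and> C \<subseteq> S"
    then have "integrable lborel (\<lambda>x. indicator C x *\<^sub>R g x)"
      using that by (intro borel_integrable_compact) (auto intro: continuous_on_subset)
    then show "integrable lebesgue (\<lambda>x. indicator C x *\<^sub>R g x)"
      using integrable_completion borel_measurable_integrable by blast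
  qed
  have main: "set_lebesgue_integral lebesgue S (\<lambda>z. f z * frechet_derivative \<eta>0 (at z) i) =
           - set_lebesgue_integral lebesgue S (\<lambda>z. frechet_derivative f (at z) i * \<eta>0 z)"
    if i: "i \<in> Basis" and \<eta>0: "test_function S \<eta>0" for i \<eta>0
  proof -
    obtain C where C: "Ck 1 S \<eta>0" "compact C" "C \<subseteq> S" "\<And>z. z \<in> S - C \<Longrightarrow> \<eta>0 z = 0"
      using \<eta>0 by (auto simp: test_function_def)
    let ?\<phi> = "\<lambda>z. if z \<in> S then f z * \<eta>0 z else 0"
    have C1: "Ck 1 UNIV ?\<phi>"
      by (rule Ck1_zero_extension[OF S Ck1_mult[OF f C(1)] compact_imp_closed[OF C(2)] C(3)]) (use C(4) in auto)
    have supp: "?\<phi> z = 0" if "z \<notin> C" for z using C(4) that by auto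
    note int = integral_directional_derivative_eq_0[OF C1 C(2) supp, of i]
    have D: "frechet_derivative ?\<phi> (at z) i = f z * frechet_derivative \<eta>0 (at z) i + frechet_derivative f (at z) i * \<eta>0 z"
      if "z \<in> S" for z
    proof -
      have "((\<lambda>z. f z * \<eta>0 z) has_derivative (\<lambda>w. f z * frechet_derivative \<eta>0 (at z) w + frechet_derivative f (at z) w * \<eta>0 z)) (at z)"
        by (rule has_derivative_mult[OF Ck1_has_derivative[OF f that] Ck1_has_derivative[OF C(1) that]])
      then have "(?\<phi> has_derivative (\<lambda>w. f z * frechet_derivative \<eta>0 (at z) w + frechet_derivative f (at z) w * \<eta>0 z)) (at z)"
        by (rule has_derivative_transform_within_open[OF _ S that]) auto
      from frechet_derivative_at[OF this] show ?thesis by metis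
    qed
    have D0: "frechet_derivative ?\<phi> (at z) i = 0" if "z \<notin> S" for z
      by (rule frechet_derivative_outside_support[OF compact_imp_closed[OF C(2)] supp]) (use that C in auto)
    have Db: "(\<lambda>x. frechet_derivative ?\<phi> (at x) i) \<in> borel_measurable lborel"
      using int(2) by auto
    have b: "set_integrable lebesgue S (\<lambda>z. frechet_derivative f (at z) i * \<eta>0 z)"
      by (rule set_integrable_mult_test[OF li[OF Ck1_continuous_derivative[OF f]] S \<eta>0])
    have a: "integrable lebesgue (\<lambda>x. frechet_derivative ?\<phi> (at x) i)" "(\<integral>x. frechet_derivative ?\<phi> (at x) i \<partial>lebesgue) = 0"
      using int integrable_completion[OF Db] integral_completion[OF Db] by auto
    have "set_lebesgue_integral lebesgue S (\<lambda>z. f z * frechet_derivative \<eta>0 (at z) i) =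
      (\<integral>z. frechet_derivative ?\<phi> (at z) i - indicator S z *\<^sub>R (frechet_derivative f (at z) i * \<eta>0 z) \<partial>lebesgue)"
      unfolding set_lebesgue_integral_def
    proof (rule Bochner_Integration.integral_cong)
      fix z
      show "indicator S z *\<^sub>R (f z * frechet_derivative \<eta>0 (at z) i) =
        frechet_derivative ?\<phi> (at z) i - indicator S z *\<^sub>R (frechet_derivative f (at z) i * \<eta>0 z)"
      proof (cases "z \<in> S")
        case True show ?thesis unfolding D[OF True] using True by simp
      next
        case False show ?thesis unfolding D0[OF False] using False by simp
      qed
    qed simp
    also have "\<dots> = (\<integral>x. frechet_derivative ?\<phi> (at x) i \<partial>lebesgue) -
       (\<integral>z. indicator S z *\<^sub>R (frechet_derivative f (at z) i * \<eta>0 z) \<partial>lebesgue)"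
      by (rule Bochner_Integration.integral_diff[OF a(1) b[unfolded set_integrable_def]])
    finally show ?thesis using a(2) by (simp add: set_lebesgue_integral_def)
  qed
  show ?thesis
    unfolding has_weak_derivative_on_def
    using li[OF Ck1_continuous_on[OF f]] li[OF Ck1_continuous_derivative[OF f]] main by auto
qed

text \<open>An open set is a countable union of compact subsets, and integrability on each of them
  includes measurability. In this way weak derivatives become measurable on a whole chart
  image.\<close>

lemma locally_integrable_measurable:
  assumes "open S" "locally_integrable_on S f"
  shows "f \<in> borel_measurable (lebesgue_on S)"
proof -
  obtain C where C: "\<And>n::nat. compact (C n)" "\<And>n. C n \<subseteq> S" "(\<Union>n. C n) = S"
    using open_Union_compact_subsets[OF assms(1)] by metis
  show ?thesis
  proof (rule measurable_piecewise_restrict2[where A = C])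
    show "C n \<in> sets (lebesgue_on S)" for n
      using C(2)[of n] lmeasurable_compact[OF C(1)[of n]] \<open>open S\<close>
      by (auto simp: sets_restrict_space_iff fmeasurableD)
    show "space (lebesgue_on S) = (\<Union>n. C n)" using C(3) by simp
    fix n
    have "integrable lebesgue (\<lambda>x. indicator (C n) x *\<^sub>R f x)"
      using assms(2) C(1,2) by (auto simp: locally_integrable_on_def set_integrable_def)
    then have "(\<lambda>x. indicator (C n) x *\<^sub>R f x) \<in> borel_measurable (lebesgue_on S)"
      by (intro measurable_restrict_space1 borel_measurable_integrable)
    then show "\<exists>h\<in>borel_measurable (lebesgue_on S). \<forall>x\<in>C n. f x = h x"
      by (rule bexI[rotated]) simp
  qed
qed

section \<open>Manifolds of class C1\<close>

text \<open>Injectivity of the charts makes images commute with intersections; hence the family in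
  \<open>mtop\<close> is a topology and \<open>openin\<close> unfolds to it.\<close>

lemma openin_mtop:
  assumes "\<And>c. c \<in> X \<Longrightarrow> inj_on (snd c) (fst c)"
  shows "openin (mtop X) W \<longleftrightarrow> W \<subseteq> points X \<and> (\<forall>c\<in>X. open (snd c ` (W \<inter> fst c)))"
proof -
  let ?L = "\<lambda>W. W \<subseteq> points X \<and> (\<forall>c\<in>X. open (snd c ` (W \<inter> fst c)))"
  have "istopology ?L"
    unfolding istopology_def
  proof (intro conjI allI impI ballI)
    fix S T c assume ST: "?L S" "?L T" and c: "c \<in> X"
    have "snd c ` (S \<inter> T \<inter> fst c) = snd c ` ((S \<inter> fst c) \<inter> (T \<inter> fst c))"
      by (rule arg_cong[of _ _ "(`) (snd c)"]) auto
    also have "\<dots> = snd c ` (S \<inter> fst c) \<inter> snd c ` (T \<inter> fst c)"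
      by (rule inj_on_image_Int[OF assms[OF c]]) auto
    finally show "open (snd c ` (S \<inter> T \<inter> fst c))" using ST c by auto
  next
    fix \<K> c assume K: "\<forall>W\<in>\<K>. ?L W" and c: "c \<in> X"
    have "snd c ` (\<Union>\<K> \<inter> fst c) = (\<Union>W\<in>\<K>. snd c ` (W \<inter> fst c))" by auto
    then show "open (snd c ` (\<Union>\<K> \<inter> fst c))" using K c by auto
  qed auto
  then show ?thesis unfolding mtop_def by (simp add: topology_inverse')
qed

lemma topspace_mtop_points:
  assumes inj: "\<And>c. c \<in> X \<Longrightarrow> inj_on (snd c) (fst c)" and "\<And>c. c \<in> X \<Longrightarrow> open (chart_image c)"
  shows "topspace (mtop X) = points X"
proof -
  note iff = openin_mtop[of X, OF inj]
  have "snd c ` (points X \<inter> fst c) = chart_image c" if "c \<in> X" for c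
    using that by (auto simp: points_def chart_image_def)
  then have "openin (mtop X) (points X)" using iff assms(2) by auto
  moreover have "topspace (mtop X) \<subseteq> points X"
    using iff openin_topspace by blast
  ultimately show ?thesis by (simp add: openin_subset subset_antisym)
qed

lemma chart_inv_image:
  assumes "z \<in> chart_image c"
  shows "chart_inv c z \<in> fst c" "snd c (chart_inv c z) = z"
  using assms by (auto simp: chart_inv_def chart_image_def inv_into_into f_inv_into_f)

lemma chart_at_mem: "x \<in> points X \<Longrightarrow> chart_at X x \<in> X \<and> x \<in> fst (chart_at X x)"
  unfolding chart_at_def points_def by (rule someI_ex) auto

definition C1_fun :: "('p, 'a::euclidean_space) atlas \<Rightarrow> ('p \<Rightarrow> real) \<Rightarrow> bool" where
  "C1_fun X f \<longleftrightarrow> (\<forall>c\<in>X. Ck 1 (chart_image c) (f \<circ> chart_inv c))"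

definition lift :: "('p, 'a) chart \<Rightarrow> ('a \<Rightarrow> real) \<Rightarrow> 'p \<Rightarrow> real" where
  "lift c \<phi> x = (if x \<in> fst c then \<phi> (snd c x) else 0)"

text \<open>Kept apart from \<open>C1_manifold\<close> because for the bundle of linear maps the
  description of open sets and the continuity of charts are needed before its Hausdorff property can
  be proved.\<close>

locale C1_charts =
  fixes X :: "('p, 'a::euclidean_space) atlas"
  assumes inj: "c \<in> X \<Longrightarrow> inj_on (snd c) (fst c)"
    and open_image: "c \<in> X \<Longrightarrow> open (chart_image c)"
    and open_overlap: "c \<in> X \<Longrightarrow> d \<in> X \<Longrightarrow> open (snd c ` (fst c \<inter> fst d))"
    and transition: "c \<in> X \<Longrightarrow> d \<in> X \<Longrightarrow> Ck 1 (snd c ` (fst c \<inter> fst d)) (snd d \<circ> chart_inv c)"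
begin

lemma chart_inv_eq: "c \<in> X \<Longrightarrow> x \<in> fst c \<Longrightarrow> chart_inv c (snd c x) = x"
  unfolding chart_inv_def by (rule inv_into_f_f[OF inj])

lemma openin_iff: "openin (mtop X) W \<longleftrightarrow> W \<subseteq> points X \<and> (\<forall>c\<in>X. open (snd c ` (W \<inter> fst c)))"
  by (rule openin_mtop[OF inj])

lemma topspace_mtop: "topspace (mtop X) = points X"
  by (rule topspace_mtop_points[OF inj open_image])

lemma openin_chart_vimage:
  assumes c: "c \<in> X" and "open O'"
  shows "openin (mtop X) {x \<in> fst c. snd c x \<in> O'}"
  unfolding openin_iff
proof (intro conjI ballI)
  show "{x \<in> fst c. snd c x \<in> O'} \<subseteq> points X" using c by (auto simp: points_def)
  fix d assume d: "d \<in> X"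
  let ?S = "snd d ` (fst d \<inter> fst c)"
  have "snd d ` ({x \<in> fst c. snd c x \<in> O'} \<inter> fst d) = ?S \<inter> (snd c \<circ> chart_inv d) -` O'"
    using chart_inv_eq[OF d] by (auto simp: image_iff)
  then show "open (snd d ` ({x \<in> fst c. snd c x \<in> O'} \<inter> fst d))"
    using continuous_open_preimage[OF Ck1_continuous_on[OF transition[OF d c]] open_overlap[OF d c] \<open>open O'\<close>]
    by simp
qed

lemma open_chart_image: "openin (mtop X) W \<Longrightarrow> c \<in> X \<Longrightarrow> open (snd c ` (W \<inter> fst c))"
  by (auto simp: openin_iff)

lemma compactin_chart_inv_image:
  assumes c: "c \<in> X" and C: "compact C" "C \<subseteq> chart_image c"
  shows "compactin (mtop X) (chart_inv c ` C)"
proof (rule image_compactin)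
  show "compactin (top_of_set (chart_image c)) C"
    using C by (simp add: compactin_subtopology)
  show "continuous_map (top_of_set (chart_image c)) (mtop X) (chart_inv c)"
    unfolding continuous_map_def
  proof (intro conjI allI impI)
    show "chart_inv c \<in> topspace (top_of_set (chart_image c)) \<rightarrow> topspace (mtop X)"
      using chart_inv_image[of _ c] c by (force simp: topspace_mtop points_def)
    fix W assume W: "openin (mtop X) W"
    have "{z \<in> topspace (top_of_set (chart_image c)). chart_inv c z \<in> W} = snd c ` (W \<inter> fst c)"
      using chart_inv_image[of _ c] chart_inv_eq[OF c] by (force simp: chart_image_def)
    then show "openin (top_of_set (chart_image c)) {z \<in> topspace (top_of_set (chart_image c)). chart_inv c z \<in> W}"
      using open_chart_image[OF W c] by (auto simp: openin_open chart_image_def)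
  qed
qed

end

text \<open>A countable covering subatlas takes the place of the countable basis: it yields
  countable covers by balls, along which null sets are united, and it passes from \<open>M\<close>
  and \<open>N\<close> to the bundle by taking pairs of charts.\<close>

locale C1_manifold = C1_charts X for X :: "('p, 'a::euclidean_space) atlas" +
  assumes Hausdorff: "Hausdorff_space (mtop X)"
    and countable_subatlas: "\<exists>X0\<subseteq>X. countable X0 \<and> points X0 = points X"
begin

abbreviation trans_deriv :: "('p, 'a) chart \<Rightarrow> ('p, 'a) chart \<Rightarrow> 'p \<Rightarrow> 'a \<Rightarrow> 'a" where
  "trans_deriv c d x \<equiv> frechet_derivative (snd d \<circ> chart_inv c) (at (snd c x))"

lemma trans_has_derivative:
  assumes "c \<in> X" "d \<in> X" "x \<in> fst c" "x \<in> fst d"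
  shows "((snd d \<circ> chart_inv c) has_derivative trans_deriv c d x) (at (snd c x))"
  using assms by (intro Ck1_has_derivative[OF transition]) auto

lemma linear_trans_deriv:
  "c \<in> X \<Longrightarrow> d \<in> X \<Longrightarrow> x \<in> fst c \<Longrightarrow> x \<in> fst d \<Longrightarrow> linear (trans_deriv c d x)"
  by (rule has_derivative_linear[OF trans_has_derivative])

lemma deriv_change_chart:
  assumes c: "c \<in> X" "x \<in> fst c" and d: "d \<in> X" "x \<in> fst d"
    and f: "((f \<circ> chart_inv d) has_derivative D) (at (snd d x))"
  shows "((f \<circ> chart_inv c) has_derivative (\<lambda>w. D (trans_deriv c d x w))) (at (snd c x))"
proof -
  have "(snd d \<circ> chart_inv c) (snd c x) = snd d x" using c by (simp add: chart_inv_eq)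
  with diff_chain_at[OF trans_has_derivative[OF c(1) d(1) c(2) d(2)]] f
  have "((f \<circ> chart_inv d) \<circ> (snd d \<circ> chart_inv c) has_derivative D \<circ> trans_deriv c d x) (at (snd c x))" by simp
  then have "(f \<circ> chart_inv c has_derivative D \<circ> trans_deriv c d x) (at (snd c x))"
    by (rule has_derivative_transform_within_open[OF _ open_overlap[OF c(1) d(1)]])
      (use c d in \<open>auto simp: chart_inv_eq\<close>)
  then show ?thesis by (simp add: o_def)
qed

lemma trans_deriv_compose:
  assumes "c \<in> X" "d \<in> X" "e \<in> X" "x \<in> fst c" "x \<in> fst d" "x \<in> fst e"
  shows "trans_deriv d e x (trans_deriv c d x w) = trans_deriv c e x w"
proof -
  have "((snd e \<circ> chart_inv c) has_derivative (\<lambda>w. trans_deriv d e x (trans_deriv c d x w))) (at (snd c x))"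
    by (intro deriv_change_chart trans_has_derivative assms)
  from fun_cong[OF frechet_derivative_at[OF this], of w] show ?thesis by simp
qed

lemma trans_deriv_same:
  assumes "c \<in> X" "x \<in> fst c" shows "trans_deriv c c x w = w"
proof -
  have "((\<lambda>z. z) has_derivative (\<lambda>w. w)) (at (snd c x))" by simp
  then have "((snd c \<circ> chart_inv c) has_derivative (\<lambda>w. w)) (at (snd c x))"
    by (rule has_derivative_transform_within_open[OF _ open_image[OF assms(1)]])
      (use assms chart_inv_image[of _ c] in \<open>auto simp: chart_image_def\<close>)
  from fun_cong[OF frechet_derivative_at[OF this], of w] show ?thesis by simp
qed

section \<open>Tangent spaces\<close>

lemma tangentI:
  assumes "\<And>c d. c \<in> X \<Longrightarrow> d \<in> X \<Longrightarrow> x \<in> fst c \<Longrightarrow> x \<in> fst d \<Longrightarrow> v d = trans_deriv c d x (v c)"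
    and "\<And>c. \<not> (c \<in> X \<and> x \<in> fst c) \<Longrightarrow> v c = 0"
  shows "v \<in> tangent_space X x"
  unfolding tangent_space_def using assms by blast

lemma tangentD:
  "v \<in> tangent_space X x \<Longrightarrow> c \<in> X \<Longrightarrow> d \<in> X \<Longrightarrow> x \<in> fst c \<Longrightarrow> x \<in> fst d \<Longrightarrow> v d = trans_deriv c d x (v c)"
  unfolding tangent_space_def by blast

lemma tangent_outside: "v \<in> tangent_space X x \<Longrightarrow> \<not> (c \<in> X \<and> x \<in> fst c) \<Longrightarrow> v c = 0"
  unfolding tangent_space_def by blast

lemma tangent_ext:
  assumes "v \<in> tangent_space X x" "w \<in> tangent_space X x" "c \<in> X" "x \<in> fst c" "v c = w c"
  shows "v = w"
proof
  fix d show "v d = w d"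
    using tangentD[OF assms(1,3) _ assms(4), of d] tangentD[OF assms(2,3) _ assms(4), of d]
      tangent_outside[OF assms(1), of d] tangent_outside[OF assms(2), of d] assms(5)
    by (cases "d \<in> X \<and> x \<in> fst d") simp_all
qed

lemma tvec_of_in: "c \<in> X \<Longrightarrow> x \<in> fst c \<Longrightarrow> tvec_of X c x w \<in> tangent_space X x"
  by (rule tangentI) (auto simp: tvec_of_def trans_deriv_compose)

lemma tvec_of_chart: "c \<in> X \<Longrightarrow> x \<in> fst c \<Longrightarrow> tvec_of X c x w c = w"
  by (simp add: tvec_of_def trans_deriv_same)

lemma tvec_of_eq: "v \<in> tangent_space X x \<Longrightarrow> c \<in> X \<Longrightarrow> x \<in> fst c \<Longrightarrow> tvec_of X c x (v c) = v"
  by (rule tangent_ext[OF tvec_of_in, of c x v c]) (auto simp: tvec_of_chart)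

lemma tangent_add:
  assumes v: "v \<in> tangent_space X x" and w: "w \<in> tangent_space X x"
  shows "tvec_add v w \<in> tangent_space X x"
proof (rule tangentI)
  fix c d assume c: "c \<in> X" "d \<in> X" "x \<in> fst c" "x \<in> fst d"
  show "tvec_add v w d = trans_deriv c d x (tvec_add v w c)"
    using tangentD[OF v c] tangentD[OF w c] linear_add[OF linear_trans_deriv[OF c]]
    by (simp add: tvec_add_def)
qed (use tangent_outside[OF v] tangent_outside[OF w] in \<open>simp add: tvec_add_def\<close>)

lemma tangent_scale:
  assumes v: "v \<in> tangent_space X x" shows "tvec_scale r v \<in> tangent_space X x"
proof (rule tangentI)
  fix c d assume c: "c \<in> X" "d \<in> X" "x \<in> fst c" "x \<in> fst d"
  show "tvec_scale r v d = trans_deriv c d x (tvec_scale r v c)"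
    using tangentD[OF v c] linear_scale[OF linear_trans_deriv[OF c]]
    by (simp add: tvec_scale_def)
qed (use tangent_outside[OF v] in \<open>simp add: tvec_scale_def\<close>)

lemma tangent_zero: "tvec_zero \<in> tangent_space X x"
  by (rule tangentI) (auto simp: tvec_zero_def linear_0[OF linear_trans_deriv])

lemma tvec_of_add: "c \<in> X \<Longrightarrow> x \<in> fst c \<Longrightarrow> tvec_of X c x (v + w) = tvec_add (tvec_of X c x v) (tvec_of X c x w)"
  by (rule ext) (simp add: tvec_of_def tvec_add_def linear_add[OF linear_trans_deriv])

lemma tvec_of_scale: "c \<in> X \<Longrightarrow> x \<in> fst c \<Longrightarrow> tvec_of X c x (r *\<^sub>R v) = tvec_scale r (tvec_of X c x v)"
  by (rule ext) (simp add: tvec_of_def tvec_scale_def linear_scale[OF linear_trans_deriv])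

lemma points_tangent_atlas: "points (tangent_atlas X) = {(x, v). x \<in> points X \<and> v \<in> tangent_space X x}"
  by (auto simp: points_def tangent_atlas_def tangent_chart_def)

section \<open>Differentials of C1 functions\<close>

lemma C1_fun_has_derivative:
  "C1_fun X f \<Longrightarrow> c \<in> X \<Longrightarrow> x \<in> fst c \<Longrightarrow>
    ((f \<circ> chart_inv c) has_derivative frechet_derivative (f \<circ> chart_inv c) (at (snd c x))) (at (snd c x))"
  unfolding C1_fun_def by (rule Ck1_has_derivative[of "chart_image c"]) (blast, simp add: chart_image_def)

text \<open>Coordinates of tangent vectors transform by the derivative of the chart change, so by
  the chain rule the choice of \<open>chart_at\<close> in \<open>dreal\<close> does not
  matter.\<close>

lemma dreal_chart:
  assumes f: "C1_fun X f" and c: "c \<in> X" "x \<in> fst c" and v: "v \<in> tangent_space X x"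
  shows "dreal X f (x, v) = frechet_derivative (f \<circ> chart_inv c) (at (snd c x)) (v c)"
proof -
  let ?d = "chart_at X x"
  have d: "?d \<in> X" "x \<in> fst ?d" using chart_at_mem[of x X] c by (auto simp: points_def)
  have "((f \<circ> chart_inv ?d) has_derivative
      (\<lambda>w. frechet_derivative (f \<circ> chart_inv c) (at (snd c x)) (trans_deriv ?d c x w))) (at (snd ?d x))"
    by (intro deriv_change_chart d c C1_fun_has_derivative f)
  from fun_cong[OF frechet_derivative_at[OF this], of "v ?d"] tangentD[OF v d(1) c(1) d(2) c(2)]
  show ?thesis by (simp add: dreal_def Let_def)
qed

lemma dreal_add:
  assumes f: "C1_fun X f" and "x \<in> points X"
  shows "dreal X f (x, tvec_add v w) = dreal X f (x, v) + dreal X f (x, w)"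
  using chart_at_mem[OF assms(2)] linear_add[OF has_derivative_linear[OF C1_fun_has_derivative[OF f]]]
  by (simp add: dreal_def Let_def tvec_add_def)

lemma dreal_scale:
  assumes f: "C1_fun X f" and "x \<in> points X"
  shows "dreal X f (x, tvec_scale r v) = r * dreal X f (x, v)"
  using chart_at_mem[OF assms(2)] linear_scale[OF has_derivative_linear[OF C1_fun_has_derivative[OF f]]]
  by (simp add: dreal_def Let_def tvec_scale_def)

lemma C1_fun_mult: "C1_fun X f \<Longrightarrow> C1_fun X g \<Longrightarrow> C1_fun X (\<lambda>x. f x * g x)"
  unfolding C1_fun_def by (auto simp: o_def intro: Ck1_mult simp del: One_nat_def)

lemma dreal_mult:
  assumes f: "C1_fun X f" and g: "C1_fun X g" and x: "x \<in> points X"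
  shows "dreal X (\<lambda>x. f x * g x) (x, v) = dreal X f (x, v) * g x + dreal X g (x, v) * f x"
proof -
  let ?c = "chart_at X x"
  have c: "?c \<in> X" "x \<in> fst ?c" using chart_at_mem[OF x] by auto
  have "((\<lambda>z. (f \<circ> chart_inv ?c) z * (g \<circ> chart_inv ?c) z) has_derivative
     (\<lambda>w. (f \<circ> chart_inv ?c) (snd ?c x) * frechet_derivative (g \<circ> chart_inv ?c) (at (snd ?c x)) w +
        frechet_derivative (f \<circ> chart_inv ?c) (at (snd ?c x)) w * (g \<circ> chart_inv ?c) (snd ?c x))) (at (snd ?c x))"
    by (intro has_derivative_mult C1_fun_has_derivative f g c)
  from fun_cong[OF frechet_derivative_at[OF this]]
  have "frechet_derivative ((\<lambda>x. f x * g x) \<circ> chart_inv ?c) (at (snd ?c x)) w =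
      f x * frechet_derivative (g \<circ> chart_inv ?c) (at (snd ?c x)) w +
        frechet_derivative (f \<circ> chart_inv ?c) (at (snd ?c x)) w * g x" for w
    using chart_inv_eq[OF c] by (simp add: o_def)
  then show ?thesis by (simp add: dreal_def Let_def algebra_simps)
qed

lemma C1c_imp_C1_fun: "f \<in> C1c X \<Longrightarrow> C1_fun X f"
  by (simp add: C1c_def C1_fun_def)

lemma C1_fun_continuous: assumes "C1_fun X f" shows "continuous_map (mtop X) euclideanreal f"
  unfolding continuous_map_def
proof (intro conjI allI impI)
  fix V :: "real set" assume V: "openin euclideanreal V"
  show "openin (mtop X) {x \<in> topspace (mtop X). f x \<in> V}"
    unfolding openin_iff topspace_mtop
  proof (intro conjI ballI)
    fix c assume c: "c \<in> X"
    have "snd c ` ({x \<in> points X. f x \<in> V} \<inter> fst c) = chart_image c \<inter> (f \<circ> chart_inv c) -` V"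
      using chart_inv_image[of _ c] chart_inv_eq[OF c] c by (force simp: chart_image_def points_def)
    moreover have "continuous_on (chart_image c) (f \<circ> chart_inv c)"
      using assms c by (intro Ck1_continuous_on) (simp add: C1_fun_def)
    ultimately show "open (snd c ` ({x \<in> points X. f x \<in> V} \<inter> fst c))"
      using continuous_open_preimage[OF _ open_image[OF c], of "f \<circ> chart_inv c" V] V by (simp only: open_openin)
  qed auto
qed auto

section \<open>Compactly supported functions\<close>

lemma C1c_bounded:
  assumes "f \<in> C1c X" obtains B where "\<And>x. x \<in> points X \<Longrightarrow> \<bar>f x\<bar> \<le> B"
proof -
  let ?S = "mtop X closure_of {x \<in> points X. f x \<noteq> 0}"
  have "compactin (mtop X) ?S" using assms by (simp add: C1c_def)
  then have "compactin euclideanreal (f ` ?S)"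
    by (rule image_compactin[OF _ C1_fun_continuous[OF C1c_imp_C1_fun[OF assms]]])
  then have "bounded (f ` ?S)" by (simp add: compact_imp_bounded)
  then obtain B where B: "\<And>x. x \<in> ?S \<Longrightarrow> \<bar>f x\<bar> \<le> B"
    by (meson bounded_real imageI)
  have "{x \<in> points X. f x \<noteq> 0} \<subseteq> ?S"
    by (rule closure_of_subset) (auto simp: topspace_mtop)
  then have "\<bar>f x\<bar> \<le> max B 0" if "x \<in> points X" for x
    using B[of x] that by (cases "f x = 0") auto
  then show thesis by (rule that)
qed

text \<open>In a Hausdorff space the compact set \<open>K\<close> is closed, so the closure of the
  set where \<open>f\<close> is nonzero stays inside it.\<close>

lemma C1cI:
  assumes "C1_fun X f" and K: "compactin (mtop X) K" and "\<And>x. x \<in> points X \<Longrightarrow> x \<notin> K \<Longrightarrow> f x = 0"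
  shows "f \<in> C1c X"
proof -
  have "closedin (mtop X) K" by (rule compactin_imp_closedin[OF Hausdorff K])
  then have "mtop X closure_of {x \<in> points X. f x \<noteq> 0} \<subseteq> K"
    by (intro closure_of_minimal) (use assms in auto)
  then have "compactin (mtop X) (mtop X closure_of {x \<in> points X. f x \<noteq> 0})"
    by (rule closed_compactin[OF K]) simp
  then show ?thesis using assms(1) by (simp add: C1c_def C1_fun_def)
qed

lemma C1c_mult:
  assumes f: "f \<in> C1c X" and g: "C1_fun X g" shows "(\<lambda>x. f x * g x) \<in> C1c X"
proof (rule C1cI[OF C1_fun_mult[OF C1c_imp_C1_fun[OF f] g]])
  show "compactin (mtop X) (mtop X closure_of {x \<in> points X. f x \<noteq> 0})"
    using f by (simp add: C1c_def)
  have "{x \<in> points X. f x \<noteq> 0} \<subseteq> mtop X closure_of {x \<in> points X. f x \<noteq> 0}"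
    by (rule closure_of_subset) (auto simp: topspace_mtop)
  then show "f x * g x = 0" if "x \<in> points X" "x \<notin> mtop X closure_of {x \<in> points X. f x \<noteq> 0}" for x
    using that by auto
qed

text \<open>Seen in another chart \<open>d\<close>, the domain is covered by two open sets: the
  overlap with \<open>c\<close>, where the function is \<open>\<phi>\<close> composed with a chart
  change, and the complement of the compact \<open>?K\<close>, where it is 0. The second is open
  because the space is Hausdorff.\<close>

lemma lift_C1c:
  assumes c: "c \<in> X" and \<phi>: "Ck 1 UNIV \<phi>" and C: "compact C" "C \<subseteq> chart_image c" "\<And>z. z \<notin> C \<Longrightarrow> \<phi> z = 0"
  shows "lift c \<phi> \<in> C1c X"
proof (rule C1cI)
  let ?K = "chart_inv c ` C"
  show K: "compactin (mtop X) ?K" by (rule compactin_chart_inv_image[OF c C(1,2)])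
  have closed: "closedin (mtop X) ?K" by (rule compactin_imp_closedin[OF Hausdorff K])
  show outside: "lift c \<phi> x = 0" if "x \<notin> ?K" for x
  proof (cases "x \<in> fst c")
    case True
    then have "snd c x \<notin> C" using that chart_inv_eq[OF c True] by (metis imageI)
    then show ?thesis using C(3) by (simp add: lift_def)
  qed (simp add: lift_def)
  show "C1_fun X (lift c \<phi>)"
    unfolding C1_fun_def
  proof
    fix d assume d: "d \<in> X"
    let ?A = "snd d ` (fst d \<inter> fst c)" and ?B = "snd d ` ((points X - ?K) \<inter> fst d)"
    have oB: "open ?B"
      using closed d by (intro open_chart_image) (auto simp: closedin_def topspace_mtop)
    have "Ck 1 ?A (\<phi> \<circ> (snd c \<circ> chart_inv d))"
      by (rule Ck1_compose[OF transition[OF d c] \<phi>]) simp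
    then have A: "Ck 1 ?A (lift c \<phi> \<circ> chart_inv d)"
      by (rule Ck1_cong_open[OF open_overlap[OF d c], rotated]) (auto simp: lift_def chart_inv_eq[OF d])
    have B: "Ck 1 ?B (lift c \<phi> \<circ> chart_inv d)"
      by (rule Ck1_cong_open[OF oB _ Ck1_const[of _ 0]]) (auto simp: chart_inv_eq[OF d] outside)
    have "?K \<subseteq> fst c" using chart_inv_image(1)[of _ c] C(2) by auto
    then have "fst d = (fst d \<inter> fst c) \<union> ((points X - ?K) \<inter> fst d)"
      using d by (auto simp: points_def)
    then have "chart_image d = ?A \<union> ?B" unfolding chart_image_def by (metis image_Un)
    then show "Ck 1 (chart_image d) (lift c \<phi> \<circ> chart_inv d)"
      using Ck1_Un_open[OF open_overlap[OF d c] oB A B] by simp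
  qed
qed

lemma dreal_lift:
  assumes c: "c \<in> X" and x: "x \<in> fst c" and v: "v \<in> tangent_space X x"
    and f: "lift c \<phi> \<in> C1c X" and D: "(\<phi> has_derivative D) (at (snd c x))"
  shows "dreal X (lift c \<phi>) (x, v) = D (v c)"
proof -
  have "snd c x \<in> chart_image c" using x by (auto simp: chart_image_def)
  with D have "((lift c \<phi> \<circ> chart_inv c) has_derivative D) (at (snd c x))"
    by (elim has_derivative_transform_within_open[OF _ open_image[OF c]])
      (auto simp: lift_def chart_inv_image)
  from fun_cong[OF frechet_derivative_at[OF this], of "v c"] dreal_chart[OF C1c_imp_C1_fun[OF f] c x v]
  show ?thesis by simp
qed

text \<open>Multiplying a bump by a coordinate makes that coordinate compactly supported; the factor can be
  divided out again wherever the bump is positive.\<close>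

definition coord_fun :: "('p, 'a) chart \<Rightarrow> 'a \<Rightarrow> real \<Rightarrow> 'a \<Rightarrow> 'p \<Rightarrow> real" where
  "coord_fun c q r b = lift c (\<lambda>z. bump q r z * (z \<bullet> b))"

definition bump_fun :: "('p, 'a) chart \<Rightarrow> 'a \<Rightarrow> real \<Rightarrow> 'p \<Rightarrow> real" where
  "bump_fun c q r = lift c (bump q r)"

definition nice_ball :: "('p, 'a) chart \<Rightarrow> 'a \<Rightarrow> real \<Rightarrow> bool" where
  "nice_ball c q r \<longleftrightarrow> c \<in> X \<and> r > 0 \<and> cball q r \<subseteq> chart_image c"

lemma nice_ball_lift_C1c:
  assumes "nice_ball c q r" "Ck 1 UNIV \<psi>"
  shows "lift c (\<lambda>z. bump q r z * \<psi> z) \<in> C1c X"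
proof (rule lift_C1c)
  show "Ck 1 UNIV (\<lambda>z. bump q r z * \<psi> z)" by (rule Ck1_mult[OF Ck1_bump assms(2)])
  show "compact (cball q r)" by simp
  show "bump q r z * \<psi> z = 0" if "z \<notin> cball q r" for z
    using bump_eq_0[of z q r] that assms(1) by (auto simp: nice_ball_def)
qed (use assms(1) in \<open>auto simp: nice_ball_def\<close>)

lemma bump_fun_C1c: "nice_ball c q r \<Longrightarrow> bump_fun c q r \<in> C1c X"
  using nice_ball_lift_C1c[OF _ Ck1_const[of _ 1]] by (simp add: bump_fun_def)

lemma coord_fun_C1c: "nice_ball c q r \<Longrightarrow> coord_fun c q r b \<in> C1c X"
  unfolding coord_fun_def
  by (rule nice_ball_lift_C1c[OF _ Ck1_bounded_linear[OF bounded_linear_inner_left]])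

text \<open>The differential of bump times coordinate is the bump times the coordinate of
  \<open>v\<close> plus the coordinate of the point times the differential of the bump; this is
  solved for the coordinate of \<open>v\<close>. The formula serves twice: it separates tangent
  vectors, and it expresses coordinates of a derivative by weak derivatives of test
  functions.\<close>

lemma coordinate_of_dreal:
  assumes n: "nice_ball c q r" and x: "x \<in> fst c" "snd c x \<in> ball q r" and v: "v \<in> tangent_space X x"
  shows "v c \<bullet> b = (dreal X (coord_fun c q r b) (x, v) - (snd c x \<bullet> b) * dreal X (bump_fun c q r) (x, v)) / bump q r (snd c x)"
proof -
  let ?z = "snd c x"
  have c: "c \<in> X" using n by (simp add: nice_ball_def)
  have D: "(bump q r has_derivative frechet_derivative (bump q r) (at ?z)) (at ?z)"
    by (rule Ck1_has_derivative[OF Ck1_bump, of _ UNIV]) simp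
  have "((\<lambda>z. bump q r z * (z \<bullet> b)) has_derivative
      (\<lambda>w. bump q r ?z * (w \<bullet> b) + frechet_derivative (bump q r) (at ?z) w * (?z \<bullet> b))) (at ?z)"
    by (rule has_derivative_mult[OF D]) (auto intro!: derivative_eq_intros)
  from dreal_lift[OF c x(1) v coord_fun_C1c[OF n, unfolded coord_fun_def] this]
    dreal_lift[OF c x(1) v bump_fun_C1c[OF n, unfolded bump_fun_def] D]
  have "dreal X (coord_fun c q r b) (x, v) - (?z \<bullet> b) * dreal X (bump_fun c q r) (x, v) = bump q r ?z * (v c \<bullet> b)"
    by (simp add: coord_fun_def bump_fun_def)
  then show ?thesis using bump_pos[OF x(2)] by simp
qed

text \<open>Countability is what matters: an identity that holds a.e. for each ball then holds off a
  single null set for all of them.\<close>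

lemma countable_nice_balls:
  obtains I where "countable I" "\<And>c q r. (c, q, r) \<in> I \<Longrightarrow> nice_ball c q r"
    "\<And>c x. c \<in> X \<Longrightarrow> x \<in> fst c \<Longrightarrow> \<exists>d q r. (d, q, r) \<in> I \<and> x \<in> fst d \<and> snd d x \<in> ball q r"
proof -
  obtain X0 where X0: "X0 \<subseteq> X" "countable X0" "points X0 = points X" using countable_subatlas by blast
  obtain D :: "'a set" where D: "countable D" "\<And>S. open S \<Longrightarrow> S \<noteq> {} \<Longrightarrow> \<exists>d\<in>D. d \<in> S"
    using countable_dense_exists by metis
  let ?I = "{(c, q, r) \<in> X0 \<times> D \<times> \<rat>. nice_ball c q r}"
  have "countable (X0 \<times> D \<times> (\<rat> :: real set))" using X0 D countable_rat by (intro countable_SIGMA) auto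
  then have "countable ?I" by (rule countable_subset[rotated]) auto
  moreover have "\<exists>d q r. (d, q, r) \<in> ?I \<and> x \<in> fst d \<and> snd d x \<in> ball q r" if "c \<in> X" "x \<in> fst c" for c x
  proof -
    have "x \<in> points X0" using that X0 by (auto simp: points_def)
    then obtain d where d: "d \<in> X0" "x \<in> fst d" by (auto simp: points_def)
    then have "d \<in> X" using X0 by auto
    have "snd d x \<in> chart_image d" using d by (auto simp: chart_image_def)
    then obtain e where e: "e > 0" "cball (snd d x) e \<subseteq> chart_image d"
      using open_contains_cball_eq[OF open_image[OF \<open>d \<in> X\<close>]] by blast
    \<comment> \<open>With \<open>q\<close> within \<open>r\<close> of the point, the ball around
      \<open>q\<close> reaches at most \<open>2 * r\<close> from it, so \<open>r < e / 2\<close>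
      keeps it inside the chart image.\<close>
    obtain r where r: "r \<in> \<rat>" "0 < r" "r < e / 2" using Rats_dense_in_real[of 0 "e/2"] e by auto
    obtain q where q: "q \<in> D" "q \<in> ball (snd d x) r" using D(2)[of "ball (snd d x) r"] r by auto
    have "cball q r \<subseteq> cball (snd d x) e"
    proof
      fix y assume "y \<in> cball q r"
      then have "dist (snd d x) y \<le> r + r"
        using q(2) dist_triangle[of "snd d x" y q] by (simp add: dist_commute)
      then show "y \<in> cball (snd d x) e" using r by simp
    qed
    then have "nice_ball d q r" using e r \<open>d \<in> X\<close> by (auto simp: nice_ball_def)
    then show ?thesis
      using d q r by (intro exI[of _ d] exI[of _ q] exI[of _ r]) (simp add: dist_commute)
  qed
  ultimately show thesis by (intro that[of ?I]) auto
qed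

text \<open>By \<open>coordinate_of_dreal\<close>, the bump and the coordinate functions of a single
  ball around the point already determine all coordinates in that chart.\<close>

lemma countable_separating_C1c:
  "\<exists>F. countable F \<and> F \<subseteq> C1c X \<and>
    (\<forall>x\<in>points X. \<forall>v\<in>tangent_space X x. \<forall>w\<in>tangent_space X x.
      (\<forall>f\<in>F. dreal X f (x, v) = dreal X f (x, w)) \<longrightarrow> v = w)"
proof -
  obtain I where I: "countable I" "\<And>c q r. (c, q, r) \<in> I \<Longrightarrow> nice_ball c q r"
    "\<And>c x. c \<in> X \<Longrightarrow> x \<in> fst c \<Longrightarrow> \<exists>d q r. (d, q, r) \<in> I \<and> x \<in> fst d \<and> snd d x \<in> ball q r"
    by (rule countable_nice_balls, rule that)
  let ?F = "(\<Union>(c, q, r)\<in>I. insert (bump_fun c q r) (coord_fun c q r ` Basis))"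
  have sep: "v = w" if x: "x \<in> points X" and v: "v \<in> tangent_space X x" and w: "w \<in> tangent_space X x"
    and eq: "\<And>f. f \<in> ?F \<Longrightarrow> dreal X f (x, v) = dreal X f (x, w)" for x v w
  proof -
    have "chart_at X x \<in> X" "x \<in> fst (chart_at X x)" using chart_at_mem[OF x] by auto
    from I(3)[OF this] obtain d q r where d: "(d, q, r) \<in> I" "x \<in> fst d" "snd d x \<in> ball q r" by blast
    then have n: "nice_ball d q r" using I(2) by blast
    have "v d \<bullet> b = w d \<bullet> b" if b: "b \<in> Basis" for b
    proof -
      have "coord_fun d q r b \<in> ?F" "bump_fun d q r \<in> ?F"
        by (rule UN_I[OF d(1)], simp add: b)+
      from this[THEN eq] show ?thesis
        unfolding coordinate_of_dreal[OF n d(2,3) v] coordinate_of_dreal[OF n d(2,3) w] by simp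
    qed
    then have "v d = w d" by (rule euclidean_eqI)
    moreover have "d \<in> X" using n by (simp add: nice_ball_def)
    ultimately show ?thesis using tangent_ext[OF v w _ d(2)] by blast
  qed
  have count: "countable ?F"
    using I(1) by (rule countable_UN) (auto intro!: countable_insert countable_image countable_finite)
  have sub: "?F \<subseteq> C1c X" using bump_fun_C1c[OF I(2)] coord_fun_C1c[OF I(2)] by auto
  show ?thesis by (intro exI[of _ ?F] conjI count sub ballI impI) (rule sep, assumption+, erule bspec)
qed

end

text \<open>Chart domains are open, so each point has a basic open set inside some chart domain.
  Choosing one chart for every basic set that fits into a chart yields countably many charts that
  still cover.\<close>

lemma manifold_C1:
  assumes "manifold 2 X" shows "C1_manifold X"
proof unfold_locales
  fix c d assume c: "c \<in> X" and d: "d \<in> X"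
  show "inj_on (snd c) (fst c)" "open (chart_image c)" using assms c by (auto simp: manifold_def)
  show "open (snd c ` (fst c \<inter> fst d))" using assms c d by (auto simp: manifold_def)
  show "Ck 1 (snd c ` (fst c \<inter> fst d)) (snd d \<circ> chart_inv c)"
    by (rule Ck2_imp_Ck1) (use assms c d in \<open>auto simp: manifold_def\<close>)
next
  show "Hausdorff_space (mtop X)" using assms by (simp add: manifold_def)
  obtain \<B> where B: "countable \<B>" "\<And>W x. openin (mtop X) W \<Longrightarrow> x \<in> W \<Longrightarrow> \<exists>V\<in>\<B>. x \<in> V \<and> V \<subseteq> W"
    using assms by (auto simp: manifold_def has_countable_basis_def)
  let ?P = "\<lambda>V c. c \<in> X \<and> V \<subseteq> fst c"
  let ?X0 = "(\<lambda>V. SOME c. ?P V c) ` {V \<in> \<B>. \<exists>c. ?P V c}"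
  have some: "?P V (SOME c. ?P V c)" if "\<exists>c. ?P V c" for V using someI_ex[OF that] .
  have "x \<in> points ?X0" if "x \<in> points X" for x
  proof -
    obtain c where c: "c \<in> X" "x \<in> fst c" using \<open>x \<in> points X\<close> by (auto simp: points_def)
    have inj: "\<And>c. c \<in> X \<Longrightarrow> inj_on (snd c) (fst c)" using assms by (auto simp: manifold_def)
    have "open (snd d ` (fst c \<inter> fst d))" if "d \<in> X" for d
      using assms c that by (metis Int_commute manifold_def)
    then have "openin (mtop X) (fst c)" using c by (auto simp: openin_mtop[OF inj] points_def)
    then obtain V where V: "V \<in> \<B>" "x \<in> V" "V \<subseteq> fst c" using B(2) c by blast
    have ex: "\<exists>c. ?P V c" using c(1) V(3) by (intro exI[of _ c]) simp
    have "(SOME c. ?P V c) \<in> ?X0" using V(1) ex by (intro imageI) simp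
    moreover have "x \<in> fst (SOME c. ?P V c)" using some[OF ex] V(2) by auto
    ultimately show ?thesis unfolding points_def by blast
  qed
  moreover have sub: "?X0 \<subseteq> X"
  proof
    fix c assume "c \<in> ?X0"
    then obtain V where "c = (SOME c. ?P V c)" "\<exists>c. ?P V c" by blast
    then show "c \<in> X" using some by simp
  qed
  moreover have "points ?X0 \<subseteq> points X" unfolding points_def by (rule UN_mono[OF sub]) simp
  moreover have "countable ?X0" using B(1) by simp
  ultimately show "\<exists>X0\<subseteq>X. countable X0 \<and> points X0 = points X"
    by (intro exI[of _ ?X0]) blast
qed

section \<open>Measurability and null sets on manifolds\<close>

lemma ae_on_mono:
  assumes "ae_on M P" "\<And>x. x \<in> points M \<Longrightarrow> P x \<Longrightarrow> Q x" shows "ae_on M Q"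
  unfolding ae_on_def
proof
  fix c assume c: "c \<in> M"
  then have "fst c \<subseteq> points M" unfolding points_def by blast
  then have "snd c ` {x \<in> fst c. \<not> Q x} \<subseteq> snd c ` {x \<in> fst c. \<not> P x}"
    using assms(2) by (intro image_mono) auto
  moreover have "negligible (snd c ` {x \<in> fst c. \<not> P x})" using assms(1) c by (simp add: ae_on_def)
  ultimately show "negligible (snd c ` {x \<in> fst c. \<not> Q x})" by (rule negligible_subset[rotated])
qed

lemma ae_onI: "(\<And>x. x \<in> points M \<Longrightarrow> P x) \<Longrightarrow> ae_on M P"
  by (rule ae_on_mono[of M "\<lambda>_. True"]) (auto simp: ae_on_def)

lemma ae_on_ball_countable:
  assumes "countable I" "\<And>i. i \<in> I \<Longrightarrow> ae_on M (P i)" shows "ae_on M (\<lambda>x. \<forall>i\<in>I. P i x)"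
  unfolding ae_on_def
proof
  fix c assume c: "c \<in> M"
  have "snd c ` {x \<in> fst c. \<not> (\<forall>i\<in>I. P i x)} = \<Union>((\<lambda>i. snd c ` {x \<in> fst c. \<not> P i x}) ` I)" by auto
  moreover have "negligible (\<Union>((\<lambda>i. snd c ` {x \<in> fst c. \<not> P i x}) ` I))"
    using assms c by (intro negligible_countable_Union) (auto simp: ae_on_def)
  ultimately show "negligible (snd c ` {x \<in> fst c. \<not> (\<forall>i\<in>I. P i x)})" by simp
qed

lemma ae_on_conj: "ae_on M P \<Longrightarrow> ae_on M Q \<Longrightarrow> ae_on M (\<lambda>x. P x \<and> Q x)"
proof -
  assume "ae_on M P" "ae_on M Q"
  then have "ae_on M (\<lambda>x. \<forall>b\<in>UNIV. (if b then P else Q) x)"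
    by (intro ae_on_ball_countable) auto
  then show ?thesis
  proof (rule ae_on_mono)
    fix x assume *: "\<forall>b\<in>UNIV. (if b then P else Q) x"
    show "P x \<and> Q x" using *[THEN bspec, of True] *[THEN bspec, of False] by simp
  qed
qed

lemma (in C1_manifold) ae_on_iff:
  "ae_on X P \<longleftrightarrow> (\<forall>c\<in>X. negligible {z \<in> chart_image c. \<not> P (chart_inv c z)})"
proof -
  have "snd c ` {x \<in> fst c. \<not> P x} = {z \<in> chart_image c. \<not> P (chart_inv c z)}" if "c \<in> X" for c
    using chart_inv_eq[OF that] by (auto simp: chart_image_def)
  then show ?thesis by (simp add: ae_on_def)
qed

definition meas_on :: "'a::euclidean_space set \<Rightarrow> ('q, 'b::euclidean_space) atlas \<Rightarrow> ('a \<Rightarrow> 'q) \<Rightarrow> bool" where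
  "meas_on S Y F \<longleftrightarrow> F \<in> S \<rightarrow> points Y \<and> (\<forall>W. openin (mtop Y) W \<longrightarrow> {z \<in> S. F z \<in> W} \<in> sets lebesgue)"

lemma measurable_map_iff:
  assumes "\<And>c. c \<in> M \<Longrightarrow> inj_on (snd c) (fst c)"
  shows "measurable_map M Y u \<longleftrightarrow> (\<forall>c\<in>M. meas_on (chart_image c) Y (u \<circ> chart_inv c))"
proof -
  have eq: "snd c ` ({x \<in> points M. u x \<in> W} \<inter> fst c) = {z \<in> chart_image c. (u \<circ> chart_inv c) z \<in> W}" if c: "c \<in> M" for c W
  proof -
    have "chart_inv c (snd c x) = x" if "x \<in> fst c" for x
      unfolding chart_inv_def by (rule inv_into_f_f[OF assms[OF c] that])
    then show ?thesis using c by (auto simp: chart_image_def points_def)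
  qed
  have "u \<circ> chart_inv c \<in> chart_image c \<rightarrow> points Y \<longleftrightarrow> u \<in> fst c \<rightarrow> points Y" if c: "c \<in> M" for c
  proof -
    have "chart_inv c (snd c x) = x" if "x \<in> fst c" for x
      unfolding chart_inv_def by (rule inv_into_f_f[OF assms[OF c] that])
    then show ?thesis by (auto simp: chart_image_def Pi_iff)
  qed
  then have "u \<in> points M \<rightarrow> points Y \<longleftrightarrow> (\<forall>c\<in>M. u \<circ> chart_inv c \<in> chart_image c \<rightarrow> points Y)"
    unfolding points_def[of M] by blast
  then show ?thesis by (auto simp: measurable_map_def measurable_set_def meas_on_def eq)
qed

lemma lebesgue_sets_cong_ae:
  assumes A: "A \<in> sets lebesgue" and N: "negligible N" and "A - N = B - N"
  shows "B \<in> sets lebesgue"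
proof -
  have "B = (A - N) \<union> (B \<inter> N)" using assms(3) by auto
  moreover have "negligible (B \<inter> N)" using N negligible_subset by blast
  ultimately show ?thesis using A negligible_imp_sets[OF N] negligible_imp_sets
    by (metis sets.Diff sets.Un)
qed

lemma meas_on_cong_ae:
  assumes F: "meas_on S Y F" and G: "G \<in> S \<rightarrow> points Y" and N: "negligible {z \<in> S. F z \<noteq> G z}"
  shows "meas_on S Y G"
  unfolding meas_on_def
proof (intro conjI allI impI G)
  fix W assume "openin (mtop Y) W"
  then have "{z \<in> S. F z \<in> W} \<in> sets lebesgue" using F by (simp add: meas_on_def)
  then show "{z \<in> S. G z \<in> W} \<in> sets lebesgue"
    by (rule lebesgue_sets_cong_ae[OF _ N]) auto
qed

text \<open>On a piece \<open>T j\<close> mapped into a single chart, injectivity turns the preimage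
  of an open set \<open>W\<close> into the preimage of an open set of coordinates. Countably many
  pieces are then put together, which reduces measurability into a manifold to that of
  coordinates.\<close>

lemma meas_onI_charts:
  assumes F: "F \<in> S \<rightarrow> points Y" and inj: "\<And>c. c \<in> Y \<Longrightarrow> inj_on (snd c) (fst c)"
    and J: "countable J" and ch: "\<And>j. j \<in> J \<Longrightarrow> ch j \<in> Y" and T: "\<And>j. j \<in> J \<Longrightarrow> T j \<in> sets lebesgue"
    and S: "S = (\<Union>j\<in>J. T j)" and dom: "\<And>j z. j \<in> J \<Longrightarrow> z \<in> T j \<Longrightarrow> F z \<in> fst (ch j)"
    and meas: "\<And>j. j \<in> J \<Longrightarrow> (\<lambda>z. snd (ch j) (F z)) \<in> borel_measurable (lebesgue_on (T j))"
  shows "meas_on S Y F"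
  unfolding meas_on_def
proof (intro conjI allI impI F)
  fix W assume W: "openin (mtop Y) W"
  have sets: "{z \<in> T j. F z \<in> W} \<in> sets lebesgue" if j: "j \<in> J" for j
  proof -
    let ?O = "snd (ch j) ` (W \<inter> fst (ch j))"
    have "open ?O" using W openin_mtop[OF inj] ch[OF j] by blast
    then have "{z \<in> T j. snd (ch j) (F z) \<in> ?O} \<in> sets (lebesgue_on (T j))"
      using measurable_sets[OF meas[OF j], of ?O] by (simp add: vimage_def Int_def conj_commute)
    moreover have "{z \<in> T j. snd (ch j) (F z) \<in> ?O} = {z \<in> T j. F z \<in> W}"
      using dom[OF j] inj_onD[OF inj[OF ch[OF j]]] by auto
    ultimately show ?thesis using T[OF j] by (simp add: sets_restrict_space_iff)
  qed
  have "{z \<in> S. F z \<in> W} = (\<Union>j\<in>J. {z \<in> T j. F z \<in> W})" using S by auto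
  then show "{z \<in> S. F z \<in> W} \<in> sets lebesgue" using sets J by (auto intro: sets.countable_UN')
qed

lemma meas_on_compose:
  assumes F: "meas_on S Y F" and K: "continuous_map (mtop Y) (mtop Y') K"
    and top: "topspace (mtop Y) = points Y" "topspace (mtop Y') = points Y'"
  shows "meas_on S Y' (\<lambda>z. K (F z))"
  unfolding meas_on_def
proof (intro conjI allI impI)
  show "(\<lambda>z. K (F z)) \<in> S \<rightarrow> points Y'"
    using F K top by (auto simp: meas_on_def continuous_map_def)
  fix W assume "openin (mtop Y') W"
  then have "openin (mtop Y) {x \<in> topspace (mtop Y). K x \<in> W}" using K by (simp add: continuous_map_def)
  then have "{z \<in> S. F z \<in> {x \<in> topspace (mtop Y). K x \<in> W}} \<in> sets lebesgue" using F by (auto simp: meas_on_def)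
  moreover have "{z \<in> S. F z \<in> {x \<in> topspace (mtop Y). K x \<in> W}} = {z \<in> S. K (F z) \<in> W}"
    using F top by (auto simp: meas_on_def)
  ultimately show "{z \<in> S. K (F z) \<in> W} \<in> sets lebesgue" by simp
qed

lemma (in C1_manifold) meas_on_chart:
  assumes F: "meas_on S X F" and d: "d \<in> X" and O: "open O'"
  shows "{z \<in> S. F z \<in> fst d \<and> snd d (F z) \<in> O'} \<in> sets lebesgue" (is "?S \<in> _")
    and "(\<lambda>z. snd d (F z)) \<in> borel_measurable (lebesgue_on {z \<in> S. F z \<in> fst d \<and> snd d (F z) \<in> O'})"
proof -
  have *: "{z \<in> S. F z \<in> fst d \<and> snd d (F z) \<in> V} \<in> sets lebesgue" if "open V" for V
    using F openin_chart_vimage[OF d that] unfolding meas_on_def by force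
  show S: "?S \<in> sets lebesgue" by (rule *[OF O])
  show "(\<lambda>z. snd d (F z)) \<in> borel_measurable (lebesgue_on ?S)"
  proof (rule borel_measurableI)
    fix V :: "'a set" assume "open V"
    have "(\<lambda>z. snd d (F z)) -` V \<inter> space (lebesgue_on ?S) = {z \<in> S. F z \<in> fst d \<and> snd d (F z) \<in> V \<inter> O'}" by auto
    then show "(\<lambda>z. snd d (F z)) -` V \<inter> space (lebesgue_on ?S) \<in> sets (lebesgue_on ?S)"
      using *[of "V \<inter> O'"] \<open>open V\<close> O S by (auto simp: sets_restrict_space_iff)
  qed
qed

lemma borel_measurable_lebesgue_on_cong_ae:
  fixes f g :: "'a::euclidean_space \<Rightarrow> 'b::euclidean_space"
  assumes S: "S \<in> sets lebesgue" and f: "f \<in> borel_measurable (lebesgue_on S)" and N: "negligible {z \<in> S. f z \<noteq> g z}"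
  shows "g \<in> borel_measurable (lebesgue_on S)"
proof (rule borel_measurableI)
  fix V :: "'b set" assume "open V"
  then have "{z \<in> S. f z \<in> V} \<in> sets lebesgue"
    using measurable_sets[OF f, of V] S by (simp add: sets_restrict_space_iff vimage_def Int_def conj_commute)
  then have "{z \<in> S. g z \<in> V} \<in> sets lebesgue"
    by (rule lebesgue_sets_cong_ae[OF _ N]) auto
  then show "g -` V \<inter> space (lebesgue_on S) \<in> sets (lebesgue_on S)"
    using S by (simp add: sets_restrict_space_iff vimage_def Int_def conj_commute)
qed

text \<open>Statements that hold for a.e. base point must still hold a.e. on the tangent bundle,
  where the fibre contributes all directions. The null set is first enlarged to a Borel one so that
  the product formula for \<open>lborel\<close> applies.\<close>

lemma negligible_Times_UNIV:
  fixes N :: "'a::euclidean_space set"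
  assumes "negligible N" shows "negligible (N \<times> (UNIV :: 'b::euclidean_space set))"
proof -
  obtain N' where N': "N' \<in> null_sets lborel" "N \<subseteq> N'"
    using assms by (auto simp: negligible_iff_null_sets null_sets_completion_iff2)
  have "emeasure (lborel \<Otimes>\<^sub>M lborel) (N' \<times> (UNIV :: 'b set)) = emeasure lborel N' * emeasure lborel (UNIV :: 'b set)"
    using N' by (intro lborel.emeasure_pair_measure_Times) auto
  also have "\<dots> = 0" using N' by (auto simp: null_sets_def)
  finally have "N' \<times> (UNIV :: 'b set) \<in> null_sets (lborel \<Otimes>\<^sub>M lborel)"
    using N' by (intro null_setsI pair_measureI) auto
  then have "N' \<times> (UNIV :: 'b set) \<in> null_sets lborel" by (simp add: lborel_prod)
  then have "negligible (N' \<times> (UNIV :: 'b set))"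
    by (auto simp: negligible_iff_null_sets intro: null_sets_completionI)
  then show ?thesis by (rule negligible_subset) (use N' in auto)
qed

lemma lebesgue_sets_Times_UNIV:
  fixes S :: "'a::euclidean_space set"
  assumes "S \<in> sets lebesgue" shows "S \<times> (UNIV :: 'b::euclidean_space set) \<in> sets lebesgue"
proof -
  obtain B N N' where *: "S = B \<union> N" "N \<subseteq> N'" "N' \<in> null_sets lborel" "B \<in> sets lborel"
    using assms by (auto simp: sets_completion)
  have "negligible N'" using * by (auto simp: negligible_iff_null_sets intro: null_sets_completionI)
  then have "negligible (N \<times> (UNIV :: 'b set))"
    using negligible_subset[OF _ \<open>N \<subseteq> N'\<close>] negligible_Times_UNIV by blast
  moreover have "B \<times> (UNIV :: 'b set) \<in> sets (borel \<Otimes>\<^sub>M borel)" using * by (intro pair_measureI) auto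
  then have "B \<times> (UNIV :: 'b set) \<in> sets lebesgue" by (simp only: borel_prod) simp
  ultimately have "B \<times> (UNIV :: 'b set) \<union> N \<times> (UNIV :: 'b set) \<in> sets lebesgue"
    using negligible_imp_sets by blast
  then show ?thesis using *(1) by (simp add: Sigma_Un_distrib1)
qed

lemma borel_measurable_fst_lebesgue_on:
  fixes f :: "'a::euclidean_space \<Rightarrow> 'c::euclidean_space"
  assumes S: "S \<in> sets lebesgue" and f: "f \<in> borel_measurable (lebesgue_on S)"
  shows "(\<lambda>p. f (fst p)) \<in> borel_measurable (lebesgue_on (S \<times> (UNIV :: 'b::euclidean_space set)))"
proof (rule borel_measurableI)
  fix V :: "'c set" assume "open V"
  then have "{z \<in> S. f z \<in> V} \<in> sets lebesgue"
    using measurable_sets[OF f, of V] S by (simp add: sets_restrict_space_iff vimage_def Int_def conj_commute)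
  from lebesgue_sets_Times_UNIV[OF this]
  have "{z \<in> S. f z \<in> V} \<times> (UNIV :: 'b set) \<in> sets lebesgue" .
  moreover have "(\<lambda>p. f (fst p)) -` V \<inter> (S \<times> (UNIV :: 'b set)) = {z \<in> S. f z \<in> V} \<times> (UNIV :: 'b set)" by auto
  ultimately show "(\<lambda>p. f (fst p)) -` V \<inter> space (lebesgue_on (S \<times> (UNIV :: 'b set))) \<in> sets (lebesgue_on (S \<times> (UNIV :: 'b set)))"
    using lebesgue_sets_Times_UNIV[OF S, where 'b = 'b]
    by (simp add: sets_restrict_space_iff) blast
qed

definition tangent_linear :: "('p, 'a::euclidean_space) atlas \<Rightarrow> 'p \<Rightarrow> (('p, 'a) tvec \<Rightarrow> real) \<Rightarrow> bool" where
  "tangent_linear X x \<phi> \<longleftrightarrow>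
    (\<forall>v\<in>tangent_space X x. \<forall>w\<in>tangent_space X x. \<phi> (tvec_add v w) = \<phi> v + \<phi> w) \<and>
    (\<forall>r. \<forall>v\<in>tangent_space X x. \<phi> (tvec_scale r v) = r * \<phi> v)"

lemma (in C1_manifold) tangent_linear_expand:
  assumes \<phi>: "tangent_linear X x \<phi>" and c: "c \<in> X" "x \<in> fst c" and v: "v \<in> tangent_space X x"
  shows "\<phi> v = (\<Sum>i\<in>Basis. (v c \<bullet> i) * \<phi> (tvec_of X c x i))"
proof -
  have "linear (\<lambda>w. \<phi> (tvec_of X c x w))"
    using \<phi> tvec_of_in[OF c] unfolding tangent_linear_def
    by (intro linearI) (auto simp: tvec_of_add[OF c] tvec_of_scale[OF c])
  from linear_expand_Basis[OF this, of "v c"] show ?thesis by (simp add: tvec_of_eq[OF v c])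
qed

section \<open>Colocal weak derivatives\<close>

definition tvec_linear ::
  "('p, 'a::euclidean_space) atlas \<Rightarrow> 'p \<Rightarrow> (('p, 'a) tvec \<Rightarrow> ('q, 'b::euclidean_space) tvec) \<Rightarrow> bool" where
  "tvec_linear M x L \<longleftrightarrow>
    (\<forall>v\<in>tangent_space M x. \<forall>w\<in>tangent_space M x. L (tvec_add v w) = tvec_add (L v) (L w)) \<and>
    (\<forall>r. \<forall>v\<in>tangent_space M x. L (tvec_scale r v) = tvec_scale r (L v))"

lemma (in C1_manifold) inj_on_tangent_chart: "d \<in> tangent_atlas X \<Longrightarrow> inj_on (snd d) (fst d)"
  unfolding tangent_atlas_def
proof (elim imageE, simp, rule inj_onI)
  fix d p p' assume d: "d \<in> X" and p: "p \<in> fst (tangent_chart X d)" "p' \<in> fst (tangent_chart X d)"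
    and eq: "snd (tangent_chart X d) p = snd (tangent_chart X d) p'"
  obtain x v x' v' where [simp]: "p = (x, v)" "p' = (x', v')" by (cases p, cases p')
  have *: "x \<in> fst d" "v \<in> tangent_space X x" "x' \<in> fst d" "v' \<in> tangent_space X x'" "snd d x = snd d x'" "v d = v' d"
    using p eq by (auto simp: tangent_chart_def)
  then have "x = x'" using inj[OF d] by (auto dest: inj_onD)
  then show "p = p'" using * tangent_ext[OF _ _ d] by auto
qed

lemma (in C1_manifold) tangent_chart_inv:
  assumes c: "c \<in> X" and z: "z \<in> chart_image c"
  shows "chart_inv (tangent_chart X c) (z, w) = (chart_inv c z, tvec_of X c (chart_inv c z) w)" (is "_ = ?e")
proof -
  note x = chart_inv_image[OF z]
  have e: "?e \<in> fst (tangent_chart X c)" "snd (tangent_chart X c) ?e = (z, w)"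
    using x tvec_of_in[OF c x(1)] tvec_of_chart[OF c x(1)] by (auto simp: tangent_chart_def)
  have "tangent_chart X c \<in> tangent_atlas X" using c by (simp add: tangent_atlas_def)
  from inv_into_f_f[OF inj_on_tangent_chart[OF this] e(1)] show ?thesis
    unfolding chart_inv_def[of "tangent_chart X c"] e(2) .
qed

lemma (in C1_manifold) tangent_chart_image:
  assumes c: "c \<in> X" shows "chart_image (tangent_chart X c) = chart_image c \<times> UNIV"
proof (rule antisym)
  show "chart_image c \<times> UNIV \<subseteq> chart_image (tangent_chart X c)"
  proof (clarify)
    fix z w assume z: "z \<in> chart_image c"
    note x = chart_inv_image[OF z]
    have "(chart_inv c z, tvec_of X c (chart_inv c z) w) \<in> fst (tangent_chart X c)"
      "snd (tangent_chart X c) (chart_inv c z, tvec_of X c (chart_inv c z) w) = (z, w)"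
      using x tvec_of_in[OF c x(1)] tvec_of_chart[OF c x(1)] by (auto simp: tangent_chart_def)
    then show "(z, w) \<in> chart_image (tangent_chart X c)" unfolding chart_image_def by (metis imageI)
  qed
qed (auto simp: chart_image_def tangent_chart_def)

lemma tangent_linear_on_fibre_iff:
  assumes "points (tangent_atlas M) = {(x, v). x \<in> points M \<and> v \<in> tangent_space M x}" "x \<in> points M"
  shows "linear_on_fibre (tangent_bundle M) (tangent_bundle X) A x \<longleftrightarrow>
    (\<forall>v\<in>tangent_space M x. \<forall>w\<in>tangent_space M x.
      A (x, tvec_add v w) = (fst (A (x, v)), tvec_add (snd (A (x, v))) (snd (A (x, w))))) \<and>
    (\<forall>r. \<forall>v\<in>tangent_space M x. A (x, tvec_scale r v) = (fst (A (x, v)), tvec_scale r (snd (A (x, v)))))"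
proof -
  have "fibre (tangent_bundle M) x = Pair x ` tangent_space M x"
    using assms by (auto simp: fibre_def tangent_bundle_def)
  then show ?thesis by (simp add: linear_on_fibre_def tangent_bundle_def case_prod_beta)
qed

text \<open>The pointwise content of \<open>has_colocal_weak_derivative\<close>. Measurability of
  \<open>A\<close> and linearity on fibres are consequences (\<open>A_measurable\<close>,
  \<open>has_colocal_weak_derivative\<close>), so a candidate derivative can be recognised by its
  values alone.\<close>

locale colocal_derivative = M: C1_manifold M + X: C1_manifold X
  for M :: "('p, 'a::euclidean_space) atlas" and X :: "('s, 'c::euclidean_space) atlas" +
  fixes U :: "'p \<Rightarrow> 's" and A :: "'p \<times> ('p, 'a) tvec \<Rightarrow> 's \<times> ('s, 'c) tvec"
  assumes U_measurable: "measurable_map M X U"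
    and wd: "f \<in> C1c X \<Longrightarrow> weakly_differentiable M (f \<circ> U)"
    and A_fst: "x \<in> points M \<Longrightarrow> v \<in> tangent_space M x \<Longrightarrow> fst (A (x, v)) = U x"
    and A_snd: "x \<in> points M \<Longrightarrow> v \<in> tangent_space M x \<Longrightarrow> snd (A (x, v)) \<in> tangent_space X (U x)"
    and A_linear: "ae_on M (\<lambda>x. tvec_linear M x (\<lambda>v. snd (A (x, v))))"
    and A_deriv: "f \<in> C1c X \<Longrightarrow> has_weak_derivative M (f \<circ> U) \<omega> \<Longrightarrow>
      ae_on M (\<lambda>x. \<forall>v\<in>tangent_space M x. \<omega> (x, v) = dreal X f (A (x, v)))"
begin

lemma U_in: "x \<in> points M \<Longrightarrow> U x \<in> points X"
  using U_measurable by (auto simp: measurable_map_def)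

lemma A_eq: "x \<in> points M \<Longrightarrow> v \<in> tangent_space M x \<Longrightarrow> A (x, v) = (U x, snd (A (x, v)))"
  using A_fst by (simp add: prod_eq_iff)

lemma weak_derivative_tangent_linear:
  "has_weak_derivative M g \<omega> \<Longrightarrow> ae_on M (\<lambda>x. tangent_linear M x (\<lambda>v. \<omega> (x, v)))"
  by (simp add: has_weak_derivative_def tangent_linear_def)

lemma dreal_A_linear:
  assumes "x \<in> points M" "tvec_linear M x (\<lambda>v. snd (A (x, v)))" "C1_fun X g"
  shows "tangent_linear M x (\<lambda>v. dreal X g (A (x, v)))"
  unfolding tangent_linear_def
proof (intro conjI ballI allI)
  fix v w r assume v: "v \<in> tangent_space M x"
  show "dreal X g (A (x, tvec_scale r v)) = r * dreal X g (A (x, v))"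
    using assms v M.tangent_scale[OF v, of r] A_eq[OF assms(1) v] A_eq[OF assms(1) M.tangent_scale[OF v, of r]]
      X.dreal_scale[OF assms(3) U_in[OF assms(1)]] by (simp add: tvec_linear_def)
  assume w: "w \<in> tangent_space M x"
  show "dreal X g (A (x, tvec_add v w)) = dreal X g (A (x, v)) + dreal X g (A (x, w))"
    using assms v w A_eq[OF assms(1) v] A_eq[OF assms(1) w] A_eq[OF assms(1) M.tangent_add[OF v w]]
      X.dreal_add[OF assms(3) U_in[OF assms(1)]] by (simp add: tvec_linear_def)
qed

lemma weak_derivative_in_chart:
  assumes "has_weak_derivative M g \<omega>" "c \<in> M"
  shows "has_weak_derivative_on (chart_image c) (g \<circ> chart_inv c)
    (\<lambda>z w. \<omega> (chart_inv c z, tvec_of M c (chart_inv c z) w))"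
  using assms by (simp add: has_weak_derivative_def)

lemma chart_inv_points: "c \<in> M \<Longrightarrow> z \<in> chart_image c \<Longrightarrow> chart_inv c z \<in> points M"
  using chart_inv_image(1)[of z c] unfolding points_def by blast

text \<open>The product rule for a bump \<open>\<beta>\<close> and \<open>g\<close> identifies both weak derivatives where
  \<open>\<beta> \<circ> U > 0\<close>. This is what extends the chain rule to functions without compact support.\<close>

lemma bump_times_deriv:
  assumes g: "C1_fun X g" "\<And>y. y \<in> points X \<Longrightarrow> \<bar>g y\<bar> \<le> B" and \<gamma>: "has_weak_derivative M (g \<circ> U) \<gamma>"
    and \<beta>: "\<beta> \<in> C1c X"
  shows "ae_on M (\<lambda>x. \<forall>v\<in>tangent_space M x. \<beta> (U x) * (dreal X g (A (x, v)) - \<gamma> (x, v)) = 0)"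
proof -
  let ?F = "\<lambda>y. \<beta> y * g y"
  have F: "?F \<in> C1c X" by (rule X.C1c_mult[OF \<beta> g(1)])
  obtain \<omega> where \<omega>: "has_weak_derivative M (\<beta> \<circ> U) \<omega>" using wd[OF \<beta>] by (auto simp: weakly_differentiable_def)
  obtain \<omega>' where \<omega>': "has_weak_derivative M (?F \<circ> U) \<omega>'" using wd[OF F] by (auto simp: weakly_differentiable_def)
  obtain B\<beta> where B\<beta>: "\<And>y. y \<in> points X \<Longrightarrow> \<bar>\<beta> y\<bar> \<le> B\<beta>" using X.C1c_bounded[OF \<beta>] by blast
  let ?G = "\<lambda>x. (\<forall>v\<in>tangent_space M x. \<omega> (x, v) = dreal X \<beta> (A (x, v))) \<and>
     (\<forall>v\<in>tangent_space M x. \<omega>' (x, v) = dreal X ?F (A (x, v))) \<and>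
     tvec_linear M x (\<lambda>v. snd (A (x, v))) \<and> tangent_linear M x (\<lambda>v. \<gamma> (x, v))"
  have good: "ae_on M ?G"
    by (intro ae_on_conj A_deriv[OF \<beta> \<omega>] A_deriv[OF F \<omega>'] A_linear weak_derivative_tangent_linear[OF \<gamma>])
  show ?thesis
    unfolding M.ae_on_iff
  proof
    fix c assume c: "c \<in> M"
    let ?S = "chart_image c"
    let ?t = "\<lambda>z i. tvec_of M c (chart_inv c z) i"
    \<comment> \<open>The weak derivative given by the product rule on \<open>M\<close>. It is
      compared with \<open>\<omega>'\<close>, which the chain rule on \<open>X\<close> describes
      because \<open>?F\<close> is compactly supported.\<close>
    let ?D = "\<lambda>z i. \<omega> (chart_inv c z, ?t z i) * (g \<circ> U \<circ> chart_inv c) z + \<gamma> (chart_inv c z, ?t z i) * (\<beta> \<circ> U \<circ> chart_inv c) z"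
    have b1: "\<bar>(\<beta> \<circ> U \<circ> chart_inv c) z\<bar> \<le> max B\<beta> B" and b2: "\<bar>(g \<circ> U \<circ> chart_inv c) z\<bar> \<le> max B\<beta> B" if "z \<in> ?S" for z
      using B\<beta>[OF U_in[OF chart_inv_points[OF c that]]] g(2)[OF U_in[OF chart_inv_points[OF c that]]] by auto
    have "has_weak_derivative_on ?S (\<lambda>z. (\<beta> \<circ> U \<circ> chart_inv c) z * (g \<circ> U \<circ> chart_inv c) z) ?D"
      by (rule has_weak_derivative_on_mult[OF M.open_image[OF c] weak_derivative_in_chart[OF \<omega> c]
            weak_derivative_in_chart[OF \<gamma> c] b1 b2])
    moreover have "(\<lambda>z. (\<beta> \<circ> U \<circ> chart_inv c) z * (g \<circ> U \<circ> chart_inv c) z) = (?F \<circ> U) \<circ> chart_inv c"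
      by (simp add: fun_eq_iff)
    ultimately have w1: "has_weak_derivative_on ?S ((?F \<circ> U) \<circ> chart_inv c) ?D" by simp
    have N: "negligible {z \<in> ?S. ?D z i \<noteq> \<omega>' (chart_inv c z, ?t z i)}" if "i \<in> Basis" for i
      by (rule has_weak_derivative_on_unique[OF M.open_image[OF c] w1 weak_derivative_in_chart[OF \<omega>' c] that])
    \<comment> \<open>Uniqueness of weak derivatives compares one basis direction at a time.
      Finitely many null sets cover these, and linearity at the remaining points extends the
      identity to all \<open>v\<close>.\<close>
    let ?N = "{z \<in> ?S. \<not> ?G (chart_inv c z)} \<union> (\<Union>i\<in>Basis. {z \<in> ?S. ?D z i \<noteq> \<omega>' (chart_inv c z, ?t z i)})"
    have "negligible ?N"
    proof (rule negligible_Un)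
      show "negligible {z \<in> ?S. \<not> ?G (chart_inv c z)}" using good c unfolding M.ae_on_iff by blast
      show "negligible (\<Union>i\<in>Basis. {z \<in> ?S. ?D z i \<noteq> \<omega>' (chart_inv c z, ?t z i)})"
        using N by (intro negligible_Union finite_imageI) auto
    qed
    moreover have "{z \<in> ?S. \<not> (\<forall>v\<in>tangent_space M (chart_inv c z).
        \<beta> (U (chart_inv c z)) * (dreal X g (A (chart_inv c z, v)) - \<gamma> (chart_inv c z, v)) = 0)} \<subseteq> ?N"
    proof (rule subsetI, rule ccontr)
      fix z assume z: "z \<in> {z \<in> ?S. \<not> (\<forall>v\<in>tangent_space M (chart_inv c z).
        \<beta> (U (chart_inv c z)) * (dreal X g (A (chart_inv c z, v)) - \<gamma> (chart_inv c z, v)) = 0)}" and "z \<notin> ?N"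
      let ?x = "chart_inv c z"
      have zS: "z \<in> ?S" using z by blast
      have G: "?G ?x" using \<open>z \<notin> ?N\<close> zS by blast
      have eq: "?D z i = \<omega>' (?x, ?t z i)" if "i \<in> Basis" for i using \<open>z \<notin> ?N\<close> zS that by blast
      have x: "?x \<in> points M" "?x \<in> fst c" using chart_inv_points[OF c zS] chart_inv_image(1)[OF zS] by auto
      \<comment> \<open>The terms in which the bump is differentiated coincide, since the chain rule
        is known for \<open>\<beta>\<close>, and cancel.\<close>
      have basis: "\<beta> (U ?x) * dreal X g (A (?x, ?t z i)) = \<beta> (U ?x) * \<gamma> (?x, ?t z i)" if "i \<in> Basis" for i
      proof -
        have t: "?t z i \<in> tangent_space M ?x" by (rule M.tvec_of_in[OF c x(2)])
        have "\<omega>' (?x, ?t z i) = dreal X ?F (U ?x, snd (A (?x, ?t z i)))"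
          using G t A_eq[OF x(1) t] by simp
        also have "\<dots> = dreal X \<beta> (U ?x, snd (A (?x, ?t z i))) * g (U ?x) + dreal X g (U ?x, snd (A (?x, ?t z i))) * \<beta> (U ?x)"
          by (rule X.dreal_mult[OF X.C1c_imp_C1_fun[OF \<beta>] g(1) U_in[OF x(1)]])
        also have "\<dots> = \<omega> (?x, ?t z i) * g (U ?x) + dreal X g (A (?x, ?t z i)) * \<beta> (U ?x)"
          using G t A_eq[OF x(1) t] by simp
        finally show ?thesis using eq[OF that] by (auto simp: mult.commute)
      qed
      have "\<beta> (U ?x) * (dreal X g (A (?x, v)) - \<gamma> (?x, v)) = 0" if v: "v \<in> tangent_space M ?x" for v
      proof -
        have "tangent_linear M ?x (\<lambda>v. dreal X g (A (?x, v)))" "tangent_linear M ?x (\<lambda>v. \<gamma> (?x, v))"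
          using G dreal_A_linear[OF x(1) _ g(1)] by auto
        note E = this[THEN M.tangent_linear_expand[OF _ c x(2) v]]
        have "\<beta> (U ?x) * dreal X g (A (?x, v)) = (\<Sum>i\<in>Basis. (v c \<bullet> i) * (\<beta> (U ?x) * dreal X g (A (?x, ?t z i))))"
          unfolding E(1) by (simp add: sum_distrib_left mult_ac)
        also have "\<dots> = (\<Sum>i\<in>Basis. (v c \<bullet> i) * (\<beta> (U ?x) * \<gamma> (?x, ?t z i)))"
          by (rule sum.cong[OF refl]) (simp only: basis)
        also have "\<dots> = \<beta> (U ?x) * \<gamma> (?x, v)"
          unfolding E(2) by (simp add: sum_distrib_left mult_ac)
        finally show ?thesis by (simp add: right_diff_distrib)
      qed
      then show False using z by blast
    qed
    ultimately show "negligible {z \<in> ?S. \<not> (\<forall>v\<in>tangent_space M (chart_inv c z).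
        \<beta> (U (chart_inv c z)) * (dreal X g (A (chart_inv c z, v)) - \<gamma> (chart_inv c z, v)) = 0)}"
      by (rule negligible_subset)
  qed
qed

text \<open>At each \<open>x\<close> the point \<open>U x\<close> lies in one of countably many
  balls whose bump is positive there, so the bump can be cancelled off one null set. The bound on
  \<open>g\<close> is the price of the product rule.\<close>

lemma deriv_C1_fun:
  assumes g: "C1_fun X g" "\<And>y. y \<in> points X \<Longrightarrow> \<bar>g y\<bar> \<le> B" and \<gamma>: "has_weak_derivative M (g \<circ> U) \<gamma>"
  shows "ae_on M (\<lambda>x. \<forall>v\<in>tangent_space M x. dreal X g (A (x, v)) = \<gamma> (x, v))"
proof -
  obtain I where I: "countable I" "\<And>c q r. (c, q, r) \<in> I \<Longrightarrow> X.nice_ball c q r"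
    "\<And>c x. c \<in> X \<Longrightarrow> x \<in> fst c \<Longrightarrow> \<exists>d q r. (d, q, r) \<in> I \<and> x \<in> fst d \<and> snd d x \<in> ball q r"
    by (rule X.countable_nice_balls, rule that)
  let ?P = "\<lambda>(d, q, r) x. \<forall>v\<in>tangent_space M x. X.bump_fun d q r (U x) * (dreal X g (A (x, v)) - \<gamma> (x, v)) = 0"
  have "ae_on M (?P j)" if "j \<in> I" for j
    using bump_times_deriv[OF g \<gamma> X.bump_fun_C1c[OF I(2)]] that by (cases j) auto
  from ae_on_ball_countable[OF I(1) this] show ?thesis
  proof (rule ae_on_mono)
    fix x assume x: "x \<in> points M" and P: "\<forall>j\<in>I. ?P j x"
    from I(3) chart_at_mem[OF U_in[OF x]] obtain d q r where d: "(d, q, r) \<in> I" "U x \<in> fst d" "snd d (U x) \<in> ball q r"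
      by meson
    then have "X.bump_fun d q r (U x) \<noteq> 0"
      using bump_pos[OF d(3)] unfolding X.bump_fun_def lift_def by simp
    then show "\<forall>v\<in>tangent_space M x. dreal X g (A (x, v)) = \<gamma> (x, v)"
      using bspec[OF P d(1)] by simp
  qed
qed

lemma U_meas_on: "c \<in> M \<Longrightarrow> meas_on (chart_image c) X (\<lambda>z. U (chart_inv c z))"
  using U_measurable measurable_map_iff[of M X U, OF M.inj] by (simp add: o_def)

text \<open>On this set the bump of \<open>ball q r\<close> is positive along \<open>U\<close>, so
  \<open>coordinate_of_dreal\<close> applies. Countably many such sets cover a chart image
  (\<open>dom_part_cover\<close>).\<close>

definition dom_part :: "('p, 'a) chart \<Rightarrow> ('s, 'c) chart \<Rightarrow> 'c \<Rightarrow> real \<Rightarrow> 'a set" where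
  "dom_part c d q r = {z \<in> chart_image c. U (chart_inv c z) \<in> fst d \<and> snd d (U (chart_inv c z)) \<in> ball q r}"

lemma
  assumes "c \<in> M" "X.nice_ball d q r"
  shows dom_part_lebesgue: "dom_part c d q r \<in> sets lebesgue"
    and chart_U_measurable: "(\<lambda>z. snd d (U (chart_inv c z))) \<in> borel_measurable (lebesgue_on (dom_part c d q r))"
  using X.meas_on_chart[OF U_meas_on[OF assms(1)] _ open_ball[of q r], of d] assms(2)
  unfolding dom_part_def X.nice_ball_def by blast+

text \<open>In \<open>coordinate_of_dreal\<close> the two differentials along \<open>A\<close> are
  a.e. equal to weak derivatives, which are measurable in charts. The coordinate thus agrees a.e.
  with an explicit measurable expression.\<close>

lemma A_coordinate_measurable:
  assumes c: "c \<in> M" and n: "X.nice_ball d q r" and i: "i \<in> Basis"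
  shows "(\<lambda>z. snd (A (chart_inv c z, tvec_of M c (chart_inv c z) i)) d) \<in> borel_measurable (lebesgue_on (dom_part c d q r))"
    (is "?a \<in> borel_measurable (lebesgue_on ?S)")
  unfolding borel_measurable_euclidean_space[of ?a]
proof
  fix b :: 'c assume "b \<in> Basis"
  let ?x = "chart_inv c" and ?t = "\<lambda>z. tvec_of M c (chart_inv c z) i"
  note S = dom_part_lebesgue[OF c n] and m = chart_U_measurable[OF c n]
  obtain \<omega>b where \<omega>b: "has_weak_derivative M (X.coord_fun d q r b \<circ> U) \<omega>b"
    using wd[OF X.coord_fun_C1c[OF n]] by (auto simp: weakly_differentiable_def)
  obtain \<omega>0 where \<omega>0: "has_weak_derivative M (X.bump_fun d q r \<circ> U) \<omega>0"
    using wd[OF X.bump_fun_C1c[OF n]] by (auto simp: weakly_differentiable_def)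
  have meas\<omega>: "(\<lambda>z. \<omega> (?x z, ?t z)) \<in> borel_measurable (lebesgue_on ?S)" if "has_weak_derivative M g \<omega>" for g \<omega>
  proof -
    have "locally_integrable_on (chart_image c) (\<lambda>z. \<omega> (?x z, ?t z))"
      using weak_derivative_in_chart[OF that c] i by (simp add: has_weak_derivative_on_def)
    from locally_integrable_measurable[OF M.open_image[OF c] this]
    show ?thesis by (rule measurable_restrict_mono) (auto simp: dom_part_def)
  qed
  let ?\<phi> = "\<lambda>z. (\<omega>b (?x z, ?t z) - (snd d (U (?x z)) \<bullet> b) * \<omega>0 (?x z, ?t z)) / bump q r (snd d (U (?x z)))"
  have "bump q r \<in> borel_measurable borel"
    by (rule borel_measurable_continuous_onI[OF Ck1_continuous_on[OF Ck1_bump]])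
  from measurable_compose[OF m this]
  have "?\<phi> \<in> borel_measurable (lebesgue_on ?S)"
    using m meas\<omega>[OF \<omega>b] meas\<omega>[OF \<omega>0]
    by (intro borel_measurable_divide borel_measurable_diff borel_measurable_times borel_measurable_inner borel_measurable_const)
  then show "(\<lambda>z. ?a z \<bullet> b) \<in> borel_measurable (lebesgue_on ?S)"
  proof (rule borel_measurable_lebesgue_on_cong_ae[OF S])
    let ?G = "\<lambda>x. (\<forall>v\<in>tangent_space M x. \<omega>b (x, v) = dreal X (X.coord_fun d q r b) (A (x, v))) \<and>
       (\<forall>v\<in>tangent_space M x. \<omega>0 (x, v) = dreal X (X.bump_fun d q r) (A (x, v)))"
    have "ae_on M ?G"
      by (intro ae_on_conj A_deriv[OF X.coord_fun_C1c[OF n] \<omega>b] A_deriv[OF X.bump_fun_C1c[OF n] \<omega>0])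
    then have N: "negligible {z \<in> chart_image c. \<not> ?G (?x z)}" using c unfolding M.ae_on_iff by blast
    show "negligible {z \<in> ?S. ?\<phi> z \<noteq> ?a z \<bullet> b}"
    proof (rule negligible_subset[OF N], intro subsetI, rule ccontr)
      fix z assume z: "z \<in> {z \<in> ?S. ?\<phi> z \<noteq> ?a z \<bullet> b}" and "z \<notin> {z \<in> chart_image c. \<not> ?G (?x z)}"
      then have zS: "z \<in> chart_image c" "U (?x z) \<in> fst d" "snd d (U (?x z)) \<in> ball q r" and G: "?G (?x z)"
        by (auto simp: dom_part_def)
      have t: "?t z \<in> tangent_space M (?x z)" by (rule M.tvec_of_in[OF c chart_inv_image(1)[OF zS(1)]])
      have x: "?x z \<in> points M" by (rule chart_inv_points[OF c zS(1)])
      have "?a z \<bullet> b = ?\<phi> z"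
        using X.coordinate_of_dreal[OF n zS(2,3) A_snd[OF x t], of b] G t A_eq[OF x t] by simp
      then show False using z by simp
    qed
  qed
qed

lemma A_points: "x \<in> points M \<Longrightarrow> v \<in> tangent_space M x \<Longrightarrow> A (x, v) \<in> points (tangent_atlas X)"
  using A_fst[of x v] A_snd[of x v] U_in[of x] by (cases "A (x, v)") (auto simp: X.points_tangent_atlas)

lemma dom_part_cover:
  assumes "c \<in> M" "\<And>c x. c \<in> X \<Longrightarrow> x \<in> fst c \<Longrightarrow> \<exists>d q r. (d, q, r) \<in> I \<and> x \<in> fst d \<and> snd d x \<in> ball q r"
  shows "chart_image c = (\<Union>(d, q, r)\<in>I. dom_part c d q r)"
proof (rule antisym[OF subsetI])
  fix z assume z: "z \<in> chart_image c"
  from assms(2) chart_at_mem[OF U_in[OF chart_inv_points[OF assms(1) z]]]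
  obtain d q r where "(d, q, r) \<in> I" "U (chart_inv c z) \<in> fst d" "snd d (U (chart_inv c z)) \<in> ball q r"
    by meson
  then show "z \<in> (\<Union>(d, q, r)\<in>I. dom_part c d q r)" using z by (force simp: dom_part_def)
qed (auto simp: dom_part_def)

text \<open>Measurability in the base point for one fixed coordinate direction. The matrix entries
  of \<open>K \<circ> A\<close> are read off from these maps.\<close>

lemma A_basis_meas_on:
  assumes c: "c \<in> M" and i: "i \<in> Basis"
  shows "meas_on (chart_image c) (tangent_atlas X) (\<lambda>z. A (chart_inv c z, tvec_of M c (chart_inv c z) i))"
proof -
  obtain I where I: "countable I" "\<And>c q r. (c, q, r) \<in> I \<Longrightarrow> X.nice_ball c q r"
    "\<And>c x. c \<in> X \<Longrightarrow> x \<in> fst c \<Longrightarrow> \<exists>d q r. (d, q, r) \<in> I \<and> x \<in> fst d \<and> snd d x \<in> ball q r"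
    by (rule X.countable_nice_balls, rule that)
  have in_M: "chart_inv c z \<in> points M" "tvec_of M c (chart_inv c z) i \<in> tangent_space M (chart_inv c z)"
    if "z \<in> chart_image c" for z
    using chart_inv_points[OF c that] M.tvec_of_in[OF c chart_inv_image(1)[OF that]] by auto
  show ?thesis
  proof (rule meas_onI_charts[OF _ X.inj_on_tangent_chart I(1), where ch = "\<lambda>(d, q, r). tangent_chart X d"
        and T = "\<lambda>(d, q, r). dom_part c d q r"])
    show "(\<lambda>z. A (chart_inv c z, tvec_of M c (chart_inv c z) i)) \<in> chart_image c \<rightarrow> points (tangent_atlas X)"
      using A_points in_M by auto
    show "chart_image c = (\<Union>j\<in>I. case j of (d, q, r) \<Rightarrow> dom_part c d q r)"
      by (rule dom_part_cover[OF c I(3)])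
    fix j assume "j \<in> I"
    then obtain d q r where j: "j = (d, q, r)" and n: "X.nice_ball d q r" using I(2) by (cases j) auto
    then have d: "d \<in> X" by (simp add: X.nice_ball_def)
    show "(case j of (d, q, r) \<Rightarrow> tangent_chart X d) \<in> tangent_atlas X"
      using d by (simp add: j tangent_atlas_def)
    show "(case j of (d, q, r) \<Rightarrow> dom_part c d q r) \<in> sets lebesgue"
      using dom_part_lebesgue[OF c n] by (simp add: j)
    have eq: "A (chart_inv c z, tvec_of M c (chart_inv c z) i) = (U (chart_inv c z), snd (A (chart_inv c z, tvec_of M c (chart_inv c z) i)))"
      and V: "snd (A (chart_inv c z, tvec_of M c (chart_inv c z) i)) \<in> tangent_space X (U (chart_inv c z))"
      if "z \<in> dom_part c d q r" for z
      using that A_eq[OF in_M] A_snd[OF in_M] by (auto simp: dom_part_def)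
    show "A (chart_inv c z, tvec_of M c (chart_inv c z) i) \<in> fst (case j of (d, q, r) \<Rightarrow> tangent_chart X d)"
      if "z \<in> (case j of (d, q, r) \<Rightarrow> dom_part c d q r)" for z
    proof -
      have z: "z \<in> dom_part c d q r" using that by (simp add: j)
      then show ?thesis using V[OF z] by (subst eq[OF z]) (simp add: j tangent_chart_def dom_part_def)
    qed
    have "(\<lambda>z. (snd d (U (chart_inv c z)), snd (A (chart_inv c z, tvec_of M c (chart_inv c z) i)) d))
        \<in> borel_measurable (lebesgue_on (dom_part c d q r))"
      by (rule borel_measurable_Pair[OF chart_U_measurable[OF c n] A_coordinate_measurable[OF c n i]])
    also have "?this \<longleftrightarrow> (\<lambda>z. snd (tangent_chart X d) (A (chart_inv c z, tvec_of M c (chart_inv c z) i)))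
        \<in> borel_measurable (lebesgue_on (dom_part c d q r))"
    proof (rule measurable_cong)
      fix z assume "z \<in> space (lebesgue_on (dom_part c d q r))"
      then have z: "z \<in> dom_part c d q r" by simp
      show "(snd d (U (chart_inv c z)), snd (A (chart_inv c z, tvec_of M c (chart_inv c z) i)) d) =
        snd (tangent_chart X d) (A (chart_inv c z, tvec_of M c (chart_inv c z) i))"
        by (subst (2) eq[OF z]) (simp add: tangent_chart_def)
    qed
    finally show "(\<lambda>z. snd (case j of (d, q, r) \<Rightarrow> tangent_chart X d) (A (chart_inv c z, tvec_of M c (chart_inv c z) i)))
        \<in> borel_measurable (lebesgue_on (case j of (d, q, r) \<Rightarrow> dom_part c d q r))"
      by (simp add: j)
  qed
qed

text \<open>By linearity a coordinate of \<open>A\<close> at \<open>(z, w)\<close> is a.e. the sum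
  over the basis of the coordinates of \<open>w\<close> times those of \<open>A\<close> at the basis
  vectors, which depend on \<open>z\<close> alone. Linearity may fail on a null set of
  \<open>z\<close> together with all \<open>w\<close>, which is still negligible.\<close>

lemma A_measurable: "measurable_map (tangent_atlas M) (tangent_atlas X) A"
proof -
  have iff: "measurable_map (tangent_atlas M) (tangent_atlas X) A \<longleftrightarrow>
      (\<forall>tc\<in>tangent_atlas M. meas_on (chart_image tc) (tangent_atlas X) (A \<circ> chart_inv tc))"
    by (rule measurable_map_iff[OF M.inj_on_tangent_chart])
  obtain I where I: "countable I" "\<And>c q r. (c, q, r) \<in> I \<Longrightarrow> X.nice_ball c q r"
    "\<And>c x. c \<in> X \<Longrightarrow> x \<in> fst c \<Longrightarrow> \<exists>d q r. (d, q, r) \<in> I \<and> x \<in> fst d \<and> snd d x \<in> ball q r"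
    by (rule X.countable_nice_balls, rule that)
  show ?thesis
    unfolding iff
  proof
    fix tc assume "tc \<in> tangent_atlas M"
    then obtain c where c: "c \<in> M" and tc: "tc = tangent_chart M c" by (auto simp: tangent_atlas_def)
    have img: "chart_image tc = chart_image c \<times> UNIV"
      unfolding tc by (rule M.tangent_chart_image[OF c])
    have in_M: "chart_inv c z \<in> points M" "tvec_of M c (chart_inv c z) w \<in> tangent_space M (chart_inv c z)"
      if "z \<in> chart_image c" for z w
      using chart_inv_points[OF c that] M.tvec_of_in[OF c chart_inv_image(1)[OF that]] by auto
    let ?B = "\<lambda>p. A (chart_inv c (fst p), tvec_of M c (chart_inv c (fst p)) (snd p))"
    have inv: "(A \<circ> chart_inv tc) p = ?B p" if "p \<in> chart_image c \<times> UNIV" for p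
      using M.tangent_chart_inv[OF c, of "fst p" "snd p"] that by (auto simp: tc)
    have "meas_on (chart_image c \<times> UNIV) (tangent_atlas X) ?B"
    proof (rule meas_onI_charts[OF _ X.inj_on_tangent_chart I(1), where ch = "\<lambda>(d, q, r). tangent_chart X d"
        and T = "\<lambda>(d, q, r). dom_part c d q r \<times> UNIV"])
      show "?B \<in> chart_image c \<times> UNIV \<rightarrow> points (tangent_atlas X)"
        using A_points in_M by auto
      show "chart_image c \<times> UNIV = (\<Union>j\<in>I. case j of (d, q, r) \<Rightarrow> dom_part c d q r \<times> UNIV)"
        using dom_part_cover[OF c I(3)] by auto
      fix j assume "j \<in> I"
      then obtain d q r where j: "j = (d, q, r)" and n: "X.nice_ball d q r" using I(2) by (cases j) auto
      then have d: "d \<in> X" by (simp add: X.nice_ball_def)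
      let ?S = "dom_part c d q r"
      note S = dom_part_lebesgue[OF c n]
      show "(case j of (d, q, r) \<Rightarrow> tangent_chart X d) \<in> tangent_atlas X"
        using d by (simp add: j tangent_atlas_def)
      show T: "(case j of (d, q, r) \<Rightarrow> dom_part c d q r \<times> UNIV) \<in> sets lebesgue"
        using lebesgue_sets_Times_UNIV[OF S] by (simp add: j)
      have eq: "?B p = (U (chart_inv c (fst p)), snd (?B p))"
        and V: "snd (?B p) \<in> tangent_space X (U (chart_inv c (fst p)))" if "p \<in> ?S \<times> UNIV" for p
        using that A_eq[OF in_M] A_snd[OF in_M] by (auto simp: dom_part_def)
      show "?B p \<in> fst (case j of (d, q, r) \<Rightarrow> tangent_chart X d)"
        if "p \<in> (case j of (d, q, r) \<Rightarrow> dom_part c d q r \<times> UNIV)" for p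
      proof -
        have p: "p \<in> ?S \<times> UNIV" using that by (simp add: j)
        then show ?thesis using V[OF p] by (subst eq[OF p]) (auto simp: j tangent_chart_def dom_part_def)
      qed
      let ?a = "\<lambda>i z. snd (A (chart_inv c z, tvec_of M c (chart_inv c z) i)) d"
      have sndm: "snd \<in> borel_measurable (lebesgue_on (?S \<times> (UNIV :: 'a set)))"
        by (intro measurable_restrict_space1 measurable_completion) (simp add: borel_measurable_continuous_onI continuous_on_snd)
      have am: "(\<lambda>p. ?a i (fst p)) \<in> borel_measurable (lebesgue_on (?S \<times> (UNIV :: 'a set)))" if "i \<in> Basis" for i
        by (rule borel_measurable_fst_lebesgue_on[OF S A_coordinate_measurable[OF c n that]])
      have sum: "(\<lambda>p. \<Sum>i\<in>Basis. (snd p \<bullet> i) *\<^sub>R ?a i (fst p)) \<in> borel_measurable (lebesgue_on (?S \<times> (UNIV :: 'a set)))"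
        by (intro borel_measurable_sum borel_measurable_scaleR borel_measurable_inner sndm am borel_measurable_const)
      have bm: "(\<lambda>p. snd (?B p) d) \<in> borel_measurable (lebesgue_on (?S \<times> (UNIV :: 'a set)))"
      proof (rule borel_measurable_lebesgue_on_cong_ae[OF lebesgue_sets_Times_UNIV[OF S] sum])
        have N: "negligible ({z \<in> chart_image c. \<not> tvec_linear M (chart_inv c z) (\<lambda>v. snd (A (chart_inv c z, v)))} \<times> (UNIV :: 'a set))"
          by (rule negligible_Times_UNIV) (use A_linear c in \<open>simp add: M.ae_on_iff\<close>)
        show "negligible {p \<in> ?S \<times> (UNIV :: 'a set). (\<Sum>i\<in>Basis. (snd p \<bullet> i) *\<^sub>R ?a i (fst p)) \<noteq> snd (?B p) d}"
        proof (rule negligible_subset[OF N], intro subsetI, rule ccontr)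
          fix p assume p: "p \<in> {p \<in> ?S \<times> (UNIV :: 'a set). (\<Sum>i\<in>Basis. (snd p \<bullet> i) *\<^sub>R ?a i (fst p)) \<noteq> snd (?B p) d}"
            and np: "p \<notin> {z \<in> chart_image c. \<not> tvec_linear M (chart_inv c z) (\<lambda>v. snd (A (chart_inv c z, v)))} \<times> (UNIV :: 'a set)"
          have z: "fst p \<in> chart_image c" using p by (auto simp: dom_part_def)
          have lin: "tvec_linear M (chart_inv c (fst p)) (\<lambda>v. snd (A (chart_inv c (fst p), v)))"
            using np z by (cases p) auto
          note t = in_M(2)[OF z] and x = chart_inv_image(1)[OF z]
          have "linear (\<lambda>w. snd (A (chart_inv c (fst p), tvec_of M c (chart_inv c (fst p)) w)) d)"
            using lin t unfolding tvec_linear_def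
            by (intro linearI) (simp_all add: M.tvec_of_add[OF c x] M.tvec_of_scale[OF c x] tvec_add_def[of "snd _"] tvec_scale_def[of _ "snd _"])
          from linear_expand_Basis[OF this, of "snd p"] p show False by simp
        qed
      qed
      have "(\<lambda>p. (snd d (U (chart_inv c (fst p))), snd (?B p) d)) \<in> borel_measurable (lebesgue_on (?S \<times> UNIV))"
        by (rule borel_measurable_Pair[OF borel_measurable_fst_lebesgue_on[OF S chart_U_measurable[OF c n]] bm])
      also have "?this \<longleftrightarrow> (\<lambda>p. snd (tangent_chart X d) (?B p)) \<in> borel_measurable (lebesgue_on (?S \<times> UNIV))"
      proof (rule measurable_cong)
        fix p :: "'a \<times> 'a" assume "p \<in> space (lebesgue_on (?S \<times> UNIV))"
        then have p: "p \<in> ?S \<times> UNIV" by simp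
        show "(snd d (U (chart_inv c (fst p))), snd (?B p) d) = snd (tangent_chart X d) (?B p)"
          by (subst (2) eq[OF p]) (simp add: tangent_chart_def)
      qed
      finally show "(\<lambda>p. snd (case j of (d, q, r) \<Rightarrow> tangent_chart X d) (?B p))
        \<in> borel_measurable (lebesgue_on (case j of (d, q, r) \<Rightarrow> dom_part c d q r \<times> UNIV))"
        by (simp add: j)
    qed
    then show "meas_on (chart_image tc) (tangent_atlas X) (A \<circ> chart_inv tc)"
      unfolding img
    proof (rule meas_on_cong_ae)
      show "A \<circ> chart_inv tc \<in> chart_image c \<times> UNIV \<rightarrow> points (tangent_atlas X)"
        using inv A_points in_M by auto
      have "{p \<in> chart_image c \<times> UNIV. ?B p \<noteq> (A \<circ> chart_inv tc) p} = {}"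
        unfolding Collect_empty_eq by (rule allI, rule notI, erule conjE, erule notE, rule inv[symmetric])
      then show "negligible {p \<in> chart_image c \<times> UNIV. ?B p \<noteq> (A \<circ> chart_inv tc) p}"
        by (simp only: negligible_empty)
    qed
  qed
qed

lemma has_colocal_weak_derivative: "has_colocal_weak_derivative M X U A"
  unfolding has_colocal_weak_derivative_def colocally_weakly_differentiable_def measurable_bundle_morphism_def
proof (intro conjI ballI allI impI)
  show "measurable_map (bundle_total (tangent_bundle M)) (bundle_total (tangent_bundle X)) A"
    using A_measurable by (simp add: tangent_bundle_def)
  show "proj (tangent_bundle X) (A e) = U (proj (tangent_bundle M) e)" if "e \<in> points (bundle_total (tangent_bundle M))" for e
    using that A_fst by (auto simp: tangent_bundle_def M.points_tangent_atlas)
  have "ae_on M (linear_on_fibre (tangent_bundle M) (tangent_bundle X) A)"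
    using A_linear
  proof (rule ae_on_mono)
    fix x assume x: "x \<in> points M" and lin: "tvec_linear M x (\<lambda>v. snd (A (x, v)))"
    show "linear_on_fibre (tangent_bundle M) (tangent_bundle X) A x"
      unfolding tangent_linear_on_fibre_iff[OF M.points_tangent_atlas x]
      using lin A_fst[OF x] M.tangent_add M.tangent_scale by (auto simp: tvec_linear_def prod_eq_iff)
  qed
  then show "ae_on (bundle_base (tangent_bundle M)) (linear_on_fibre (tangent_bundle M) (tangent_bundle X) A)"
    by (simp add: tangent_bundle_def)
qed (use U_measurable wd A_deriv in auto)

end

lemma has_colocal_weak_derivativeD:
  assumes "C1_manifold M" "C1_manifold X" and A: "has_colocal_weak_derivative M X U A"
  shows "colocal_derivative M X U A"
proof -
  interpret M: C1_manifold M by fact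
  interpret X: C1_manifold X by fact
  note D = A[unfolded has_colocal_weak_derivative_def colocally_weakly_differentiable_def measurable_bundle_morphism_def]
  have pts: "A (x, v) \<in> points (tangent_atlas X)" and base: "fst (A (x, v)) = U x"
    if "x \<in> points M" "v \<in> tangent_space M x" for x v
    using D that by (auto simp: measurable_map_def tangent_bundle_def M.points_tangent_atlas Pi_iff)
  show ?thesis
  proof
    show "measurable_map M X U" using D by blast
    show "weakly_differentiable M (f \<circ> U)" if "f \<in> C1c X" for f using D that by blast
    show "fst (A (x, v)) = U x" if "x \<in> points M" "v \<in> tangent_space M x" for x v by (rule base[OF that])
    show "snd (A (x, v)) \<in> tangent_space X (U x)" if "x \<in> points M" "v \<in> tangent_space M x" for x v
      using pts[OF that] base[OF that] by (cases "A (x, v)") (auto simp: X.points_tangent_atlas)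
    show "ae_on M (\<lambda>x. \<forall>v\<in>tangent_space M x. \<omega> (x, v) = dreal X f (A (x, v)))"
      if "f \<in> C1c X" "has_weak_derivative M (f \<circ> U) \<omega>" for f \<omega>
      using D that by blast
    have "ae_on M (linear_on_fibre (tangent_bundle M) (tangent_bundle X) A)"
      using D by (simp add: tangent_bundle_def)
    then show "ae_on M (\<lambda>x. tvec_linear M x (\<lambda>v. snd (A (x, v))))"
      by (rule ae_on_mono) (simp add: tangent_linear_on_fibre_iff[OF M.points_tangent_atlas] tvec_linear_def)
  qed
qed

section \<open>The bundle of linear maps\<close>

lemma (in C1_manifold) velocity_eq:
  assumes c: "c \<in> X" and \<gamma>: "\<And>t. \<gamma> t \<in> fst c" and w: "((\<lambda>t. snd c (\<gamma> t)) has_vector_derivative w) (at 0)"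
  shows "velocity X \<gamma> = (\<gamma> 0, tvec_of X c (\<gamma> 0) w)"
proof -
  have "vector_derivative (\<lambda>t. snd d (\<gamma> t)) (at 0) = trans_deriv c d (\<gamma> 0) w" if d: "d \<in> X" "\<gamma> 0 \<in> fst d" for d
  proof -
    have "((\<lambda>t. snd c (\<gamma> t)) has_derivative (\<lambda>h. h *\<^sub>R w)) (at 0)"
      using w by (simp add: has_vector_derivative_def)
    from diff_chain_at[OF this trans_has_derivative[OF c d(1) \<gamma> d(2)]]
    have "(((snd d \<circ> chart_inv c) \<circ> (\<lambda>t. snd c (\<gamma> t))) has_derivative (\<lambda>h. trans_deriv c d (\<gamma> 0) (h *\<^sub>R w))) (at 0)"
      by (simp add: o_def)
    moreover have "(snd d \<circ> chart_inv c) \<circ> (\<lambda>t. snd c (\<gamma> t)) = (\<lambda>t. snd d (\<gamma> t))"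
      using chart_inv_eq[OF c \<gamma>] by (simp add: fun_eq_iff)
    ultimately have "((\<lambda>t. snd d (\<gamma> t)) has_vector_derivative trans_deriv c d (\<gamma> 0) w) (at 0)"
      using linear_scale[OF linear_trans_deriv[OF c d(1) \<gamma> d(2)]] by (simp add: has_vector_derivative_def)
    then show ?thesis by (rule vector_derivative_at)
  qed
  then show ?thesis by (auto simp: velocity_def tvec_of_def fun_eq_iff)
qed

lemma has_weak_derivative_on_cong:
  assumes eq: "\<And>z w. z \<in> S \<Longrightarrow> G z w = G' z w"
  shows "has_weak_derivative_on S g G \<longleftrightarrow> has_weak_derivative_on S g G'"
proof -
  have "set_integrable lebesgue C (\<lambda>z. G z i) \<longleftrightarrow> set_integrable lebesgue C (\<lambda>z. G' z i)" if "C \<subseteq> S" for C i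
    unfolding set_integrable_def by (rule Bochner_Integration.integrable_cong) (use eq that in \<open>auto simp: indicator_def\<close>)
  then have "locally_integrable_on S (\<lambda>z. G z i) \<longleftrightarrow> locally_integrable_on S (\<lambda>z. G' z i)" for i
    unfolding locally_integrable_on_def by blast
  moreover have "set_lebesgue_integral lebesgue S (\<lambda>z. G z i * \<eta> z) = set_lebesgue_integral lebesgue S (\<lambda>z. G' z i * \<eta> z)" for i \<eta>
    unfolding set_lebesgue_integral_def by (rule Bochner_Integration.integral_cong) (use eq in \<open>auto simp: indicator_def\<close>)
  ultimately show ?thesis by (simp add: has_weak_derivative_on_def)
qed

lemma (in C1_manifold) C1_fun_has_weak_derivative:
  assumes f: "C1_fun X f" shows "has_weak_derivative X f (dreal X f)"
  unfolding has_weak_derivative_def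
proof (intro conjI ballI)
  show "ae_on X (\<lambda>x. (\<forall>v\<in>tangent_space X x. \<forall>w\<in>tangent_space X x. dreal X f (x, tvec_add v w) = dreal X f (x, v) + dreal X f (x, w)) \<and>
      (\<forall>r. \<forall>v\<in>tangent_space X x. dreal X f (x, tvec_scale r v) = r * dreal X f (x, v)))"
    by (rule ae_onI) (simp add: dreal_add[OF f] dreal_scale[OF f])
  fix c assume c: "c \<in> X"
  have C: "Ck 1 (chart_image c) (f \<circ> chart_inv c)" using f c by (simp add: C1_fun_def)
  have eq: "dreal X f (chart_inv c z, tvec_of X c (chart_inv c z) w) = frechet_derivative (f \<circ> chart_inv c) (at z) w"
    if z: "z \<in> chart_image c" for z w
    unfolding dreal_chart[OF f c chart_inv_image(1)[OF z] tvec_of_in[OF c chart_inv_image(1)[OF z]]]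
      tvec_of_chart[OF c chart_inv_image(1)[OF z]] chart_inv_image(2)[OF z] by (rule refl)
  show "has_weak_derivative_on (chart_image c) (f \<circ> chart_inv c)
      (\<lambda>z w. dreal X f (chart_inv c z, tvec_of X c (chart_inv c z) w))"
  proof (rule has_weak_derivative_on_cong[THEN iffD2])
    show "has_weak_derivative_on (chart_image c) (f \<circ> chart_inv c) (\<lambda>z. frechet_derivative (f \<circ> chart_inv c) (at z))"
      by (rule Ck1_has_weak_derivative_on[OF open_image[OF c] C])
  qed (rule eq)
qed

lemma Ck1_vec:
  fixes f :: "'a::euclidean_space \<Rightarrow> 'b::euclidean_space ^ 'n"
  assumes "\<And>i. Ck 1 S (\<lambda>z. f z $ i)" shows "Ck 1 S f"
proof (rule Ck1_componentwise)
  fix b :: "'b ^ 'n" assume "b \<in> Basis"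
  then obtain i u where "b = axis i u" by (auto simp: Basis_vec_def)
  then show "Ck 1 S (\<lambda>z. f z \<bullet> b)"
    using Ck1_linear_compose[OF bounded_linear_inner_left assms[of i], of u] by (simp add: inner_axis)
qed

definition hom_atlas ::
  "('p, real^'m::finite) atlas \<Rightarrow> ('q, real^'n::finite) atlas \<Rightarrow>
   (('p, real^'m, 'q, real^'n) hom_point, ('m, 'n) hom_model) atlas" where
  "hom_atlas M N = {hom_chart M N c d | c d. c \<in> M \<and> d \<in> N}"

lemma hom_bundle_simps [simp]:
  "bundle_total (hom_bundle M N) = hom_atlas M N" "bundle_base (hom_bundle M N) = prod_atlas M N"
  "proj (hom_bundle M N) = fst"
  "vadd (hom_bundle M N) (b, L) (b', L') = (b, \<lambda>v. tvec_add (L v) (L' v))"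
  "vscale (hom_bundle M N) r (b, L) = (b, \<lambda>v. tvec_scale r (L v))"
  by (simp_all add: hom_bundle_def hom_atlas_def)

definition hom_mat ::
  "('p, real^'m::finite) atlas \<Rightarrow> ('p, real^'m) chart \<Rightarrow> ('q, real^'n::finite) chart \<Rightarrow> 'p \<Rightarrow>
    (('p, real^'m) tvec \<Rightarrow> ('q, real^'n) tvec) \<Rightarrow> real^'m^'n" where
  "hom_mat M c d x L = matrix (\<lambda>w. L (tvec_of M c x w) d)"

text \<open>The inverse of the fibre coordinate \<open>hom_mat\<close>. It shows that bundle charts
  are onto in the fibre direction and turns fibre components of tangent vectors back into linear
  maps.\<close>

definition hom_of ::
  "('p, real^'m::finite) atlas \<Rightarrow> ('q, real^'n::finite) atlas \<Rightarrow> ('p, real^'m) chart \<Rightarrow> ('q, real^'n) chart \<Rightarrow>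
    'p \<Rightarrow> 'q \<Rightarrow> real^'m^'n \<Rightarrow> ('p, real^'m) tvec \<Rightarrow> ('q, real^'n) tvec" where
  "hom_of M N c d x y A v = (if v \<in> tangent_space M x then tvec_of N d y (A *v v c) else tvec_zero)"

lemma hom_chart_dom:
  "((x, y), L) \<in> fst (hom_chart M N c d) \<longleftrightarrow> x \<in> fst c \<and> y \<in> fst d \<and> L \<in> hom_space M N x y"
  by (simp add: hom_chart_def)

lemma hom_chart_map: "snd (hom_chart M N c d) ((x, y), L) = ((snd c x, snd d y), hom_mat M c d x L)"
  by (simp add: hom_chart_def hom_mat_def)

lemma hom_spaceD:
  assumes "L \<in> hom_space M N x y"
  shows "v \<in> tangent_space M x \<Longrightarrow> L v \<in> tangent_space N y"
    and "v \<in> tangent_space M x \<Longrightarrow> w \<in> tangent_space M x \<Longrightarrow> L (tvec_add v w) = tvec_add (L v) (L w)"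
    and "v \<in> tangent_space M x \<Longrightarrow> L (tvec_scale r v) = tvec_scale r (L v)"
    and "v \<notin> tangent_space M x \<Longrightarrow> L v = tvec_zero"
  using assms unfolding hom_space_def by blast+

section \<open>The bundle as a C1 manifold\<close>

locale hom_manifold =
  fixes M :: "('p, real^'m::finite) atlas" and N :: "('q, real^'n::finite) atlas"
  assumes M2: "manifold 2 M" and N2: "manifold 2 N"
begin

sublocale M: C1_manifold M by (rule manifold_C1[OF M2])
sublocale N: C1_manifold N by (rule manifold_C1[OF N2])

abbreviation "H \<equiv> hom_atlas M N"

lemma transition_M2: "c \<in> M \<Longrightarrow> d \<in> M \<Longrightarrow> Ck 2 (snd c ` (fst c \<inter> fst d)) (snd d \<circ> chart_inv c)"
  and transition_N2: "c' \<in> N \<Longrightarrow> d' \<in> N \<Longrightarrow> Ck 2 (snd c' ` (fst c' \<inter> fst d')) (snd d' \<circ> chart_inv c')"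
  using M2 N2 by (auto simp: manifold_def)

lemma linear_hom_coord:
  assumes "L \<in> hom_space M N x y" "c \<in> M" "x \<in> fst c"
  shows "linear (\<lambda>w. L (tvec_of M c x w) d)"
  using hom_spaceD[OF assms(1)] M.tvec_of_in[OF assms(2,3)]
  by (intro linearI) (simp_all add: M.tvec_of_add[OF assms(2,3)] M.tvec_of_scale[OF assms(2,3)]
      tvec_add_def[of "L _"] tvec_scale_def[of _ "L _"])

lemma hom_mat_vector:
  assumes "L \<in> hom_space M N x y" "c \<in> M" "x \<in> fst c" "v \<in> tangent_space M x"
  shows "hom_mat M c d x L *v v c = L v d"
  using fun_cong[OF matrix_vector_mul(2)[OF linear_hom_coord[OF assms(1-3)]], of d "v c"] M.tvec_of_eq[OF assms(4,2,3)]
  by (simp add: hom_mat_def)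

lemma hom_of_in:
  assumes c: "c \<in> M" "x \<in> fst c" and d: "d \<in> N" "y \<in> fst d"
  shows "hom_of M N c d x y A \<in> hom_space M N x y"
proof -
  have "A *v tvec_add v w c = A *v v c + A *v w c" "A *v tvec_scale r v c = r *\<^sub>R (A *v v c)" for v w r
    by (simp_all add: tvec_add_def tvec_scale_def matrix_vector_right_distrib matrix_vector_mult_scaleR)
  then show ?thesis
    unfolding hom_space_def hom_of_def
    using N.tvec_of_in[OF d] M.tangent_add M.tangent_scale
    by (auto simp: N.tvec_of_add[OF d] N.tvec_of_scale[OF d])
qed

lemma hom_mat_hom_of:
  assumes c: "c \<in> M" "x \<in> fst c" and d: "d \<in> N" "y \<in> fst d"
  shows "hom_mat M c d x (hom_of M N c d x y A) = A"
proof -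
  have "(\<lambda>w. hom_of M N c d x y A (tvec_of M c x w) d) = (\<lambda>w. A *v w)"
    using M.tvec_of_in[OF c] M.tvec_of_chart[OF c] N.tvec_of_chart[OF d] by (simp add: hom_of_def)
  then show ?thesis by (simp add: hom_mat_def matrix_of_matrix_vector_mul)
qed

lemma hom_ext:
  assumes L: "L \<in> hom_space M N x y" and L': "L' \<in> hom_space M N x y"
    and c: "c \<in> M" "x \<in> fst c" and d: "d \<in> N" "y \<in> fst d"
    and eq: "hom_mat M c d x L = hom_mat M c d x L'"
  shows "L = L'"
proof
  fix v show "L v = L' v"
  proof (cases "v \<in> tangent_space M x")
    case True
    have "L v d = L' v d"
      using hom_mat_vector[OF L c True, of d] hom_mat_vector[OF L' c True, of d] eq by simp
    then show ?thesis
      by (rule N.tangent_ext[OF hom_spaceD(1)[OF L True] hom_spaceD(1)[OF L' True] d])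
  next
    case False then show ?thesis using hom_spaceD(4)[OF L] hom_spaceD(4)[OF L'] by simp
  qed
qed

lemma H_chartE:
  assumes "\<chi>' \<in> H" obtains c d where "c \<in> M" "d \<in> N" "\<chi>' = hom_chart M N c d"
  using assms unfolding hom_atlas_def by blast

lemma hom_chart_in: "c \<in> M \<Longrightarrow> d \<in> N \<Longrightarrow> hom_chart M N c d \<in> H"
  unfolding hom_atlas_def by blast

lemma points_H_iff: "((x, y), L) \<in> points H \<longleftrightarrow> x \<in> points M \<and> y \<in> points N \<and> L \<in> hom_space M N x y"
proof
  assume "((x, y), L) \<in> points H"
  then obtain h where "h \<in> H" "((x, y), L) \<in> fst h" unfolding points_def by blast
  then show "x \<in> points M \<and> y \<in> points N \<and> L \<in> hom_space M N x y"
    unfolding points_def by (elim H_chartE) (auto simp: hom_chart_dom)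
next
  assume *: "x \<in> points M \<and> y \<in> points N \<and> L \<in> hom_space M N x y"
  then obtain c d where "c \<in> M" "x \<in> fst c" "d \<in> N" "y \<in> fst d" unfolding points_def by blast
  then have "hom_chart M N c d \<in> H" "((x, y), L) \<in> fst (hom_chart M N c d)"
    using * by (simp_all add: hom_chart_in hom_chart_dom)
  then show "((x, y), L) \<in> points H" unfolding points_def by blast
qed

lemma points_H: "points H = {((x, y), L). x \<in> points M \<and> y \<in> points N \<and> L \<in> hom_space M N x y}"
  using points_H_iff by auto

lemma inj_hom_chart: 
  assumes "c \<in> M" "d \<in> N" shows "inj_on (snd (hom_chart M N c d)) (fst (hom_chart M N c d))"
proof (rule inj_onI, clarsimp simp: hom_chart_dom hom_chart_map)
  fix x y L x' y' L'
  assume *: "x \<in> fst c" "y \<in> fst d" "L \<in> hom_space M N x y" "x' \<in> fst c" "y' \<in> fst d" "L' \<in> hom_space M N x' y'"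
    and eq: "snd c x = snd c x'" "snd d y = snd d y'" "hom_mat M c d x L = hom_mat M c d x' L'"
  have "x = x'" "y = y'" using * eq M.inj[OF assms(1)] N.inj[OF assms(2)] by (auto dest: inj_onD)
  then show "x = x' \<and> y = y' \<and> L = L'"
    using hom_ext[of L x y L' c d] * eq assms by auto
qed

lemma hom_chart_image_restrict:
  assumes c: "c \<in> M" and d: "d \<in> N" and "A \<subseteq> fst c" "B \<subseteq> fst d"
  shows "snd (hom_chart M N c d) ` {((x, y), L). x \<in> A \<and> y \<in> B \<and> L \<in> hom_space M N x y} = (snd c ` A \<times> snd d ` B) \<times> UNIV"
proof (rule antisym)
  show "(snd c ` A \<times> snd d ` B) \<times> UNIV \<subseteq> snd (hom_chart M N c d) ` {((x, y), L). x \<in> A \<and> y \<in> B \<and> L \<in> hom_space M N x y}"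
  proof clarify
    fix x y T assume xy: "x \<in> A" "y \<in> B"
    then have *: "x \<in> fst c" "y \<in> fst d" using assms by auto
    show "((snd c x, snd d y), T) \<in> snd (hom_chart M N c d) ` {((x, y), L). x \<in> A \<and> y \<in> B \<and> L \<in> hom_space M N x y}"
      by (rule image_eqI[of _ _ "((x, y), hom_of M N c d x y T)"])
        (use * xy hom_of_in[OF c *(1) d *(2)] hom_mat_hom_of[OF c *(1) d *(2)] in \<open>auto simp: hom_chart_map\<close>)
  qed
qed (auto simp: hom_chart_map)

lemma hom_chart_image:
  assumes c: "c \<in> M" and d: "d \<in> N"
  shows "chart_image (hom_chart M N c d) = (chart_image c \<times> chart_image d) \<times> UNIV"
proof -
  have "fst (hom_chart M N c d) = {((x, y), L). x \<in> fst c \<and> y \<in> fst d \<and> L \<in> hom_space M N x y}"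
    by (simp add: hom_chart_def)
  then show ?thesis
    unfolding chart_image_def using hom_chart_image_restrict[OF c d subset_refl subset_refl] by simp
qed

lemma hom_chart_overlap:
  assumes "c \<in> M" "d \<in> N"
  shows "snd (hom_chart M N c d) ` (fst (hom_chart M N c d) \<inter> fst (hom_chart M N c' d')) =
    (snd c ` (fst c \<inter> fst c') \<times> snd d ` (fst d \<inter> fst d')) \<times> UNIV"
proof -
  have "fst (hom_chart M N c d) \<inter> fst (hom_chart M N c' d') =
    {((x, y), L). x \<in> fst c \<inter> fst c' \<and> y \<in> fst d \<inter> fst d' \<and> L \<in> hom_space M N x y}"
    by (auto simp: hom_chart_def)
  then show ?thesis using hom_chart_image_restrict[OF assms, of "fst c \<inter> fst c'" "fst d \<inter> fst d'"] by simp
qed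

text \<open>The old matrix is multiplied on the left by the derivative of the chart change of
  \<open>N\<close> and on the right by that of the inverse chart change of \<open>M\<close>. The
  entries are spelled out so that C1 regularity follows from that of finite sums and
  products.\<close>

lemma hom_mat_change:
  assumes c: "c \<in> M" "x \<in> fst c" and c': "c' \<in> M" "x \<in> fst c'" and d: "d \<in> N" "y \<in> fst d" and d': "d' \<in> N" "y \<in> fst d'"
    and L: "L \<in> hom_space M N x y"
  shows "hom_mat M c' d' x L $ i $ j =
    (\<Sum>k\<in>UNIV. (\<Sum>l\<in>UNIV. hom_mat M c d x L $ k $ l * M.trans_deriv c' c x (axis j 1) $ l) *
        N.trans_deriv d d' y (axis k 1) $ i)"
proof -
  let ?v = "tvec_of M c' x (axis j 1)"
  have v: "?v \<in> tangent_space M x" by (rule M.tvec_of_in[OF c'])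
  have vc: "?v c = M.trans_deriv c' c x (axis j 1)" using c by (simp add: tvec_of_def)
  let ?u = "hom_mat M c d x L *v ?v c"
  have lin: "linear (N.trans_deriv d d' y)" by (rule N.linear_trans_deriv[OF d(1) d'(1) d(2) d'(2)])
  have "hom_mat M c' d' x L $ i $ j = L ?v d' $ i" by (simp add: hom_mat_def matrix_def)
  also have "L ?v d' = N.trans_deriv d d' y ?u"
    using N.tangentD[OF hom_spaceD(1)[OF L v] d(1) d'(1) d(2) d'(2)] hom_mat_vector[OF L c v] by simp
  also have "?u = (\<Sum>k\<in>UNIV. ?u $ k *\<^sub>R axis k 1)" by (simp add: vec_eq_iff axis_def if_distrib cong: if_cong)
  also have "N.trans_deriv d d' y \<dots> = (\<Sum>k\<in>UNIV. ?u $ k *\<^sub>R N.trans_deriv d d' y (axis k 1))"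
    by (simp add: linear_sum[OF lin] linear_scale[OF lin])
  finally show ?thesis by (simp add: matrix_vector_mult_def vc)
qed

text \<open>The matrix entries contain first derivatives of chart changes of \<open>M\<close> and
  \<open>N\<close>, so one order of differentiability is lost: class C2 of the factors gives class
  C1 of the bundle.\<close>

lemma hom_transition:
  assumes c: "c \<in> M" and d: "d \<in> N" and c': "c' \<in> M" and d': "d' \<in> N"
  shows "Ck 1 (snd (hom_chart M N c d) ` (fst (hom_chart M N c d) \<inter> fst (hom_chart M N c' d')))
    (snd (hom_chart M N c' d') \<circ> chart_inv (hom_chart M N c d))"
proof -
  let ?P = "snd c ` (fst c \<inter> fst c')" and ?Q = "snd d ` (fst d \<inter> fst d')"
  let ?S = "(?P \<times> ?Q) \<times> (UNIV :: (real^'m^'n) set)"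
  let ?\<phi> = "snd c' \<circ> chart_inv c" and ?\<psi> = "snd d' \<circ> chart_inv d" and ?\<phi>' = "snd c \<circ> chart_inv c'"
  \<comment> \<open>Vectors are brought from the new chart back to the old one, so the inverse
    change \<open>?\<phi>'\<close> is differentiated at the image point
    \<open>?\<phi> (fst (fst z))\<close>.\<close>
  let ?e = "\<lambda>z i j. (\<Sum>k\<in>UNIV. (\<Sum>l\<in>UNIV. snd z $ k $ l * frechet_derivative ?\<phi>' (at (?\<phi> (fst (fst z)))) (axis j 1) $ l) *
        frechet_derivative ?\<psi> (at (snd (fst z))) (axis k 1) $ i)"
  let ?g = "\<lambda>z. ((?\<phi> (fst (fst z)), ?\<psi> (snd (fst z))), \<chi> i j. ?e z i j)"
  have oS: "open ?S" using M.open_overlap[OF c c'] N.open_overlap[OF d d'] by (intro open_Times) auto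
  have ff: "Ck 1 ?S (\<lambda>z. fst (fst z))" and sf: "Ck 1 ?S (\<lambda>z. snd (fst z))"
    by (intro Ck1_bounded_linear bounded_linear_fst_comp bounded_linear_snd_comp bounded_linear_fst)+
  have A: "Ck 1 ?S (\<lambda>z. snd z $ k $ l)" for k l
    by (intro Ck1_bounded_linear bounded_linear_compose[OF bounded_linear_vec_nth] bounded_linear_compose[OF bounded_linear_vec_nth]
        bounded_linear_snd)
  have sub1: "(\<lambda>z. fst (fst z)) ` ?S \<subseteq> ?P" and sub': "(\<lambda>z. snd (fst z)) ` ?S \<subseteq> ?Q" by auto
  have \<phi>: "Ck 1 ?S (\<lambda>z. ?\<phi> (fst (fst z)))"
    using Ck1_compose[OF ff M.transition[OF c c'] sub1] by (simp only: o_def)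
  have \<psi>: "Ck 1 ?S (\<lambda>z. ?\<psi> (snd (fst z)))"
    using Ck1_compose[OF sf N.transition[OF d d'] sub'] by (simp only: o_def)
  have sub: "(\<lambda>z. ?\<phi> (fst (fst z))) ` ?S \<subseteq> snd c' ` (fst c' \<inter> fst c)"
    using M.chart_inv_eq[OF c] by auto
  have D\<phi>: "Ck 1 ?S (\<lambda>z. frechet_derivative ?\<phi>' (at (?\<phi> (fst (fst z)))) w)" for w
    using Ck1_compose[OF \<phi> Ck2_derivative[OF transition_M2[OF c' c]] sub] by (simp only: o_def)
  have D\<psi>: "Ck 1 ?S (\<lambda>z. frechet_derivative ?\<psi> (at (snd (fst z))) w)" for w
    using Ck1_compose[OF sf Ck2_derivative[OF transition_N2[OF d d']] sub'] by (simp only: o_def)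
  have e: "Ck 1 ?S (\<lambda>z. ?e z i j)" for i j
    by (intro Ck1_sum Ck1_mult A Ck1_linear_compose[OF bounded_linear_vec_nth D\<phi>] Ck1_linear_compose[OF bounded_linear_vec_nth D\<psi>])
  have "Ck 1 ?S (\<lambda>z. \<chi> i j. ?e z i j)"
    by (rule Ck1_vec, rule Ck1_vec) (use e in simp)
  then have g: "Ck 1 ?S ?g" by (intro Ck1_Pair \<phi> \<psi>)
  have "?g z = (snd (hom_chart M N c' d') \<circ> chart_inv (hom_chart M N c d)) z" if z: "z \<in> ?S" for z
  proof -
    have "z \<in> snd (hom_chart M N c d) ` {((x, y), L). x \<in> fst c \<inter> fst c' \<and> y \<in> fst d \<inter> fst d' \<and> L \<in> hom_space M N x y}"
      using z hom_chart_image_restrict[OF c d, of "fst c \<inter> fst c'" "fst d \<inter> fst d'"] by simp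
    then obtain x y L where x: "x \<in> fst c" "x \<in> fst c'" and y: "y \<in> fst d" "y \<in> fst d'" and L: "L \<in> hom_space M N x y"
      and zz: "z = snd (hom_chart M N c d) ((x, y), L)" by auto
    have inv: "chart_inv (hom_chart M N c d) z = ((x, y), L)"
      unfolding chart_inv_def zz using x y L by (intro inv_into_f_f inj_hom_chart c d) (simp add: hom_chart_dom)
    have "hom_mat M c' d' x L = (\<chi> i j. ?e z i j)"
      using hom_mat_change[OF c x(1) c' x(2) d y(1) d' y(2) L] M.chart_inv_eq[OF c x(1)]
      by (simp add: vec_eq_iff zz hom_chart_map)
    then show ?thesis
      using inv M.chart_inv_eq[OF c x(1)] N.chart_inv_eq[OF d y(1)] by (simp add: zz hom_chart_map)
  qed
  then show ?thesis unfolding hom_chart_overlap[OF c d] by (rule Ck1_cong_open[OF oS _ g])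
qed

sublocale H: C1_charts H
proof
  fix \<chi>1 \<chi>2 assume "\<chi>1 \<in> H" "\<chi>2 \<in> H"
  then obtain c d c' d' where c: "c \<in> M" "d \<in> N" "\<chi>1 = hom_chart M N c d" and c': "c' \<in> M" "d' \<in> N" "\<chi>2 = hom_chart M N c' d'"
    by (metis H_chartE)
  show "inj_on (snd \<chi>1) (fst \<chi>1)" using inj_hom_chart c by simp
  show "open (chart_image \<chi>1)"
    using M.open_image[OF c(1)] N.open_image[OF c(2)] by (simp add: c hom_chart_image open_Times)
  show "open (snd \<chi>1 ` (fst \<chi>1 \<inter> fst \<chi>2))"
    using M.open_overlap[OF c(1) c'(1)] N.open_overlap[OF c(2) c'(2)] by (simp add: c c' hom_chart_overlap open_Times)
  show "Ck 1 (snd \<chi>1 ` (fst \<chi>1 \<inter> fst \<chi>2)) (snd \<chi>2 \<circ> chart_inv \<chi>1)"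
    unfolding c c' by (rule hom_transition[OF c(1,2) c'(1,2)])
qed

lemma openin_H_base:
  assumes "openin (mtop M) V" "openin (mtop N) W"
  shows "openin (mtop H) {((x, y), L). x \<in> V \<and> y \<in> W \<and> L \<in> hom_space M N x y}" (is "openin _ ?O")
  unfolding H.openin_iff
proof (intro conjI ballI)
  have "V \<subseteq> points M" "W \<subseteq> points N" using assms M.openin_iff N.openin_iff by blast+
  then show "?O \<subseteq> points H" by (auto simp: points_H)
  fix \<chi>' assume "\<chi>' \<in> H"
  then obtain c d where c: "c \<in> M" "d \<in> N" "\<chi>' = hom_chart M N c d" by (rule H_chartE)
  have "?O \<inter> fst \<chi>' = {((x, y), L). x \<in> V \<inter> fst c \<and> y \<in> W \<inter> fst d \<and> L \<in> hom_space M N x y}"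
    by (auto simp: c hom_chart_def)
  then have "snd \<chi>' ` (?O \<inter> fst \<chi>') = (snd c ` (V \<inter> fst c) \<times> snd d ` (W \<inter> fst d)) \<times> UNIV"
    using hom_chart_image_restrict[OF c(1,2), of "V \<inter> fst c" "W \<inter> fst d"] c(3) by simp
  then show "open (snd \<chi>' ` (?O \<inter> fst \<chi>'))"
    using M.open_chart_image[OF assms(1) c(1)] N.open_chart_image[OF assms(2) c(2)] by (simp add: open_Times)
qed

text \<open>Points over different base points are separated by open sets of one of the factors
  (\<open>openin_H_base\<close>), points of the same fibre by a common chart. Pairs of charts from
  countable subatlases of \<open>M\<close> and \<open>N\<close> form the countable subatlas.\<close>

sublocale H: C1_manifold H
proof unfold_locales
  show "Hausdorff_space (mtop H)"
    unfolding Hausdorff_space_def H.topspace_mtop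
  proof (intro allI impI)
    fix p p' assume pp: "p \<in> points H \<and> p' \<in> points H \<and> p \<noteq> p'"
    obtain x y L x' y' L' where p: "p = ((x, y), L)" and p': "p' = ((x', y'), L')"
      by (metis surj_pair)
    have *: "x \<in> points M" "y \<in> points N" "L \<in> hom_space M N x y" "x' \<in> points M" "y' \<in> points N" "L' \<in> hom_space M N x' y'"
      using pp by (auto simp: p p' points_H)
    have oM: "openin (mtop M) (points M)" and oN: "openin (mtop N) (points N)"
      using openin_topspace[of "mtop M"] openin_topspace[of "mtop N"] by (simp_all add: M.topspace_mtop N.topspace_mtop)
    consider "x \<noteq> x'" | "y \<noteq> y'" | "x = x'" "y = y'" by blast
    then show "\<exists>O1 O2. openin (mtop H) O1 \<and> openin (mtop H) O2 \<and> p \<in> O1 \<and> p' \<in> O2 \<and> disjnt O1 O2"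
    proof cases
      case 1
      with M.Hausdorff *(1,4) obtain V V' where V: "openin (mtop M) V" "openin (mtop M) V'" "x \<in> V" "x' \<in> V'" "disjnt V V'"
        unfolding Hausdorff_space_def M.topspace_mtop by metis
      show ?thesis
        by (rule exI, rule exI, intro conjI, rule openin_H_base[OF V(1) oN], rule openin_H_base[OF V(2) oN])
          (use V * in \<open>auto simp: p p' disjnt_iff\<close>)
    next
      case 2
      with N.Hausdorff *(2,5) obtain V V' where V: "openin (mtop N) V" "openin (mtop N) V'" "y \<in> V" "y' \<in> V'" "disjnt V V'"
        unfolding Hausdorff_space_def N.topspace_mtop by metis
      show ?thesis
        by (rule exI, rule exI, intro conjI, rule openin_H_base[OF oM V(1)], rule openin_H_base[OF oM V(2)])
          (use V * in \<open>auto simp: p p' disjnt_iff\<close>)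
    next
      case 3
      obtain c d where c: "c \<in> M" "x \<in> fst c" and d: "d \<in> N" "y \<in> fst d"
        using * unfolding points_def by blast
      let ?h = "hom_chart M N c d"
      have h: "?h \<in> H" and dom: "p \<in> fst ?h" "p' \<in> fst ?h"
        using c d * 3 by (auto simp: hom_chart_in p p' hom_chart_dom)
      then have "snd ?h p \<noteq> snd ?h p'" using pp H.inj[OF h] by (auto dest: inj_onD)
      then obtain V V' where V: "open V" "open V'" "snd ?h p \<in> V" "snd ?h p' \<in> V'" "V \<inter> V' = {}"
        using hausdorff by metis
      show ?thesis
        by (rule exI, rule exI, intro conjI, rule H.openin_chart_vimage[OF h V(1)], rule H.openin_chart_vimage[OF h V(2)])
          (use V dom in \<open>auto simp: disjnt_iff\<close>)
    qed
  qed
  obtain M0 N0 where M0: "M0 \<subseteq> M" "countable M0" "points M0 = points M" and N0: "N0 \<subseteq> N" "countable N0" "points N0 = points N"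
    using M.countable_subatlas N.countable_subatlas by blast
  let ?H0 = "(\<lambda>(c, d). hom_chart M N c d) ` (M0 \<times> N0)"
  have "?H0 \<subseteq> H" using M0 N0 by (auto simp: hom_chart_in subset_iff)
  moreover have "countable ?H0" using M0 N0 by (intro countable_image countable_SIGMA) auto
  moreover have "points ?H0 \<subseteq> points H" unfolding points_def by (rule UN_mono[OF calculation(1)]) simp
  moreover have "points H \<subseteq> points ?H0"
  proof
    fix p assume "p \<in> points H"
    then obtain x y L where p: "p = ((x, y), L)" "x \<in> points M0" "y \<in> points N0" "L \<in> hom_space M N x y"
      by (auto simp: points_H M0 N0)
    then obtain c d where cd: "c \<in> M0" "x \<in> fst c" "d \<in> N0" "y \<in> fst d" unfolding points_def by blast
    then have "hom_chart M N c d \<in> ?H0" "p \<in> fst (hom_chart M N c d)"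
      using p by (auto simp: hom_chart_dom intro: image_eqI[of _ _ "(c, d)"])
    then show "p \<in> points ?H0" unfolding points_def by blast
  qed
  ultimately show "\<exists>X0\<subseteq>H. countable X0 \<and> points X0 = points H"
    by (intro exI[of _ ?H0]) blast
qed

end

section \<open>Base components of tangent vectors and vertical lifts\<close>

context hom_manifold
begin

text \<open>Bundle charts lie over product charts, so the base part of a chart change depends on the
  base coordinates alone. Computing its derivative in two ways and using uniqueness of derivatives
  gives the formula.\<close>

lemma trans_base:
  assumes c: "c \<in> M" "x \<in> fst c" and c': "c' \<in> M" "x \<in> fst c'" and d: "d \<in> N" "y \<in> fst d" and d': "d' \<in> N" "y \<in> fst d'"
    and L: "L \<in> hom_space M N x y"
  shows "fst (H.trans_deriv (hom_chart M N c d) (hom_chart M N c' d') ((x, y), L) W) =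
    (M.trans_deriv c c' x (fst (fst W)), N.trans_deriv d d' y (snd (fst W)))"
proof -
  let ?h = "hom_chart M N c d" and ?h' = "hom_chart M N c' d'" and ?e = "((x, y), L)"
  let ?t = "snd ?h' \<circ> chart_inv ?h" and ?z = "snd ?h ?e"
  have h: "?h \<in> H" "?h' \<in> H" "?e \<in> fst ?h" "?e \<in> fst ?h'"
    using c c' d d' L by (simp_all add: hom_chart_in hom_chart_dom)
  have 1: "((\<lambda>z. fst (?t z)) has_derivative (\<lambda>W. fst (H.trans_deriv ?h ?h' ?e W))) (at ?z)"
    by (rule has_derivative_fst[OF H.trans_has_derivative[OF h]])
  have z: "?z = ((snd c x, snd d y), hom_mat M c d x L)" by (rule hom_chart_map)
  have "((snd c' \<circ> chart_inv c) has_derivative M.trans_deriv c c' x) (at ((\<lambda>z. fst (fst z)) ?z))"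
    using M.trans_has_derivative[OF c(1) c'(1) c(2) c'(2)] by (simp add: z)
  from diff_chain_at[OF bounded_linear_imp_has_derivative[OF bounded_linear_fst_comp[OF bounded_linear_fst]] this]
  have a: "((\<lambda>z. (snd c' \<circ> chart_inv c) (fst (fst z))) has_derivative (\<lambda>W. M.trans_deriv c c' x (fst (fst W)))) (at ?z)"
    by (simp add: o_def)
  have "((snd d' \<circ> chart_inv d) has_derivative N.trans_deriv d d' y) (at ((\<lambda>z. snd (fst z)) ?z))"
    using N.trans_has_derivative[OF d(1) d'(1) d(2) d'(2)] by (simp add: z)
  from diff_chain_at[OF bounded_linear_imp_has_derivative[OF bounded_linear_snd_comp[OF bounded_linear_fst]] this]
  have b: "((\<lambda>z. (snd d' \<circ> chart_inv d) (snd (fst z))) has_derivative (\<lambda>W. N.trans_deriv d d' y (snd (fst W)))) (at ?z)"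
    by (simp add: o_def)
  have 2: "((\<lambda>z. fst (?t z)) has_derivative (\<lambda>W. (M.trans_deriv c c' x (fst (fst W)), N.trans_deriv d d' y (snd (fst W))))) (at ?z)"
  proof (rule has_derivative_transform_within_open[OF has_derivative_Pair[OF a b] H.open_overlap[OF h(1,2)]])
    show "?z \<in> snd ?h ` (fst ?h \<inter> fst ?h')" using h by blast
    fix z assume "z \<in> snd ?h ` (fst ?h \<inter> fst ?h')"
    then obtain p where p: "p \<in> fst ?h" "p \<in> fst ?h'" "z = snd ?h p" by blast
    obtain x' y' L' where pe: "p = ((x', y'), L')" by (metis surj_pair)
    have "?t z = snd ?h' p" using H.chart_inv_eq[OF h(1) p(1)] p(3) by simp
    then show "((snd c' \<circ> chart_inv c) (fst (fst z)), (snd d' \<circ> chart_inv d) (snd (fst z))) = fst (?t z)"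
      using p M.chart_inv_eq[OF c(1)] N.chart_inv_eq[OF d(1)] by (simp add: pe hom_chart_map hom_chart_dom)
  qed
  from fun_cong[OF has_derivative_unique[OF 1 2], of W] show ?thesis .
qed

lemma tangent_base_change:
  assumes c: "c \<in> M" "x \<in> fst c" and c': "c' \<in> M" "x \<in> fst c'" and d: "d \<in> N" "y \<in> fst d" and d': "d' \<in> N" "y \<in> fst d'"
    and L: "L \<in> hom_space M N x y" and W: "W \<in> tangent_space H ((x, y), L)"
    and v: "v \<in> tangent_space M x" and w: "w \<in> tangent_space N y"
    and eq: "fst (W (hom_chart M N c d)) = (v c, w d)"
  shows "fst (W (hom_chart M N c' d')) = (v c', w d')"
proof -
  have "W (hom_chart M N c' d') = H.trans_deriv (hom_chart M N c d) (hom_chart M N c' d') ((x, y), L) (W (hom_chart M N c d))"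
    by (rule H.tangentD[OF W]) (use c c' d d' L in \<open>simp_all add: hom_chart_in hom_chart_dom\<close>)
  then show ?thesis
    using trans_base[OF c c' d d' L] eq M.tangentD[OF v c(1) c'(1) c(2) c'(2)] N.tangentD[OF w d(1) d'(1) d(2) d'(2)]
    by simp
qed

lemma prod_chart_mem: "(x, y) \<in> fst (prod_chart c d) \<longleftrightarrow> x \<in> fst c \<and> y \<in> fst d"
  by (simp add: prod_chart_def)

text \<open>\<open>tvec_pair\<close> is defined through the chosen charts at \<open>x\<close> and
  \<open>y\<close>. Chart changes of the product are products of chart changes, so every pair of
  charts gives coordinates of the same form.\<close>

lemma tvec_pair_chart:
  assumes v: "v \<in> tangent_space M x" and w: "w \<in> tangent_space N y"
    and c: "c \<in> M" "x \<in> fst c" and d: "d \<in> N" "y \<in> fst d"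
  shows "snd (tvec_pair M N (x, v) (y, w)) (prod_chart c d) = (v c, w d)"
proof -
  let ?c = "chart_at M x" and ?d = "chart_at N y"
  have c0: "?c \<in> M" "x \<in> fst ?c" using chart_at_mem[of x M] c unfolding points_def by blast+
  have d0: "?d \<in> N" "y \<in> fst ?d" using chart_at_mem[of y N] d unfolding points_def by blast+
  let ?b = "prod_chart c d" and ?bz = "prod_chart ?c ?d"
  let ?P = "snd ?c ` (fst ?c \<inter> fst c)" and ?Q = "snd ?d ` (fst ?d \<inter> fst d)"
  have oS: "open (?P \<times> ?Q)" by (intro open_Times M.open_overlap N.open_overlap c d c0 d0)
  have "((snd c \<circ> chart_inv ?c) has_derivative M.trans_deriv ?c c x) (at (fst (snd ?c x, snd ?d y)))"
    using M.trans_has_derivative[OF c0(1) c(1) c0(2) c(2)] by simp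
  from diff_chain_at[OF bounded_linear_imp_has_derivative[OF bounded_linear_fst] this]
  have 1: "((\<lambda>z. (snd c \<circ> chart_inv ?c) (fst z)) has_derivative (\<lambda>W. M.trans_deriv ?c c x (fst W))) (at (snd ?c x, snd ?d y))"
    by (simp add: o_def)
  have "((snd d \<circ> chart_inv ?d) has_derivative N.trans_deriv ?d d y) (at (snd (snd ?c x, snd ?d y)))"
    using N.trans_has_derivative[OF d0(1) d(1) d0(2) d(2)] by simp
  from diff_chain_at[OF bounded_linear_imp_has_derivative[OF bounded_linear_snd] this]
  have 2: "((\<lambda>z. (snd d \<circ> chart_inv ?d) (snd z)) has_derivative (\<lambda>W. N.trans_deriv ?d d y (snd W))) (at (snd ?c x, snd ?d y))"
    by (simp add: o_def)
  have "((snd ?b \<circ> chart_inv ?bz) has_derivative (\<lambda>W. (M.trans_deriv ?c c x (fst W), N.trans_deriv ?d d y (snd W)))) (at (snd ?c x, snd ?d y))"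
  proof (rule has_derivative_transform_within_open[OF has_derivative_Pair[OF 1 2] oS])
    show "(snd ?c x, snd ?d y) \<in> ?P \<times> ?Q" using c d c0 d0 by blast
    fix z assume "z \<in> ?P \<times> ?Q"
    then obtain x' y' where *: "x' \<in> fst ?c" "x' \<in> fst c" "y' \<in> fst ?d" "y' \<in> fst d" and z: "z = (snd ?c x', snd ?d y')" by blast
    have inj: "inj_on (snd ?bz) (fst ?bz)"
      using M.inj[OF c0(1)] N.inj[OF d0(1)] by (auto simp: prod_chart_def inj_on_def)
    have "snd ?bz (x', y') = z" "snd ?b (x', y') = (snd c x', snd d y')" by (simp_all add: z prod_chart_def)
    moreover have "chart_inv ?bz (snd ?bz (x', y')) = (x', y')"
      unfolding chart_inv_def using * by (intro inv_into_f_f inj) (simp add: prod_chart_mem)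
    ultimately have "(snd ?b \<circ> chart_inv ?bz) z = (snd c x', snd d y')" by simp
    then show "((snd c \<circ> chart_inv ?c) (fst z), (snd d \<circ> chart_inv ?d) (snd z)) = (snd ?b \<circ> chart_inv ?bz) z"
      using M.chart_inv_eq[OF c0(1) *(1)] N.chart_inv_eq[OF d0(1) *(3)] by (simp add: z)
  qed
  from fun_cong[OF frechet_derivative_at[OF this], of "(v ?c, w ?d)"]
  have "frechet_derivative (snd ?b \<circ> chart_inv ?bz) (at (snd ?c x, snd ?d y)) (v ?c, w ?d) = (v c, w d)"
    using M.tangentD[OF v c0(1) c(1) c0(2) c(2)] N.tangentD[OF w d0(1) d(1) d0(2) d(2)] by simp
  moreover have "?b \<in> prod_atlas M N" using c d unfolding prod_atlas_def by blast
  moreover have "snd ?bz (x, y) = (snd ?c x, snd ?d y)" by (simp add: prod_chart_def)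
  ultimately show ?thesis
    using c d by (simp add: tvec_pair_def Let_def tvec_of_def prod_chart_mem)
qed

lemma tvec_pair_fst: "fst (tvec_pair M N (x, v) (y, w)) = (x, y)"
  by (simp add: tvec_pair_def Let_def)

lemma tvec_pair_outside: "\<not> (b \<in> prod_atlas M N \<and> (x, y) \<in> fst b) \<Longrightarrow> snd (tvec_pair M N (x, v) (y, w)) b = 0"
  by (auto simp: tvec_pair_def Let_def tvec_of_def)

lemma tmap_chart:
  assumes e: "((x, y), L) \<in> points H" and W: "W \<in> tangent_space H ((x, y), L)"
    and c: "c \<in> M" "x \<in> fst c" and d: "d \<in> N" "y \<in> fst d"
  shows "snd (tmap H (prod_atlas M N) fst (((x, y), L), W)) (prod_chart c d) = fst (W (hom_chart M N c d))"
proof -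
  let ?e = "((x, y), L)" and ?h = "hom_chart M N c d" and ?b = "prod_chart c d"
  let ?hz = "chart_at H ?e"
  have h0: "?hz \<in> H" "?e \<in> fst ?hz" using chart_at_mem[OF e] by blast+
  have h: "?h \<in> H" "?e \<in> fst ?h" using c d e by (simp_all add: hom_chart_in hom_chart_dom points_H_iff)
  have "(fst has_derivative fst) (at (snd ?h ?e))" by (rule bounded_linear_imp_has_derivative[OF bounded_linear_fst])
  then have "((snd ?b \<circ> fst) \<circ> chart_inv ?h has_derivative fst) (at (snd ?h ?e))"
  proof (rule has_derivative_transform_within_open[OF _ H.open_image[OF h(1)]])
    show "snd ?h ?e \<in> chart_image ?h" unfolding chart_image_def using h(2) by blast
    fix z assume z: "z \<in> chart_image ?h"
    obtain x' y' L' where p: "chart_inv ?h z = ((x', y'), L')" by (metis surj_pair)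
    have "fst (snd ?h ((x', y'), L')) = fst z" using chart_inv_image(2)[OF z] p by simp
    then show "fst z = ((snd ?b \<circ> fst) \<circ> chart_inv ?h) z" by (simp add: p hom_chart_map prod_chart_def)
  qed
  from fun_cong[OF frechet_derivative_at[OF H.deriv_change_chart[OF h0 h this]], of "W ?hz"]
    H.tangentD[OF W h0(1) h(1) h0(2) h(2)]
  have "frechet_derivative (snd ?b \<circ> fst \<circ> chart_inv ?hz) (at (snd ?hz ?e)) (W ?hz) = fst (W ?h)" by simp
  moreover have "?b \<in> prod_atlas M N" using c d unfolding prod_atlas_def by blast
  ultimately show ?thesis using c d by (simp add: tmap_def Let_def prod_chart_mem)
qed

text \<open>By \<open>tangent_base_change\<close> the coordinate equation passes from one pair of
  charts to every other. The condition on the tangent map of the projection is thereby reduced to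
  the base component in a single chart, the form in which it is used from here on.\<close>

lemma tmap_eq_pair_iff:
  assumes e: "((x, y), L) \<in> points H" and W: "W \<in> tangent_space H ((x, y), L)"
    and v: "v \<in> tangent_space M x" and w: "w \<in> tangent_space N y"
    and c: "c \<in> M" "x \<in> fst c" and d: "d \<in> N" "y \<in> fst d"
  shows "tmap H (prod_atlas M N) fst (((x, y), L), W) = tvec_pair M N (x, v) (y, w) \<longleftrightarrow>
    fst (W (hom_chart M N c d)) = (v c, w d)"
proof
  assume "tmap H (prod_atlas M N) fst (((x, y), L), W) = tvec_pair M N (x, v) (y, w)"
  then show "fst (W (hom_chart M N c d)) = (v c, w d)"
    using tmap_chart[OF e W c d] tvec_pair_chart[OF v w c d] by simp
next
  assume eq: "fst (W (hom_chart M N c d)) = (v c, w d)"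
  have L: "L \<in> hom_space M N x y" using e by (simp add: points_H_iff)
  show "tmap H (prod_atlas M N) fst (((x, y), L), W) = tvec_pair M N (x, v) (y, w)"
  proof (rule prod_eqI)
    show "fst (tmap H (prod_atlas M N) fst (((x, y), L), W)) = fst (tvec_pair M N (x, v) (y, w))"
      by (simp add: tvec_pair_fst tmap_def Let_def)
    show "snd (tmap H (prod_atlas M N) fst (((x, y), L), W)) = snd (tvec_pair M N (x, v) (y, w))"
    proof
      fix b
      show "snd (tmap H (prod_atlas M N) fst (((x, y), L), W)) b = snd (tvec_pair M N (x, v) (y, w)) b"
      proof (cases "b \<in> prod_atlas M N \<and> (x, y) \<in> fst b")
        case True
        then obtain c' d' where b: "b = prod_chart c' d'" and c': "c' \<in> M" "d' \<in> N" unfolding prod_atlas_def by blast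
        then have x: "x \<in> fst c'" "y \<in> fst d'" using True by (simp_all add: prod_chart_mem)
        show ?thesis unfolding b
          using tmap_chart[OF e W c'(1) x(1) c'(2) x(2)] tvec_pair_chart[OF v w c'(1) x(1) c'(2) x(2)]
            tangent_base_change[OF c c'(1) x(1) d c'(2) x(2) L W v w eq] by simp
      next
        case False
        then show ?thesis using tvec_pair_outside[OF False] by (auto simp: tmap_def Let_def)
      qed
    qed
  qed
qed

lemma hom_space_line:
  assumes L: "L \<in> hom_space M N x y" and L': "L' \<in> hom_space M N x y"
  shows "(\<lambda>v. tvec_add (L v) (tvec_scale t (L' v))) \<in> hom_space M N x y"
proof -
  have "tvec_add (tvec_zero :: ('q, real^'n) tvec) (tvec_scale t tvec_zero) = tvec_zero"
    by (simp add: tvec_add_def tvec_scale_def tvec_zero_def)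
  moreover have "tvec_add (tvec_add a b) (tvec_scale t (tvec_add a' b')) =
      tvec_add (tvec_add a (tvec_scale t a')) (tvec_add b (tvec_scale t b'))"
    "tvec_add (tvec_scale r a) (tvec_scale t (tvec_scale r a')) = tvec_scale r (tvec_add a (tvec_scale t a'))"
    for a b a' b' :: "('q, real^'n) tvec" and r
    by (simp_all add: tvec_add_def tvec_scale_def fun_eq_iff algebra_simps)
  ultimately show ?thesis
    unfolding hom_space_def
    using hom_spaceD[OF L] hom_spaceD[OF L'] N.tangent_add N.tangent_scale by auto
qed

lemma hom_mat_line:
  "hom_mat M c d x (\<lambda>v. tvec_add (L v) (tvec_scale t (L' v))) = hom_mat M c d x L + t *\<^sub>R hom_mat M c d x L'"
  by (simp add: hom_mat_def matrix_def vec_eq_iff tvec_add_def tvec_scale_def)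

lemma tvec_line_0: "tvec_add v (tvec_scale 0 w) = v" "tvec_scale 0 v = tvec_zero" "tvec_add v (tvec_scale (-1) v) = tvec_zero"
    "tvec_add tvec_zero v = v" "tvec_add v tvec_zero = v" "tvec_scale r tvec_zero = tvec_zero"
  by (simp_all add: tvec_add_def tvec_scale_def tvec_zero_def)

text \<open>In a bundle chart the curve keeps its base point and is a straight line in the fibre
  coordinate, with the matrix of \<open>L'\<close> as velocity.\<close>

lemma vertical_lift_eq:
  assumes L: "L \<in> hom_space M N x y" and L': "L' \<in> hom_space M N x y"
    and c: "c \<in> M" "x \<in> fst c" and d: "d \<in> N" "y \<in> fst d"
  shows "vertical_lift (hom_bundle M N) ((x, y), L) ((x, y), L') =
    (((x, y), L), tvec_of H (hom_chart M N c d) ((x, y), L) (0, hom_mat M c d x L'))"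
proof -
  let ?h = "hom_chart M N c d"
  let ?\<gamma> = "\<lambda>t. ((x, y), \<lambda>v. tvec_add (L v) (tvec_scale t (L' v)))"
  have "((\<lambda>t. ((snd c x, snd d y), hom_mat M c d x L + t *\<^sub>R hom_mat M c d x L')) has_vector_derivative
      (0, hom_mat M c d x L')) (at 0)"
    unfolding has_vector_derivative_def by (auto intro!: derivative_eq_intros simp: zero_prod_def)
  then have "((\<lambda>t. snd ?h (?\<gamma> t)) has_vector_derivative (0, hom_mat M c d x L')) (at 0)"
    by (simp add: hom_chart_map hom_mat_line)
  from H.velocity_eq[OF hom_chart_in[OF c(1) d(1)] _ this]
  have "velocity H ?\<gamma> = (?\<gamma> 0, tvec_of H ?h (?\<gamma> 0) (0, hom_mat M c d x L'))"
    using c d hom_space_line[OF L L'] by (simp add: hom_chart_dom)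
  then show ?thesis by (simp add: vertical_lift_def tvec_line_0)
qed

end

section \<open>Connections and horizontal lifts\<close>

locale hom_connection = hom_manifold M N
  for M :: "('p, real^'m::finite) atlas" and N :: "('q, real^'n::finite) atlas" +
  fixes K :: "('p, 'm, 'q, 'n) hom_tangent \<Rightarrow> ('p, real^'m, 'q, real^'n) hom_point"
  assumes K: "connection (hom_bundle M N) K"
begin

abbreviation "E \<equiv> hom_bundle M N"

lemma topspace_tangent_H: "topspace (mtop (tangent_atlas H)) = points (tangent_atlas H)"
proof (rule topspace_mtop_points[OF H.inj_on_tangent_chart])
  show "open (chart_image t)" if "t \<in> tangent_atlas H" for t
    using that H.open_image by (auto simp: tangent_atlas_def H.tangent_chart_image open_Times)
qed

lemma K_morphism: "bundle_morphism (tangent_bundle H) E K fst"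
  using K by (simp add: connection_def)

lemma K_continuous: "continuous_map (mtop (tangent_atlas H)) (mtop H) K"
  using K_morphism by (simp add: bundle_morphism_def tangent_bundle_def)

lemma K_in:
  assumes "e \<in> points H" "W \<in> tangent_space H e" shows "K (e, W) \<in> points H"
proof -
  have "(e, W) \<in> topspace (mtop (tangent_atlas H))"
    using assms by (simp add: topspace_tangent_H H.points_tangent_atlas)
  with K_continuous have "K (e, W) \<in> topspace (mtop H)" unfolding continuous_map_def by blast
  then show ?thesis by (simp add: H.topspace_mtop)
qed

lemma K_fst:
  assumes "e \<in> points H" "W \<in> tangent_space H e" shows "fst (K (e, W)) = fst e"
proof -
  have "(e, W) \<in> points (bundle_total (tangent_bundle H))"
    using assms by (simp add: tangent_bundle_def H.points_tangent_atlas)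
  with K_morphism have "proj E (K (e, W)) = fst (proj (tangent_bundle H) (e, W))"
    unfolding bundle_morphism_def by blast
  then show ?thesis by (simp add: tangent_bundle_def)
qed

lemma
  assumes e: "e \<in> points H" and V: "V \<in> tangent_space H e"
  shows K_add: "W \<in> tangent_space H e \<Longrightarrow> K (e, tvec_add V W) = vadd E (K (e, V)) (K (e, W))"
    and K_scale: "K (e, tvec_scale r V) = vscale E r (K (e, V))"
proof -
  have "linear_on_fibre (tangent_bundle H) E K e"
    using K_morphism e by (simp add: bundle_morphism_def tangent_bundle_def)
  moreover have "(e, V) \<in> fibre (tangent_bundle H) e" if "V \<in> tangent_space H e" for V
    using e that by (simp add: fibre_def tangent_bundle_def H.points_tangent_atlas)
  ultimately have "\<And>W. W \<in> tangent_space H e \<Longrightarrow> K (vadd (tangent_bundle H) (e, V) (e, W)) = vadd E (K (e, V)) (K (e, W))"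
    and "K (vscale (tangent_bundle H) r (e, V)) = vscale E r (K (e, V))" for r
    using V unfolding linear_on_fibre_def by blast+
  then show "W \<in> tangent_space H e \<Longrightarrow> K (e, tvec_add V W) = vadd E (K (e, V)) (K (e, W))"
    and "K (e, tvec_scale r V) = vscale E r (K (e, V))"
    by (simp_all add: tangent_bundle_def)
qed

lemma K_vertical:
  "((x, y), L) \<in> points H \<Longrightarrow> ((x, y), L') \<in> points H \<Longrightarrow> K (vertical_lift E ((x, y), L) ((x, y), L')) = ((x, y), L')"
  using K by (simp add: connection_def)

lemma K_hom:
  assumes "((x, y), L) \<in> points H" "W \<in> tangent_space H ((x, y), L)"
  obtains L' where "K (((x, y), L), W) = ((x, y), L')" "L' \<in> hom_space M N x y"
  using K_in[OF assms] K_fst[OF assms] points_H_iff by (metis fst_conv prod.collapse)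

text \<open>The difference has base component 0, so it is the vertical lift of the linear map whose
  matrix is its fibre component, and \<open>K\<close> returns that map. As \<open>K\<close> vanishes
  on the difference, the matrix is 0.\<close>

lemma K_injective:
  assumes e: "((x, y), L) \<in> points H" and V: "V \<in> tangent_space H ((x, y), L)" and V': "V' \<in> tangent_space H ((x, y), L)"
    and c: "c \<in> M" "x \<in> fst c" and d: "d \<in> N" "y \<in> fst d"
    and K_eq: "K (((x, y), L), V) = K (((x, y), L), V')"
    and base: "fst (V (hom_chart M N c d)) = fst (V' (hom_chart M N c d))"
  shows "V = V'"
proof -
  let ?e = "((x, y), L)" and ?h = "hom_chart M N c d"
  have L: "L \<in> hom_space M N x y" and xy: "x \<in> points M" "y \<in> points N" using e by (simp_all add: points_H_iff)
  have h: "?h \<in> H" "?e \<in> fst ?h" using c d L by (simp_all add: hom_chart_in hom_chart_dom)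
  let ?D = "tvec_add V (tvec_scale (-1) V')"
  have D: "?D \<in> tangent_space H ?e" by (intro H.tangent_add H.tangent_scale V V')
  let ?B = "snd (?D ?h)"
  have "fst (?D ?h) = 0" using base by (simp add: tvec_add_def tvec_scale_def)
  then have Dh: "?D ?h = (0, ?B)" by (simp add: prod_eq_iff)
  let ?l = "hom_of M N c d x y ?B"
  have l: "?l \<in> hom_space M N x y" by (rule hom_of_in[OF c d])
  have "vertical_lift E ?e ((x, y), ?l) = (?e, tvec_of H ?h ?e (0, ?B))"
    using vertical_lift_eq[OF L l c d] hom_mat_hom_of[OF c d] by simp
  also have "tvec_of H ?h ?e (0, ?B) = ?D"
    using H.tvec_of_eq[OF D h] Dh by simp
  finally have "K (?e, ?D) = ((x, y), ?l)"
    using K_vertical[OF e, of ?l] l xy by (simp add: points_H_iff)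
  moreover obtain l' where l': "K (?e, V') = ((x, y), l')" by (rule K_hom[OF e V'])
  have "K (?e, ?D) = ((x, y), \<lambda>v. tvec_zero)"
    using K_add[OF e V H.tangent_scale[OF V']] K_scale[OF e V'] K_eq l' by (simp add: tvec_line_0)
  ultimately have "?l = (\<lambda>v. tvec_zero)" by simp
  then have "hom_mat M c d x ?l = 0" by (simp add: hom_mat_def matrix_def tvec_zero_def vec_eq_iff)
  then have "?B = 0" using hom_mat_hom_of[OF c d] by simp
  then have "?D ?h = 0" using Dh by (simp add: zero_prod_def)
  then have "V ?h = V' ?h" by (simp add: tvec_add_def tvec_scale_def)
  then show ?thesis by (rule H.tangent_ext[OF V V' h])
qed

text \<open>The definite description in \<open>horizontal_lift\<close> is resolved by
  \<open>K_injective\<close>, which provides uniqueness, while \<open>tmap_eq_pair_iff\<close>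
  translates its last condition into \<open>base\<close>.\<close>

lemma horizontal_lift_eq:
  assumes e: "((x, y), L) \<in> points H" and W: "W \<in> tangent_space H ((x, y), L)"
    and v: "v \<in> tangent_space M x" and w: "w \<in> tangent_space N y"
    and c: "c \<in> M" "x \<in> fst c" and d: "d \<in> N" "y \<in> fst d"
    and KW: "K (((x, y), L), W) = ((x, y), \<lambda>v. tvec_zero)" and base: "fst (W (hom_chart M N c d)) = (v c, w d)"
  shows "horizontal_lift E K ((x, y), L) (tvec_pair M N (x, v) (y, w)) = (((x, y), L), W)"
  unfolding horizontal_lift_def
proof (rule the_equality)
  let ?e = "((x, y), L)"
  show "(?e, W) \<in> points (tangent_atlas (bundle_total E)) \<and> fst (?e, W) = ?e \<and> K (?e, W) = vscale E 0 ?e \<and>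
      tmap (bundle_total E) (bundle_base E) (proj E) (?e, W) = tvec_pair M N (x, v) (y, w)"
    using e W KW tmap_eq_pair_iff[OF e W v w c d] base by (simp add: H.points_tangent_atlas tvec_line_0)
  fix V assume V: "V \<in> points (tangent_atlas (bundle_total E)) \<and> fst V = ?e \<and> K V = vscale E 0 ?e \<and>
      tmap (bundle_total E) (bundle_base E) (proj E) V = tvec_pair M N (x, v) (y, w)"
  then obtain W' where W': "V = (?e, W')" "W' \<in> tangent_space H ?e"
    by (cases V) (auto simp: H.points_tangent_atlas)
  have "fst (W' (hom_chart M N c d)) = (v c, w d)"
    using V W' tmap_eq_pair_iff[OF e W'(2) v w c d] by simp
  moreover have "K (?e, W') = K (?e, W)" using V W' KW by (simp add: tvec_line_0)
  ultimately have "W' = W" using K_injective[OF e W'(2) W c d] base by simp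
  then show "V = (?e, W)" using W' by simp
qed

lemma vertical_lift_tangent:
  assumes "((x, y), L) \<in> points H" "L' \<in> hom_space M N x y"
  obtains Z where "vertical_lift E ((x, y), L) ((x, y), L') = (((x, y), L), Z)" "Z \<in> tangent_space H ((x, y), L)"
    "K (((x, y), L), Z) = ((x, y), L')"
    "\<And>c d. c \<in> M \<Longrightarrow> x \<in> fst c \<Longrightarrow> d \<in> N \<Longrightarrow> y \<in> fst d \<Longrightarrow> Z (hom_chart M N c d) = (0, hom_mat M c d x L')"
proof -
  have L: "L \<in> hom_space M N x y" and xy: "x \<in> points M" "y \<in> points N" using assms by (simp_all add: points_H_iff)
  obtain c d where c: "c \<in> M" "x \<in> fst c" and d: "d \<in> N" "y \<in> fst d" using xy unfolding points_def by blast
  let ?e = "((x, y), L)" and ?h = "hom_chart M N c d"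
  have h: "hom_chart M N c d \<in> H" "?e \<in> fst (hom_chart M N c d)"
    if "c \<in> M" "x \<in> fst c" "d \<in> N" "y \<in> fst d" for c d using that L by (simp_all add: hom_chart_in hom_chart_dom)
  let ?Z = "tvec_of H ?h ?e (0, hom_mat M c d x L')"
  have V: "vertical_lift E ?e ((x, y), L') = (?e, ?Z)" by (rule vertical_lift_eq[OF L assms(2) c d])
  show thesis
  proof (rule that[of ?Z])
    show "?Z \<in> tangent_space H ?e" by (rule H.tvec_of_in[OF h[OF c d]])
    show "K (?e, ?Z) = ((x, y), L')"
      using K_vertical[OF assms(1), of L'] assms(2) xy V by (simp add: points_H_iff)
    show "?Z (hom_chart M N c' d') = (0, hom_mat M c' d' x L')" if "c' \<in> M" "x \<in> fst c'" "d' \<in> N" "y \<in> fst d'" for c' d'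
    proof -
      \<comment> \<open>\<open>vertical_lift\<close> does not refer to charts, so computing it in
        another pair of charts must give the same vector.\<close>
      have "?Z = tvec_of H (hom_chart M N c' d') ?e (0, hom_mat M c' d' x L')"
        using vertical_lift_eq[OF L assms(2) that] V by simp
      then show ?thesis using H.tvec_of_chart[OF h[OF that]] by simp
    qed
  qed (rule V)
qed

text \<open>Subtracting from a tangent vector the vertical lift of its image under \<open>K\<close> leaves a vector in
  the kernel of \<open>K\<close> over the same base vector, hence its horizontal part.\<close>

lemma vertical_horizontal_decomposition:
  assumes e: "((x, y), L) \<in> points H" and W: "W \<in> tangent_space H ((x, y), L)"
    and v: "v \<in> tangent_space M x" and w: "w \<in> tangent_space N y"
    and c: "c \<in> M" "x \<in> fst c" and d: "d \<in> N" "y \<in> fst d"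
    and base: "fst (W (hom_chart M N c d)) = (v c, w d)"
  obtains Z Y where "vertical_lift E ((x, y), L) (K (((x, y), L), W)) = (((x, y), L), Z)"
    "horizontal_lift E K ((x, y), L) (tvec_pair M N (x, v) (y, w)) = (((x, y), L), Y)"
    "Y \<in> tangent_space H ((x, y), L)" "K (((x, y), L), Y) = ((x, y), \<lambda>v. tvec_zero)"
    "fst (Y (hom_chart M N c d)) = (v c, w d)" "W = tvec_add Z Y"
proof -
  let ?e = "((x, y), L)"
  obtain L' where L': "K (?e, W) = ((x, y), L')" "L' \<in> hom_space M N x y" by (rule K_hom[OF e W])
  obtain Z where Z: "vertical_lift E ?e ((x, y), L') = (?e, Z)" "Z \<in> tangent_space H ?e" "K (?e, Z) = ((x, y), L')"
    "Z (hom_chart M N c d) = (0, hom_mat M c d x L')"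
    using vertical_lift_tangent[OF e L'(2)] c d by metis
  let ?Y = "tvec_add W (tvec_scale (-1) Z)"
  have Y: "?Y \<in> tangent_space H ?e" by (intro H.tangent_add H.tangent_scale W Z)
  have KY: "K (?e, ?Y) = ((x, y), \<lambda>v. tvec_zero)"
    using K_add[OF e W H.tangent_scale[OF Z(2)]] K_scale[OF e Z(2)] L' Z by (simp add: tvec_line_0)
  have bY: "fst (?Y (hom_chart M N c d)) = (v c, w d)"
    using base Z(4) by (simp add: tvec_add_def tvec_scale_def)
  have "W = tvec_add Z ?Y" by (simp add: tvec_add_def tvec_scale_def)
  then show thesis
    using that[of Z ?Y] Z(1) L'(1) horizontal_lift_eq[OF e Y v w c d KY bY] Y KY bY by simp
qed

lemma horizontal_lift_exists:
  assumes e: "((x, y), L) \<in> points H" and v: "v \<in> tangent_space M x" and w: "w \<in> tangent_space N y"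
    and c: "c \<in> M" "x \<in> fst c" and d: "d \<in> N" "y \<in> fst d"
  obtains Y where "horizontal_lift E K ((x, y), L) (tvec_pair M N (x, v) (y, w)) = (((x, y), L), Y)"
    "Y \<in> tangent_space H ((x, y), L)" "K (((x, y), L), Y) = ((x, y), \<lambda>v. tvec_zero)"
    "fst (Y (hom_chart M N c d)) = (v c, w d)"
proof -
  let ?h = "hom_chart M N c d" and ?e = "((x, y), L)"
  have h: "?h \<in> H" "?e \<in> fst ?h" using c d e by (simp_all add: hom_chart_in hom_chart_dom points_H_iff)
  \<comment> \<open>Any vector over \<open>(v, w)\<close> would do, because the decomposition
    removes its vertical part; fibre component 0 is the simplest choice.\<close>
  let ?W = "tvec_of H ?h ?e ((v c, w d), 0)"
  have "?W \<in> tangent_space H ?e" "fst (?W ?h) = (v c, w d)"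
    using H.tvec_of_in[OF h] H.tvec_of_chart[OF h] by auto
  from vertical_horizontal_decomposition[OF e this(1) v w c d this(2)] that show thesis by blast
qed

end

section \<open>Bilinear maps, and functions pulled back from the base\<close>

context hom_manifold
begin

lemma bilin_spaceD:
  assumes "B \<in> bilin_space M N x y"
  shows "e \<in> tangent_space M x \<Longrightarrow> B e \<in> hom_space M N x y"
    and "e \<in> tangent_space M x \<Longrightarrow> e' \<in> tangent_space M x \<Longrightarrow> B (tvec_add e e') v = tvec_add (B e v) (B e' v)"
    and "e \<in> tangent_space M x \<Longrightarrow> B (tvec_scale r e) v = tvec_scale r (B e v)"
    and "e \<notin> tangent_space M x \<Longrightarrow> B e = (\<lambda>v. tvec_zero)"
  using assms unfolding bilin_space_def by blast+

lemma bilin_atlasE: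
  assumes "h \<in> bilin_atlas M N" obtains c d where "c \<in> M" "d \<in> N" "h = bilin_chart M N c d"
  using assms unfolding bilin_atlas_def by blast

lemma bilin_chart_dom:
  "((x, y), B) \<in> fst (bilin_chart M N c d) \<longleftrightarrow> x \<in> fst c \<and> y \<in> fst d \<and> B \<in> bilin_space M N x y"
  by (simp add: bilin_chart_def)

lemma bilin_chart_map:
  "snd (bilin_chart M N c d) ((x, y), B) =
    ((snd c x, snd d y), \<chi> i. hom_mat M c d x (B (tvec_of M c x (axis i 1))))"
  by (simp add: bilin_chart_def hom_mat_def)

lemma points_bilin_iff:
  "((x, y), B) \<in> points (bilin_atlas M N) \<longleftrightarrow> x \<in> points M \<and> y \<in> points N \<and> B \<in> bilin_space M N x y"
proof
  assume "((x, y), B) \<in> points (bilin_atlas M N)"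
  then obtain h where "h \<in> bilin_atlas M N" "((x, y), B) \<in> fst h" unfolding points_def by blast
  then show "x \<in> points M \<and> y \<in> points N \<and> B \<in> bilin_space M N x y"
    unfolding points_def by (elim bilin_atlasE) (auto simp: bilin_chart_dom)
next
  assume *: "x \<in> points M \<and> y \<in> points N \<and> B \<in> bilin_space M N x y"
  then obtain c d where "c \<in> M" "x \<in> fst c" "d \<in> N" "y \<in> fst d" unfolding points_def by blast
  then have "bilin_chart M N c d \<in> bilin_atlas M N" "((x, y), B) \<in> fst (bilin_chart M N c d)"
    using * unfolding bilin_atlas_def bilin_chart_dom by blast+
  then show "((x, y), B) \<in> points (bilin_atlas M N)" unfolding points_def by blast
qed

lemma bilin_ext:
  assumes B: "B \<in> bilin_space M N x y" and B': "B' \<in> bilin_space M N x y"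
    and eq: "\<And>e. e \<in> tangent_space M x \<Longrightarrow> B e = B' e"
  shows "B = B'"
proof
  fix e show "B e = B' e"
    using eq bilin_spaceD(4)[OF B] bilin_spaceD(4)[OF B'] by (cases "e \<in> tangent_space M x") simp_all
qed

text \<open>The chart records a bilinear map only for basis vectors in the first argument; linearity
  in that argument recovers the rest. Injectivity is what \<open>meas_onI_charts\<close> asks of the
  target.\<close>

lemma inj_bilin_chart:
  assumes "h \<in> bilin_atlas M N" shows "inj_on (snd h) (fst h)"
proof -
  obtain c d where c: "c \<in> M" and d: "d \<in> N" and h: "h = bilin_chart M N c d" using assms by (rule bilin_atlasE)
  show ?thesis
  proof (rule inj_onI)
    fix p p' assume p: "p \<in> fst h" "p' \<in> fst h" and eq: "snd h p = snd h p'"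
    obtain x y B x' y' B' where pe: "p = ((x, y), B)" "p' = ((x', y'), B')" by (metis surj_pair)
    have *: "x \<in> fst c" "y \<in> fst d" "B \<in> bilin_space M N x y" "x' \<in> fst c" "y' \<in> fst d" "B' \<in> bilin_space M N x' y'"
      using p by (simp_all add: h pe bilin_chart_dom)
    have "snd c x = snd c x'" "snd d y = snd d y'" using eq by (simp_all add: h pe bilin_chart_map)
    then have xy: "x' = x" "y' = y" using M.inj[OF c] N.inj[OF d] * by (auto dest: inj_onD)
    have B: "B \<in> bilin_space M N x y" "B' \<in> bilin_space M N x y" using * xy by simp_all
    have mats: "hom_mat M c d x (B (tvec_of M c x (axis i 1))) = hom_mat M c d x (B' (tvec_of M c x (axis i 1)))" for i
      using eq unfolding h pe bilin_chart_map xy by (simp add: vec_eq_iff)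
    have lin: "linear (\<lambda>w. hom_mat M c d x (B (tvec_of M c x w)))" if "B \<in> bilin_space M N x y" for B
      using bilin_spaceD[OF that] M.tvec_of_in[OF c *(1)]
      by (intro linearI) (simp_all add: M.tvec_of_add[OF c *(1)] M.tvec_of_scale[OF c *(1)] hom_mat_def matrix_def
          vec_eq_iff tvec_add_def[of "B _ _"] tvec_scale_def[of _ "B _ _"])
    have "B e = B' e" if e: "e \<in> tangent_space M x" for e
    proof (rule hom_ext[OF bilin_spaceD(1)[OF B(1) e] bilin_spaceD(1)[OF B(2) e] c *(1) d *(2)])
      have "hom_mat M c d x (B (tvec_of M c x (e c))) = hom_mat M c d x (B' (tvec_of M c x (e c)))"
        unfolding linear_expand_Basis[OF lin[OF B(1)], of "e c"] linear_expand_Basis[OF lin[OF B(2)], of "e c"]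
      proof (rule sum.cong[OF refl])
        fix b :: "real^'m" assume "b \<in> Basis"
        then obtain i where "b = axis i 1" by (auto simp: Basis_vec_def)
        then show "(e c \<bullet> b) *\<^sub>R hom_mat M c d x (B (tvec_of M c x b)) = (e c \<bullet> b) *\<^sub>R hom_mat M c d x (B' (tvec_of M c x b))"
          using mats by simp
      qed
      then show "hom_mat M c d x (B e) = hom_mat M c d x (B' e)" by (simp only: M.tvec_of_eq[OF e c *(1)])
    qed
    then have "B = B'" by (rule bilin_ext[OF B])
    then show "p = p'" using xy by (simp add: pe)
  qed
qed

lemma C1_fun_pullback_N:
  assumes f: "C1_fun N f" shows "C1_fun H (\<lambda>p. f (snd (fst p)))"
  unfolding C1_fun_def
proof
  fix h assume "h \<in> H"
  then obtain c d where c: "c \<in> M" "d \<in> N" "h = hom_chart M N c d" by (rule H_chartE)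
  have sub: "(\<lambda>z. snd (fst z)) ` chart_image h \<subseteq> chart_image d" using c by (auto simp: hom_chart_image)
  have "Ck 1 (chart_image h) (\<lambda>z. snd (fst z))"
    by (intro Ck1_bounded_linear bounded_linear_snd_comp bounded_linear_fst)
  from Ck1_compose[OF this _ sub] f c(2)
  have "Ck 1 (chart_image h) ((f \<circ> chart_inv d) \<circ> (\<lambda>z. snd (fst z)))" unfolding C1_fun_def by blast
  then show "Ck 1 (chart_image h) ((\<lambda>p. f (snd (fst p))) \<circ> chart_inv h)"
  proof (rule Ck1_cong_open[OF H.open_image[OF \<open>h \<in> H\<close>], rotated])
    fix z assume "z \<in> chart_image h"
    note z = chart_inv_image[OF this]
    obtain x y L where p: "chart_inv h z = ((x, y), L)" by (metis surj_pair)
    have "((x, y), L) \<in> fst (hom_chart M N c d)" "snd (hom_chart M N c d) ((x, y), L) = z"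
      using z p c(3) by simp_all
    then have "y \<in> fst d" "snd (fst z) = snd d y" by (auto simp: hom_chart_dom hom_chart_map)
    then show "((f \<circ> chart_inv d) \<circ> (\<lambda>z. snd (fst z))) z = ((\<lambda>p. f (snd (fst p))) \<circ> chart_inv h) z"
      using p N.chart_inv_eq[OF c(2)] by simp
  qed
qed

lemma C1_fun_pullback_M:
  assumes f: "C1_fun M f" shows "C1_fun H (\<lambda>p. f (fst (fst p)))"
  unfolding C1_fun_def
proof
  fix h assume "h \<in> H"
  then obtain c d where c: "c \<in> M" "d \<in> N" "h = hom_chart M N c d" by (rule H_chartE)
  have sub: "(\<lambda>z. fst (fst z)) ` chart_image h \<subseteq> chart_image c" using c by (auto simp: hom_chart_image)
  have "Ck 1 (chart_image h) (\<lambda>z. fst (fst z))"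
    by (intro Ck1_bounded_linear bounded_linear_fst_comp bounded_linear_fst)
  from Ck1_compose[OF this _ sub] f c(1)
  have "Ck 1 (chart_image h) ((f \<circ> chart_inv c) \<circ> (\<lambda>z. fst (fst z)))" unfolding C1_fun_def by blast
  then show "Ck 1 (chart_image h) ((\<lambda>p. f (fst (fst p))) \<circ> chart_inv h)"
  proof (rule Ck1_cong_open[OF H.open_image[OF \<open>h \<in> H\<close>], rotated])
    fix z assume "z \<in> chart_image h"
    note z = chart_inv_image[OF this]
    obtain x y L where p: "chart_inv h z = ((x, y), L)" by (metis surj_pair)
    have "((x, y), L) \<in> fst (hom_chart M N c d)" "snd (hom_chart M N c d) ((x, y), L) = z"
      using z p c(3) by simp_all
    then have "x \<in> fst c" "fst (fst z) = snd c x" by (auto simp: hom_chart_dom hom_chart_map)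
    then show "((f \<circ> chart_inv c) \<circ> (\<lambda>z. fst (fst z))) z = ((\<lambda>p. f (fst (fst p))) \<circ> chart_inv h) z"
      using p M.chart_inv_eq[OF c(1)] by simp
  qed
qed

text \<open>A pullback depends on base coordinates only, so its differential sees just the base
  component of \<open>W\<close>. Testing with pullbacks therefore determines the image of
  \<open>W\<close> under the tangent map of the projection.\<close>

lemma dreal_pullback:
  assumes e: "((x, y), L) \<in> points H" and W: "W \<in> tangent_space H ((x, y), L)"
    and c: "c \<in> M" "x \<in> fst c" and d: "d \<in> N" "y \<in> fst d"
  shows "C1_fun M f \<Longrightarrow> dreal H (\<lambda>p. f (fst (fst p))) (((x, y), L), W) =
      dreal M f (x, tvec_of M c x (fst (fst (W (hom_chart M N c d)))))"
    and "C1_fun N g \<Longrightarrow> dreal H (\<lambda>p. g (snd (fst p))) (((x, y), L), W) =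
      dreal N g (y, tvec_of N d y (snd (fst (W (hom_chart M N c d)))))"
proof -
  let ?e = "((x, y), L)" and ?h = "hom_chart M N c d"
  have h: "?h \<in> H" "?e \<in> fst ?h" using c d e by (simp_all add: hom_chart_in hom_chart_dom points_H_iff)
  have z: "snd ?h ?e = ((snd c x, snd d y), hom_mat M c d x L)" by (rule hom_chart_map)
  have mem: "snd ?h ?e \<in> chart_image ?h" unfolding chart_image_def using h(2) by blast
  have inv: "\<exists>x y L. chart_inv ?h z = ((x, y), L) \<and> x \<in> fst c \<and> y \<in> fst d \<and> fst z = (snd c x, snd d y)"
    if "z \<in> chart_image ?h" for z
  proof -
    obtain x y L where p: "chart_inv ?h z = ((x, y), L)" by (metis surj_pair)
    have "fst (snd ?h ((x, y), L)) = fst z" using chart_inv_image(2)[OF that] p by simp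
    moreover have "((x, y), L) \<in> fst ?h" using chart_inv_image(1)[OF that] p by simp
    ultimately show ?thesis using p by (auto simp: hom_chart_dom hom_chart_map)
  qed
  show "dreal H (\<lambda>p. f (fst (fst p))) (?e, W) = dreal M f (x, tvec_of M c x (fst (fst (W ?h))))" if f: "C1_fun M f"
  proof -
    let ?D = "frechet_derivative (f \<circ> chart_inv c) (at (snd c x))"
    have "((f \<circ> chart_inv c) has_derivative ?D) (at ((\<lambda>z. fst (fst z)) (snd ?h ?e)))"
      using M.C1_fun_has_derivative[OF f c] by (simp add: z)
    from diff_chain_at[OF bounded_linear_imp_has_derivative[OF bounded_linear_fst_comp[OF bounded_linear_fst]] this]
    have "((\<lambda>z. (f \<circ> chart_inv c) (fst (fst z))) has_derivative (\<lambda>W. ?D (fst (fst W)))) (at (snd ?h ?e))" by (simp add: o_def)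
    then have "((\<lambda>p. f (fst (fst p))) \<circ> chart_inv ?h has_derivative (\<lambda>W. ?D (fst (fst W)))) (at (snd ?h ?e))"
    proof (rule has_derivative_transform_within_open[OF _ H.open_image[OF h(1)] mem])
      fix z assume "z \<in> chart_image ?h"
      from inv[OF this] M.chart_inv_eq[OF c(1)]
      show "(f \<circ> chart_inv c) (fst (fst z)) = ((\<lambda>p. f (fst (fst p))) \<circ> chart_inv ?h) z" by auto
    qed
    from fun_cong[OF frechet_derivative_at[OF this], of "W ?h"]
    show ?thesis
      using H.dreal_chart[OF C1_fun_pullback_M[OF f] h W] M.dreal_chart[OF f c M.tvec_of_in[OF c]] M.tvec_of_chart[OF c]
      by simp
  qed
  show "dreal H (\<lambda>p. g (snd (fst p))) (?e, W) = dreal N g (y, tvec_of N d y (snd (fst (W ?h))))" if g: "C1_fun N g"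
  proof -
    let ?D = "frechet_derivative (g \<circ> chart_inv d) (at (snd d y))"
    have "((g \<circ> chart_inv d) has_derivative ?D) (at ((\<lambda>z. snd (fst z)) (snd ?h ?e)))"
      using N.C1_fun_has_derivative[OF g d] by (simp add: z)
    from diff_chain_at[OF bounded_linear_imp_has_derivative[OF bounded_linear_snd_comp[OF bounded_linear_fst]] this]
    have "((\<lambda>z. (g \<circ> chart_inv d) (snd (fst z))) has_derivative (\<lambda>W. ?D (snd (fst W)))) (at (snd ?h ?e))" by (simp add: o_def)
    then have "((\<lambda>p. g (snd (fst p))) \<circ> chart_inv ?h has_derivative (\<lambda>W. ?D (snd (fst W)))) (at (snd ?h ?e))"
    proof (rule has_derivative_transform_within_open[OF _ H.open_image[OF h(1)] mem])
      fix z assume "z \<in> chart_image ?h"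
      from inv[OF this] N.chart_inv_eq[OF d(1)]
      show "(g \<circ> chart_inv d) (snd (fst z)) = ((\<lambda>p. g (snd (fst p))) \<circ> chart_inv ?h) z" by auto
    qed
    from fun_cong[OF frechet_derivative_at[OF this], of "W ?h"]
    show ?thesis
      using H.dreal_chart[OF C1_fun_pullback_N[OF g] h W] N.dreal_chart[OF g d N.tvec_of_in[OF d]] N.tvec_of_chart[OF d]
      by simp
  qed
qed

end

lemma borel_measurable_vec:
  fixes f :: "'a \<Rightarrow> 'b::euclidean_space ^ 'n"
  assumes "\<And>i. (\<lambda>z. f z $ i) \<in> borel_measurable M" shows "f \<in> borel_measurable M"
  unfolding borel_measurable_euclidean_space[of f]
proof
  fix b :: "'b ^ 'n" assume "b \<in> Basis"
  then obtain i u where "b = axis i u" by (auto simp: Basis_vec_def)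
  then show "(\<lambda>z. f z \<bullet> b) \<in> borel_measurable M"
    using borel_measurable_inner[OF assms[of i] borel_measurable_const[of u]] by (simp add: inner_axis)
qed

section \<open>Covariant derivatives\<close>

locale twice_differentiable = hom_connection M N K
  for M :: "('p, real^'m::finite) atlas" and N :: "('q, real^'n::finite) atlas"
    and K :: "('p, 'm, 'q, 'n) hom_tangent \<Rightarrow> ('p, real^'m, 'q, real^'n) hom_point" +
  fixes u :: "'p \<Rightarrow> 'q" and Tu :: "'p \<times> ('p, real^'m) tvec \<Rightarrow> 'q \<times> ('q, real^'n) tvec"
  assumes twice: "twice_colocally_weakly_differentiable M N u Tu"
begin

abbreviation "U \<equiv> hom_section M N u Tu"

definition L :: "'p \<Rightarrow> ('p, real^'m) tvec \<Rightarrow> ('q, real^'n) tvec" where "L x = snd (U x)"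

lemma U_eq: "U x = ((x, u x), L x)"
  by (simp add: L_def hom_section_def Let_def)

lemma Tu_derivative: "colocal_derivative M N u Tu"
  using twice by (intro has_colocal_weak_derivativeD M.C1_manifold_axioms N.C1_manifold_axioms)
    (simp add: twice_colocally_weakly_differentiable_def)

sublocale T: colocal_derivative M N u Tu by (rule Tu_derivative)

lemma U_differentiable: "colocally_weakly_differentiable M H U"
  using twice by (simp add: twice_colocally_weakly_differentiable_def)

lemma U_wd: "f \<in> C1c H \<Longrightarrow> \<exists>\<omega>. has_weak_derivative M (f \<circ> U) \<omega>"
  using U_differentiable by (auto simp: colocally_weakly_differentiable_def weakly_differentiable_def)

lemma U_points: "x \<in> points M \<Longrightarrow> U x \<in> points H"
  using U_differentiable by (auto simp: colocally_weakly_differentiable_def measurable_map_def)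

lemma
  assumes "x \<in> points M"
  shows L_hom: "L x \<in> hom_space M N x (u x)" and U_H: "((x, u x), L x) \<in> points H" and u_points: "u x \<in> points N"
  using U_points[OF assms] by (simp_all add: U_eq points_H_iff)

text \<open>\<open>hom_section\<close> substitutes the zero map where \<open>Tu\<close> fails to be
  linear, which happens on a null set only.\<close>

lemma L_eq_Tu: "ae_on M (\<lambda>x. \<forall>v\<in>tangent_space M x. L x v = snd (Tu (x, v)))"
  using T.A_linear
proof (rule ae_on_mono)
  fix x assume x: "x \<in> points M" and lin: "tvec_linear M x (\<lambda>v. snd (Tu (x, v)))"
  let ?L = "\<lambda>v. if v \<in> tangent_space M x then snd (Tu (x, v)) else tvec_zero"
  have "?L \<in> hom_space M N x (u x)"
    using lin T.A_snd[OF x] M.tangent_add M.tangent_scale unfolding hom_space_def tvec_linear_def by auto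
  then show "\<forall>v\<in>tangent_space M x. L x v = snd (Tu (x, v))"
    by (simp add: L_def hom_section_def Let_def)
qed

abbreviation cM :: "'p \<Rightarrow> ('p, real^'m) chart" where "cM x \<equiv> chart_at M x"
abbreviation cN :: "'p \<Rightarrow> ('q, real^'n) chart" where "cN x \<equiv> chart_at N (u x)"

lemma charts:
  assumes "x \<in> points M"
  shows "cM x \<in> M" "x \<in> fst (cM x)" "cN x \<in> N" "u x \<in> fst (cN x)"
  using chart_at_mem[OF assms] chart_at_mem[OF u_points[OF assms]] by blast+

text \<open>By \<open>tmap_eq_pair_iff\<close> this says that the tangent map of the projection
  sends \<open>W\<close> to the pair of \<open>v\<close> and \<open>L x v\<close>. The chosen charts
  only serve to express it.\<close>

definition base_ok :: "'p \<Rightarrow> ('p, real^'m) tvec \<Rightarrow>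
    (('p, real^'m, 'q, real^'n) hom_point, ('m, 'n) hom_model) tvec \<Rightarrow> bool" where
  "base_ok x v W \<longleftrightarrow> fst (W (hom_chart M N (cM x) (cN x))) = (v (cM x), L x v (cN x))"

text \<open>Along \<open>U\<close> a pullback from \<open>M\<close> becomes \<open>f\<close> itself,
  with its classical differential, and a pullback from \<open>N\<close> becomes
  \<open>f \<circ> u\<close>, whose weak derivative is given by \<open>Tu\<close>. Functions in
  \<open>C1c\<close> are bounded, so \<open>deriv_C1_fun\<close> applies to their pullbacks.
  Countable separating families on both factors then fix the base component off one null
  set.\<close>

lemma base_derivative:
  assumes A: "colocal_derivative M H U A"
  shows "ae_on M (\<lambda>x. \<forall>v\<in>tangent_space M x. base_ok x v (snd (A (x, v))))"
proof -
  interpret A: colocal_derivative M H U A by (rule A)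
  obtain FM where FM: "countable FM" "FM \<subseteq> C1c M"
    and sepM: "\<forall>x\<in>points M. \<forall>v\<in>tangent_space M x. \<forall>w\<in>tangent_space M x.
      (\<forall>f\<in>FM. dreal M f (x, v) = dreal M f (x, w)) \<longrightarrow> v = w"
    using M.countable_separating_C1c by blast
  note sepM = sepM[rule_format]
  obtain FN where FN: "countable FN" "FN \<subseteq> C1c N"
    and sepN: "\<forall>x\<in>points N. \<forall>v\<in>tangent_space N x. \<forall>w\<in>tangent_space N x.
      (\<forall>f\<in>FN. dreal N f (x, v) = dreal N f (x, w)) \<longrightarrow> v = w"
    using N.countable_separating_C1c by blast
  note sepN = sepN[rule_format]
  have aeM: "ae_on M (\<lambda>x. \<forall>f\<in>FM. \<forall>v\<in>tangent_space M x. dreal H (\<lambda>p. f (fst (fst p))) (A (x, v)) = dreal M f (x, v))"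
  proof (rule ae_on_ball_countable[OF FM(1)])
    fix f assume "f \<in> FM"
    then have f: "f \<in> C1c M" using FM by blast
    note C = M.C1c_imp_C1_fun[OF f]
    obtain B where B: "\<And>x. x \<in> points M \<Longrightarrow> \<bar>f x\<bar> \<le> B" by (rule M.C1c_bounded[OF f], rule that)
    have "(\<lambda>p. f (fst (fst p))) \<circ> U = f" by (simp add: fun_eq_iff U_eq)
    then have w: "has_weak_derivative M ((\<lambda>p. f (fst (fst p))) \<circ> U) (dreal M f)"
      using M.C1_fun_has_weak_derivative[OF C] by simp
    show "ae_on M (\<lambda>x. \<forall>v\<in>tangent_space M x. dreal H (\<lambda>p. f (fst (fst p))) (A (x, v)) = dreal M f (x, v))"
      by (rule A.deriv_C1_fun[OF C1_fun_pullback_M[OF C] _ w, of B]) (auto simp: points_H intro: B)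
  qed
  have aeN: "ae_on M (\<lambda>x. \<forall>f\<in>FN. \<forall>v\<in>tangent_space M x. dreal H (\<lambda>p. f (snd (fst p))) (A (x, v)) = dreal N f (Tu (x, v)))"
  proof (rule ae_on_ball_countable[OF FN(1)])
    fix f assume "f \<in> FN"
    then have f: "f \<in> C1c N" using FN by blast
    note C = N.C1c_imp_C1_fun[OF f]
    obtain B where B: "\<And>x. x \<in> points N \<Longrightarrow> \<bar>f x\<bar> \<le> B" by (rule N.C1c_bounded[OF f], rule that)
    obtain \<gamma> where \<gamma>: "has_weak_derivative M (f \<circ> u) \<gamma>" using T.wd[OF f] by (auto simp: weakly_differentiable_def)
    have "(\<lambda>p. f (snd (fst p))) \<circ> U = f \<circ> u" by (simp add: fun_eq_iff U_eq)
    then have w: "has_weak_derivative M ((\<lambda>p. f (snd (fst p))) \<circ> U) \<gamma>" using \<gamma> by simp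
    have "ae_on M (\<lambda>x. \<forall>v\<in>tangent_space M x. dreal H (\<lambda>p. f (snd (fst p))) (A (x, v)) = \<gamma> (x, v))"
      by (rule A.deriv_C1_fun[OF C1_fun_pullback_N[OF C] _ w, of B]) (auto simp: points_H intro: B)
    from ae_on_conj[OF this T.A_deriv[OF f \<gamma>]]
    show "ae_on M (\<lambda>x. \<forall>v\<in>tangent_space M x. dreal H (\<lambda>p. f (snd (fst p))) (A (x, v)) = dreal N f (Tu (x, v)))"
      by (rule ae_on_mono) simp
  qed
  from ae_on_conj[OF aeM ae_on_conj[OF aeN L_eq_Tu]] show ?thesis
  proof (rule ae_on_mono, intro ballI)
    fix x v assume x: "x \<in> points M" and v: "v \<in> tangent_space M x"
      and ae: "(\<forall>f\<in>FM. \<forall>v\<in>tangent_space M x. dreal H (\<lambda>p. f (fst (fst p))) (A (x, v)) = dreal M f (x, v)) \<and>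
       (\<forall>f\<in>FN. \<forall>v\<in>tangent_space M x. dreal H (\<lambda>p. f (snd (fst p))) (A (x, v)) = dreal N f (Tu (x, v))) \<and>
       (\<forall>v\<in>tangent_space M x. L x v = snd (Tu (x, v)))"
    let ?W = "snd (A (x, v))" and ?h = "hom_chart M N (cM x) (cN x)"
    note ch = charts[OF x]
    have Aeq: "A (x, v) = (((x, u x), L x), ?W)" and W: "?W \<in> tangent_space H ((x, u x), L x)"
      using A.A_eq[OF x v] A.A_snd[OF x v] by (simp_all add: U_eq)
    note pb = dreal_pullback[OF U_H[OF x] W ch]
    have "tvec_of M (cM x) x (fst (fst (?W ?h))) = v"
    proof (rule sepM[OF x M.tvec_of_in[OF ch(1,2)] v])
      fix f assume f: "f \<in> FM"
      then have "C1_fun M f" using FM M.C1c_imp_C1_fun by blast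
      from pb(1)[OF this] Aeq ae f v
      show "dreal M f (x, tvec_of M (cM x) x (fst (fst (?W ?h)))) = dreal M f (x, v)" by metis
    qed
    then have 1: "fst (fst (?W ?h)) = v (cM x)" using M.tvec_of_chart[OF ch(1,2)] by metis
    have Tu: "Tu (x, v) = (u x, L x v)" using T.A_eq[OF x v] ae v by simp
    have "tvec_of N (cN x) (u x) (snd (fst (?W ?h))) = L x v"
    proof (rule sepN[OF u_points[OF x] N.tvec_of_in[OF ch(3,4)] hom_spaceD(1)[OF L_hom[OF x] v]])
      fix f assume f: "f \<in> FN"
      then have "C1_fun N f" using FN N.C1c_imp_C1_fun by blast
      from pb(2)[OF this] Aeq ae f v Tu
      show "dreal N f (u x, tvec_of N (cN x) (u x) (snd (fst (?W ?h)))) = dreal N f (u x, L x v)" by metis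
    qed
    then have "snd (fst (?W ?h)) = L x v (cN x)" using N.tvec_of_chart[OF ch(3,4)] by metis
    with 1 show "base_ok x v ?W" by (simp add: base_ok_def prod_eq_iff)
  qed
qed

section \<open>Horizontal and vertical parts along Tu\<close>

abbreviation "vert \<equiv> vert_comp M N U"
abbreviation "hor \<equiv> hor_comp M N K U"

lemma hor_def': "hor x e = horizontal_lift E K ((x, u x), L x) (tvec_pair M N (x, e) (u x, L x e))"
  by (simp add: hor_comp_def U_eq)

lemma horE:
  assumes x: "x \<in> points M" and e: "e \<in> tangent_space M x"
  obtains Y where "hor x e = (U x, Y)" "Y \<in> tangent_space H (U x)" "K (U x, Y) = ((x, u x), \<lambda>v. tvec_zero)" "base_ok x e Y"
  using horizontal_lift_exists[OF U_H[OF x] e hom_spaceD(1)[OF L_hom[OF x] e] charts[OF x]] that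
  unfolding hor_def' base_ok_def U_eq by metis

lemma hor_eqI:
  assumes x: "x \<in> points M" and e: "e \<in> tangent_space M x"
    and "Y \<in> tangent_space H (U x)" "K (U x, Y) = ((x, u x), \<lambda>v. tvec_zero)" "base_ok x e Y"
  shows "hor x e = (U x, Y)"
  using horizontal_lift_eq[OF U_H[OF x] _ e hom_spaceD(1)[OF L_hom[OF x] e] charts[OF x]] assms(3-)
  unfolding hor_def' base_ok_def U_eq by blast

text \<open>Sums and multiples of vectors in the kernel of \<open>K\<close> stay in it and lie over
  the sums and multiples of the base vectors, so uniqueness of horizontal lifts
  (\<open>hor_eqI\<close>) identifies them.\<close>

lemma hor_linear:
  assumes x: "x \<in> points M" shows "tvec_linear M x (\<lambda>e. snd (hor x e))"
  unfolding tvec_linear_def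
proof (intro conjI ballI allI)
  fix e e' r assume e: "e \<in> tangent_space M x"
  obtain Y where Y: "hor x e = (U x, Y)" "Y \<in> tangent_space H (U x)" "K (U x, Y) = ((x, u x), \<lambda>v. tvec_zero)" "base_ok x e Y"
    by (rule horE[OF x e])
  have "hor x (tvec_scale r e) = (U x, tvec_scale r Y)"
  proof (rule hor_eqI[OF x M.tangent_scale[OF e] H.tangent_scale[OF Y(2)]])
    show "K (U x, tvec_scale r Y) = ((x, u x), \<lambda>v. tvec_zero)"
      using K_scale[OF U_points[OF x] Y(2)] Y(3) by (simp add: tvec_line_0)
    show "base_ok x (tvec_scale r e) (tvec_scale r Y)"
      using Y(4) hom_spaceD(3)[OF L_hom[OF x] e] by (simp add: base_ok_def tvec_scale_def)
  qed
  then show "snd (hor x (tvec_scale r e)) = tvec_scale r (snd (hor x e))" using Y(1) by simp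
  assume e': "e' \<in> tangent_space M x"
  obtain Y' where Y': "hor x e' = (U x, Y')" "Y' \<in> tangent_space H (U x)" "K (U x, Y') = ((x, u x), \<lambda>v. tvec_zero)" "base_ok x e' Y'"
    by (rule horE[OF x e'])
  have "hor x (tvec_add e e') = (U x, tvec_add Y Y')"
  proof (rule hor_eqI[OF x M.tangent_add[OF e e'] H.tangent_add[OF Y(2) Y'(2)]])
    show "K (U x, tvec_add Y Y') = ((x, u x), \<lambda>v. tvec_zero)"
      using K_add[OF U_points[OF x] Y(2) Y'(2)] Y(3) Y'(3) by (simp add: tvec_line_0)
    show "base_ok x (tvec_add e e') (tvec_add Y Y')"
      using Y(4) Y'(4) hom_spaceD(2)[OF L_hom[OF x] e e'] by (simp add: base_ok_def tvec_add_def)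
  qed
  then show "snd (hor x (tvec_add e e')) = tvec_add (snd (hor x e)) (snd (hor x e'))" using Y(1) Y'(1) by simp
qed

text \<open>For a covariant derivative this holds only a.e.; elsewhere \<open>contract D x e\<close>
  may belong to another fibre than \<open>U x\<close>, and its vertical lift has no meaning.\<close>

definition cov_point :: "('p \<Rightarrow> ('p, real^'m, 'q, real^'n) bilin_point) \<Rightarrow> 'p \<Rightarrow> bool" where
  "cov_point D x \<longleftrightarrow> fst (D x) = (x, u x) \<and> snd (D x) \<in> bilin_space M N x (u x)"

lemma vertE:
  assumes x: "x \<in> points M" and D: "cov_point D x" and e: "e \<in> tangent_space M x"
  obtains Z where "vert D x e = (U x, Z)" "Z \<in> tangent_space H (U x)" "K (U x, Z) = contract D x e"
    "Z (hom_chart M N (cM x) (cN x)) = (0, hom_mat M (cM x) (cN x) x (snd (D x) e))"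
proof -
  have D': "fst (D x) = (x, u x)" and B: "snd (D x) e \<in> hom_space M N x (u x)"
    using D bilin_spaceD(1)[OF _ e] by (simp_all add: cov_point_def)
  obtain Z where "vertical_lift E ((x, u x), L x) ((x, u x), snd (D x) e) = (((x, u x), L x), Z)"
    "Z \<in> tangent_space H ((x, u x), L x)" "K (((x, u x), L x), Z) = ((x, u x), snd (D x) e)"
    "\<And>c d. c \<in> M \<Longrightarrow> x \<in> fst c \<Longrightarrow> d \<in> N \<Longrightarrow> u x \<in> fst d \<Longrightarrow> Z (hom_chart M N c d) = (0, hom_mat M c d x (snd (D x) e))"
    by (rule vertical_lift_tangent[OF U_H[OF x] B], rule that)
  then show thesis using charts[OF x] by (intro that[of Z]) (simp_all add: vert_comp_def contract_def U_eq D')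
qed

text \<open>A vertical vector is determined by its fibre component, here the matrix of
  \<open>snd (D x) e\<close>, which is linear in \<open>e\<close>.\<close>

lemma vert_linear:
  assumes x: "x \<in> points M" and D: "cov_point D x" shows "tvec_linear M x (\<lambda>e. snd (vert D x e))"
  unfolding tvec_linear_def
proof (intro conjI ballI allI)
  let ?h = "hom_chart M N (cM x) (cN x)"
  have h: "?h \<in> H" "U x \<in> fst ?h"
    using charts[OF x] L_hom[OF x] by (simp_all add: hom_chart_in hom_chart_dom U_eq)
  have B: "snd (D x) \<in> bilin_space M N x (u x)" using D by (simp add: cov_point_def)
  fix e e' r assume e: "e \<in> tangent_space M x"
  obtain Z where Z: "vert D x e = (U x, Z)" "Z \<in> tangent_space H (U x)"
    "Z ?h = (0, hom_mat M (cM x) (cN x) x (snd (D x) e))" by (rule vertE[OF x D e], rule that)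
  obtain Z1 where Z1: "vert D x (tvec_scale r e) = (U x, Z1)" "Z1 \<in> tangent_space H (U x)"
    "Z1 ?h = (0, hom_mat M (cM x) (cN x) x (snd (D x) (tvec_scale r e)))" by (rule vertE[OF x D M.tangent_scale[OF e]], rule that)
  have "Z1 = tvec_scale r Z"
    by (rule H.tangent_ext[OF Z1(2) H.tangent_scale[OF Z(2)] h])
      (simp add: Z1 Z tvec_scale_def[of r Z] hom_mat_def matrix_def vec_eq_iff bilin_spaceD(3)[OF B e]
        tvec_scale_def[of r "snd (D x) e _"])
  then show "snd (vert D x (tvec_scale r e)) = tvec_scale r (snd (vert D x e))" using Z(1) Z1(1) by simp
  assume e': "e' \<in> tangent_space M x"
  obtain Z' where Z': "vert D x e' = (U x, Z')" "Z' \<in> tangent_space H (U x)"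
    "Z' ?h = (0, hom_mat M (cM x) (cN x) x (snd (D x) e'))" by (rule vertE[OF x D e'], rule that)
  obtain Z2 where Z2: "vert D x (tvec_add e e') = (U x, Z2)" "Z2 \<in> tangent_space H (U x)"
    "Z2 ?h = (0, hom_mat M (cM x) (cN x) x (snd (D x) (tvec_add e e')))" by (rule vertE[OF x D M.tangent_add[OF e e']], rule that)
  have "Z2 = tvec_add Z Z'"
    by (rule H.tangent_ext[OF Z2(2) H.tangent_add[OF Z(2) Z'(2)] h])
      (simp add: Z2 Z Z' tvec_add_def[of Z Z'] hom_mat_def matrix_def vec_eq_iff bilin_spaceD(2)[OF B e e']
        tvec_add_def[of "snd (D x) e _"])
  then show "snd (vert D x (tvec_add e e')) = tvec_add (snd (vert D x e)) (snd (vert D x e'))" using Z(1) Z'(1) Z2(1) by simp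
qed

section \<open>From a covariant derivative to a colocal derivative, and uniqueness\<close>

abbreviation "cov \<equiv> has_colocal_weak_covariant_derivative M N K u U"

lemma cov_points:
  assumes "cov D" shows "ae_on M (cov_point D)"
proof -
  have "ae_on M (\<lambda>x. fst (D x) = (x, u x))" and m: "measurable_map M (bilin_atlas M N) D"
    using assms unfolding has_colocal_weak_covariant_derivative_def by blast+
  then show ?thesis
  proof (elim ae_on_mono)
    fix x assume x: "x \<in> points M" and "fst (D x) = (x, u x)"
    then have "D x = ((x, u x), snd (D x))" by (simp add: prod_eq_iff)
    moreover have "D x \<in> points (bilin_atlas M N)" using m x unfolding measurable_map_def by blast
    ultimately show "cov_point D x" by (metis cov_point_def points_bilin_iff fst_conv)
  qed
qed

lemma cov_deriv:
  assumes "cov D" "f \<in> C1c H" "has_weak_derivative M (f \<circ> U) \<omega>"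
  shows "ae_on M (\<lambda>x. \<forall>e\<in>tangent_space M x. dreal H f (vert D x e) = \<omega> (x, e) - dreal H f (hor x e))"
  using assms by (auto simp: has_colocal_weak_covariant_derivative_def)

text \<open>\<open>colocal_derivative\<close> wants values in the tangent space at
  \<open>U x\<close> for every \<open>x\<close>, not only for almost every one. The zero vector
  fills the exceptional set of \<open>D\<close>.\<close>

definition vert_plus_hor :: "('p \<Rightarrow> ('p, real^'m, 'q, real^'n) bilin_point) \<Rightarrow> 'p \<times> ('p, real^'m) tvec \<Rightarrow> ('p, 'm, 'q, 'n) hom_tangent" where
  "vert_plus_hor D = (\<lambda>(x, e). if cov_point D x then (U x, tvec_add (snd (vert D x e)) (snd (hor x e))) else (U x, tvec_zero))"

text \<open>Solved for \<open>\<omega>\<close>, the defining equation of a covariant derivative is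
  the chain rule for the sum, because differentials are additive. Measurability of the sum then
  follows inside the locale.\<close>

lemma vert_plus_hor_derivative:
  assumes D: "cov D" shows "colocal_derivative M H U (vert_plus_hor D)"
proof
  show "measurable_map M H U" using U_differentiable by (simp add: colocally_weakly_differentiable_def)
  show "weakly_differentiable M (f \<circ> U)" if "f \<in> C1c H" for f
    using U_wd[OF that] by (simp add: weakly_differentiable_def)
  fix x v assume x: "x \<in> points M" and v: "v \<in> tangent_space M x"
  show "fst (vert_plus_hor D (x, v)) = U x" by (simp add: vert_plus_hor_def)
  show "snd (vert_plus_hor D (x, v)) \<in> tangent_space H (U x)"
  proof (cases "cov_point D x")
    case True
    obtain Y where Y: "hor x v = (U x, Y)" "Y \<in> tangent_space H (U x)" by (rule horE[OF x v], rule that)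
    obtain Z where Z: "vert D x v = (U x, Z)" "Z \<in> tangent_space H (U x)" by (rule vertE[OF x True v], rule that)
    show ?thesis using H.tangent_add[OF Z(2) Y(2)] by (simp add: vert_plus_hor_def True Y Z)
  next
    case False then show ?thesis by (simp add: vert_plus_hor_def H.tangent_zero)
  qed
next
  show "ae_on M (\<lambda>x. tvec_linear M x (\<lambda>v. snd (vert_plus_hor D (x, v))))"
    using cov_points[OF D]
  proof (rule ae_on_mono)
    fix x assume x: "x \<in> points M" and c: "cov_point D x"
    have "tvec_add (tvec_add a b) (tvec_add a' b') = tvec_add (tvec_add a a') (tvec_add b b')"
      "tvec_add (tvec_scale r a) (tvec_scale r a') = tvec_scale r (tvec_add a a')"
      for a b a' b' :: "(('p, real^'m, 'q, real^'n) hom_point, ('m, 'n) hom_model) tvec" and r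
      by (simp_all add: tvec_add_def tvec_scale_def fun_eq_iff algebra_simps)
    then show "tvec_linear M x (\<lambda>v. snd (vert_plus_hor D (x, v)))"
      using vert_linear[OF x c] hor_linear[OF x] by (simp add: vert_plus_hor_def c tvec_linear_def)
  qed
  fix f \<omega> assume f: "f \<in> C1c H" and \<omega>: "has_weak_derivative M (f \<circ> U) \<omega>"
  from ae_on_conj[OF cov_points[OF D] cov_deriv[OF D f \<omega>]]
  show "ae_on M (\<lambda>x. \<forall>v\<in>tangent_space M x. \<omega> (x, v) = dreal H f (vert_plus_hor D (x, v)))"
  proof (rule ae_on_mono, intro ballI)
    fix x v assume x: "x \<in> points M" and v: "v \<in> tangent_space M x"
      and c: "cov_point D x \<and> (\<forall>e\<in>tangent_space M x. dreal H f (vert D x e) = \<omega> (x, e) - dreal H f (hor x e))"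
    obtain Y where Y: "hor x v = (U x, Y)" by (rule horE[OF x v], rule that)
    obtain Z where Z: "vert D x v = (U x, Z)" by (rule vertE[OF x _ v]) (use c in blast)+
    have "dreal H f (vert D x v) = \<omega> (x, v) - dreal H f (hor x v)" using c v by blast
    then show "\<omega> (x, v) = dreal H f (vert_plus_hor D (x, v))"
      using c H.dreal_add[OF H.C1c_imp_C1_fun[OF f] U_points[OF x], of Z Y] by (simp add: vert_plus_hor_def Y Z)
  qed
qed

lemma derivative_unique:
  assumes A: "colocal_derivative M H U A" and A': "colocal_derivative M H U A'"
  shows "ae_on M (\<lambda>x. \<forall>e\<in>tangent_space M x. A (x, e) = A' (x, e))"
proof -
  interpret A: colocal_derivative M H U A by (rule A)
  interpret A': colocal_derivative M H U A' by (rule A')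
  obtain F where F: "countable F" "F \<subseteq> C1c H"
    and sep: "\<forall>x\<in>points H. \<forall>v\<in>tangent_space H x. \<forall>w\<in>tangent_space H x.
      (\<forall>f\<in>F. dreal H f (x, v) = dreal H f (x, w)) \<longrightarrow> v = w"
    using H.countable_separating_C1c by blast
  note sep = sep[rule_format]
  have "ae_on M (\<lambda>x. \<forall>f\<in>F. \<forall>v\<in>tangent_space M x. dreal H f (A (x, v)) = dreal H f (A' (x, v)))"
  proof (rule ae_on_ball_countable[OF F(1)])
    fix f assume "f \<in> F"
    then have f: "f \<in> C1c H" using F by blast
    obtain \<omega> where \<omega>: "has_weak_derivative M (f \<circ> U) \<omega>" using U_wd[OF f] by blast
    from ae_on_conj[OF A.A_deriv[OF f \<omega>] A'.A_deriv[OF f \<omega>]]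
    show "ae_on M (\<lambda>x. \<forall>v\<in>tangent_space M x. dreal H f (A (x, v)) = dreal H f (A' (x, v)))"
      by (rule ae_on_mono) metis
  qed
  then show ?thesis
  proof (rule ae_on_mono, intro ballI)
    fix x e assume x: "x \<in> points M" and e: "e \<in> tangent_space M x"
      and eq: "\<forall>f\<in>F. \<forall>v\<in>tangent_space M x. dreal H f (A (x, v)) = dreal H f (A' (x, v))"
    have "snd (A (x, e)) = snd (A' (x, e))"
    proof (rule sep[OF U_points[OF x] A.A_snd[OF x e] A'.A_snd[OF x e]])
      show "dreal H f (U x, snd (A (x, e))) = dreal H f (U x, snd (A' (x, e)))" if "f \<in> F" for f
        using eq that e A.A_eq[OF x e] A'.A_eq[OF x e] by metis
    qed
    then show "A (x, e) = A' (x, e)" using A.A_eq[OF x e] A'.A_eq[OF x e] by simp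
  qed
qed

lemma K_vert_plus_hor:
  assumes x: "x \<in> points M" and D: "cov_point D x" and e: "e \<in> tangent_space M x"
  shows "K (vert_plus_hor D (x, e)) = contract D x e"
    and "vert_plus_hor D (x, e) = vadd (tangent_bundle H) (vert D x e) (hor x e)"
proof -
  obtain Y where Y: "hor x e = (U x, Y)" "Y \<in> tangent_space H (U x)" "K (U x, Y) = ((x, u x), \<lambda>v. tvec_zero)"
    by (rule horE[OF x e], rule that)
  obtain Z where Z: "vert D x e = (U x, Z)" "Z \<in> tangent_space H (U x)" "K (U x, Z) = contract D x e"
    by (rule vertE[OF x D e], rule that)
  have "fst (contract D x e) = (x, u x)" using D by (simp add: contract_def cov_point_def)
  then show "K (vert_plus_hor D (x, e)) = contract D x e"
    using K_add[OF U_points[OF x] Z(2) Y(2)] Y Z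
    by (cases "contract D x e") (simp add: vert_plus_hor_def D tvec_line_0)
  show "vert_plus_hor D (x, e) = vadd (tangent_bundle H) (vert D x e) (hor x e)"
    by (simp add: vert_plus_hor_def D Y Z tangent_bundle_def)
qed

lemma cov_formulas:
  assumes D: "cov D" and A: "colocal_derivative M H U A"
  shows "ae_on M (\<lambda>x. \<forall>e\<in>tangent_space M x. A (x, e) = vadd (tangent_bundle H) (vert D x e) (hor x e))"
    and "ae_on M (\<lambda>x. \<forall>e\<in>tangent_space M x. contract D x e = K (A (x, e)))"
proof -
  note ae = ae_on_conj[OF cov_points[OF D] derivative_unique[OF A vert_plus_hor_derivative[OF D]]]
  show "ae_on M (\<lambda>x. \<forall>e\<in>tangent_space M x. A (x, e) = vadd (tangent_bundle H) (vert D x e) (hor x e))"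
    using ae by (rule ae_on_mono) (metis K_vert_plus_hor(2))
  show "ae_on M (\<lambda>x. \<forall>e\<in>tangent_space M x. contract D x e = K (A (x, e)))"
    using ae by (rule ae_on_mono) (metis K_vert_plus_hor(1))
qed

text \<open>Both \<open>D\<close> and \<open>D'\<close> are recovered by applying \<open>K\<close>
  to one and the same colocal derivative, the one built from \<open>D\<close>. Uniqueness of colocal
  derivatives enters through \<open>cov_formulas\<close>.\<close>

lemma cov_unique:
  assumes D: "cov D" and D': "cov D'" shows "ae_on M (\<lambda>x. D x = D' x)"
proof -
  from ae_on_conj[OF ae_on_conj[OF cov_points[OF D] cov_points[OF D']] cov_formulas(2)[OF D' vert_plus_hor_derivative[OF D]]]
  show ?thesis
  proof (rule ae_on_mono)
    fix x assume x: "x \<in> points M" and *: "(cov_point D x \<and> cov_point D' x) \<and>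
        (\<forall>e\<in>tangent_space M x. contract D' x e = K (vert_plus_hor D (x, e)))"
    then have c: "fst (D x) = (x, u x)" "fst (D' x) = (x, u x)" "snd (D x) \<in> bilin_space M N x (u x)"
        "snd (D' x) \<in> bilin_space M N x (u x)" by (simp_all add: cov_point_def)
    have "snd (D x) = snd (D' x)"
    proof (rule bilin_ext[OF c(3,4)])
      fix e assume e: "e \<in> tangent_space M x"
      have "contract D' x e = contract D x e" using * e K_vert_plus_hor(1)[OF x _ e] by simp
      then show "snd (D x) e = snd (D' x) e" by (simp add: contract_def)
    qed
    then show "D x = D' x" using c by (simp add: prod_eq_iff)
  qed
qed

section \<open>From a colocal derivative to a covariant derivative\<close>

lemma zero_hom: "(\<lambda>v. tvec_zero) \<in> hom_space M N x y"
  by (simp add: hom_space_def N.tangent_zero tvec_line_0)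

definition good :: "('p \<times> ('p, real^'m) tvec \<Rightarrow> ('p, 'm, 'q, 'n) hom_tangent) \<Rightarrow> 'p \<Rightarrow> bool" where
  "good A x \<longleftrightarrow> tvec_linear M x (\<lambda>v. snd (A (x, v))) \<and> (\<forall>v\<in>tangent_space M x. base_ok x v (snd (A (x, v))))"

text \<open>The value has to be bilinear at every point for \<open>K_comp A\<close> to be a map into
  the bundle of bilinear maps. Zero is substituted on the null set where \<open>A\<close> is not
  good.\<close>

definition K_comp :: "('p \<times> ('p, real^'m) tvec \<Rightarrow> ('p, 'm, 'q, 'n) hom_tangent) \<Rightarrow> 'p \<Rightarrow> ('p, real^'m, 'q, real^'n) bilin_point" where
  "K_comp A x = ((x, u x), \<lambda>e. if good A x \<and> e \<in> tangent_space M x then snd (K (A (x, e))) else (\<lambda>v. tvec_zero))"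

context
  fixes A assumes A: "colocal_derivative M H U A"
begin

interpretation A: colocal_derivative M H U A by (rule A)

lemma KA:
  assumes x: "x \<in> points M" and e: "e \<in> tangent_space M x"
  shows "K (A (x, e)) = ((x, u x), snd (K (A (x, e))))" and "snd (K (A (x, e))) \<in> hom_space M N x (u x)"
proof -
  obtain l where "K (((x, u x), L x), snd (A (x, e))) = ((x, u x), l)" "l \<in> hom_space M N x (u x)"
    by (rule K_hom[OF U_H[OF x], of "snd (A (x, e))"]) (use A.A_snd[OF x e] in \<open>simp_all add: U_eq\<close>)
  moreover have "A (x, e) = (((x, u x), L x), snd (A (x, e)))" using A.A_eq[OF x e] by (simp add: U_eq)
  ultimately have "K (A (x, e)) = ((x, u x), l)" "l \<in> hom_space M N x (u x)" by simp_all
  then show "K (A (x, e)) = ((x, u x), snd (K (A (x, e))))" "snd (K (A (x, e))) \<in> hom_space M N x (u x)" by simp_all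
qed

text \<open>Linearity in \<open>e\<close> combines linearity of \<open>A\<close> at good points with
  that of \<open>K\<close> on the tangent spaces of \<open>H\<close>. Linearity in the second
  argument is part of the values of \<open>K\<close> being points of \<open>H\<close>.\<close>

lemma K_comp_bilin:
  assumes x: "x \<in> points M" shows "snd (K_comp A x) \<in> bilin_space M N x (u x)"
proof (cases "good A x")
  case False
  then show ?thesis by (simp add: K_comp_def bilin_space_def zero_hom tvec_line_0)
next
  case True
  then have lin: "tvec_linear M x (\<lambda>v. snd (A (x, v)))" by (simp add: good_def)
  have add: "snd (K (A (x, tvec_add e e'))) = (\<lambda>v. tvec_add (snd (K (A (x, e))) v) (snd (K (A (x, e'))) v))"
    if e: "e \<in> tangent_space M x" and e': "e' \<in> tangent_space M x" for e e'
  proof -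
    have "A (x, tvec_add e e') = (U x, tvec_add (snd (A (x, e))) (snd (A (x, e'))))"
      using lin e e' A.A_eq[OF x M.tangent_add[OF e e']] by (simp add: tvec_linear_def)
    then have "K (A (x, tvec_add e e')) = vadd E (K (A (x, e))) (K (A (x, e')))"
      using K_add[OF U_points[OF x] A.A_snd[OF x e] A.A_snd[OF x e']] A.A_eq[OF x e] A.A_eq[OF x e'] by simp
    also have "\<dots> = ((x, u x), \<lambda>v. tvec_add (snd (K (A (x, e))) v) (snd (K (A (x, e'))) v))"
      by (subst KA(1)[OF x e], subst KA(1)[OF x e']) simp
    finally show ?thesis by simp
  qed
  have scale: "snd (K (A (x, tvec_scale r e))) = (\<lambda>v. tvec_scale r (snd (K (A (x, e))) v))"
    if e: "e \<in> tangent_space M x" for e r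
  proof -
    have "A (x, tvec_scale r e) = (U x, tvec_scale r (snd (A (x, e))))"
      using lin e A.A_eq[OF x M.tangent_scale[OF e, of r]] by (simp add: tvec_linear_def)
    then have "K (A (x, tvec_scale r e)) = vscale E r (K (A (x, e)))"
      using K_scale[OF U_points[OF x] A.A_snd[OF x e]] A.A_eq[OF x e] by simp
    also have "\<dots> = ((x, u x), \<lambda>v. tvec_scale r (snd (K (A (x, e))) v))"
      by (subst KA(1)[OF x e]) simp
    finally show ?thesis by simp
  qed
  show ?thesis
    unfolding bilin_space_def K_comp_def
    using True KA(2)[OF x] add scale M.tangent_add M.tangent_scale by simp
qed

lemma ae_good: "ae_on M (good A)"
  by (rule ae_on_mono[OF ae_on_conj[OF A.A_linear base_derivative[OF A]]]) (simp add: good_def)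

text \<open>\<open>K\<close> is continuous and \<open>A\<close> along a coordinate direction is
  measurable, so the composition is measurable into \<open>H\<close>. The matrix is the fibre
  coordinate of the result in a bundle chart.\<close>

lemma K_comp_coordinate_measurable:
  assumes c: "c \<in> M" and d: "d \<in> N"
  shows "(\<lambda>z. hom_mat M c d (chart_inv c z) (snd (K (A (chart_inv c z, tvec_of M c (chart_inv c z) (axis i 1))))))
    \<in> borel_measurable (lebesgue_on {z \<in> chart_image c. u (chart_inv c z) \<in> fst d})"
proof -
  let ?F = "\<lambda>z. K (A (chart_inv c z, tvec_of M c (chart_inv c z) (axis i 1)))" and ?h = "hom_chart M N c d"
  have b: "axis i 1 \<in> (Basis :: (real^'m) set)" by (simp add: axis_in_Basis_iff)
  have "meas_on (chart_image c) H ?F"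
    by (rule meas_on_compose[OF A.A_basis_meas_on[OF c b] K_continuous topspace_tangent_H H.topspace_mtop])
  from H.meas_on_chart(2)[OF this hom_chart_in[OF c d] open_UNIV]
  have m: "(\<lambda>z. snd ?h (?F z)) \<in> borel_measurable (lebesgue_on {z \<in> chart_image c. ?F z \<in> fst ?h})" by simp
  have F: "?F z = ((chart_inv c z, u (chart_inv c z)), snd (?F z))" "snd (?F z) \<in> hom_space M N (chart_inv c z) (u (chart_inv c z))"
    if "z \<in> chart_image c" for z
    using KA[OF A.chart_inv_points[OF c that] M.tvec_of_in[OF c chart_inv_image(1)[OF that]]] by blast+
  have dom: "?F z \<in> fst ?h \<longleftrightarrow> u (chart_inv c z) \<in> fst d" if "z \<in> chart_image c" for z
    using F(2)[OF that] chart_inv_image(1)[OF that] by (subst F(1)[OF that]) (simp add: hom_chart_dom)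
  have "{z \<in> chart_image c. ?F z \<in> fst ?h} = {z \<in> chart_image c. u (chart_inv c z) \<in> fst d}" using dom by blast
  with m have m: "(\<lambda>z. snd ?h (?F z)) \<in> borel_measurable (lebesgue_on {z \<in> chart_image c. u (chart_inv c z) \<in> fst d})" by simp
  have "(\<lambda>z. snd (snd ?h (?F z))) \<in> borel_measurable (lebesgue_on {z \<in> chart_image c. u (chart_inv c z) \<in> fst d})"
    by (rule measurable_compose[OF m]) (rule borel_measurable_continuous_onI, intro continuous_intros)
  also have "?this \<longleftrightarrow> ?thesis"
  proof (rule measurable_cong)
    fix z assume "z \<in> space (lebesgue_on {z \<in> chart_image c. u (chart_inv c z) \<in> fst d})"
    then have z: "z \<in> chart_image c" by simp
    show "snd (snd ?h (?F z)) = hom_mat M c d (chart_inv c z) (snd (?F z))"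
      by (subst F(1)[OF z]) (simp add: hom_chart_map)
  qed
  finally show ?thesis .
qed

text \<open>With a chart \<open>c\<close> of \<open>M\<close> fixed only the chart of
  \<open>N\<close> has to vary, so countably many preimages of chart domains under \<open>u\<close>
  cover the chart image. There the coordinates agree with those of \<open>K \<circ> A\<close> except
  where \<open>A\<close> is not good, which is a null set.\<close>

lemma K_comp_measurable: "measurable_map M (bilin_atlas M N) (K_comp A)"
proof -
  have iff: "measurable_map M (bilin_atlas M N) (K_comp A) \<longleftrightarrow>
      (\<forall>c\<in>M. meas_on (chart_image c) (bilin_atlas M N) (K_comp A \<circ> chart_inv c))"
    by (rule measurable_map_iff[OF M.inj])
  obtain N0 where N0: "N0 \<subseteq> N" "countable N0" "points N0 = points N" using N.countable_subatlas by blast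
  show ?thesis
    unfolding iff
  proof
    fix c assume c: "c \<in> M"
    let ?x = "chart_inv c" and ?D = "K_comp A \<circ> chart_inv c"
    have D_eq: "?D z = ((?x z, u (?x z)), snd (?D z))" for z by (simp add: K_comp_def)
    show "meas_on (chart_image c) (bilin_atlas M N) ?D"
    proof (rule meas_onI_charts[OF _ inj_bilin_chart N0(2), where ch = "\<lambda>d. bilin_chart M N c d"
          and T = "\<lambda>d. {z \<in> chart_image c. u (?x z) \<in> fst d}"])
      show "?D \<in> chart_image c \<rightarrow> points (bilin_atlas M N)"
      proof
        fix z assume z: "z \<in> chart_image c"
        note x = A.chart_inv_points[OF c z]
        show "?D z \<in> points (bilin_atlas M N)"
          using K_comp_bilin[OF x] x u_points[OF x] by (subst D_eq) (simp add: points_bilin_iff)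
      qed
      show "chart_image c = (\<Union>d\<in>N0. {z \<in> chart_image c. u (?x z) \<in> fst d})"
      proof -
        have "\<exists>d\<in>N0. u (?x z) \<in> fst d" if "z \<in> chart_image c" for z
        proof -
          have "u (?x z) \<in> points N0" using u_points[OF A.chart_inv_points[OF c that]] by (simp only: N0(3))
          then show ?thesis unfolding points_def by blast
        qed
        then show ?thesis by blast
      qed
      fix d assume "d \<in> N0"
      then have d: "d \<in> N" using N0 by blast
      let ?T = "{z \<in> chart_image c. u (?x z) \<in> fst d}"
      show "bilin_chart M N c d \<in> bilin_atlas M N" using c d unfolding bilin_atlas_def by blast
      show T: "?T \<in> sets lebesgue" using N.meas_on_chart(1)[OF T.U_meas_on[OF c] d open_UNIV] by simp
      have um: "(\<lambda>z. snd d (u (?x z))) \<in> borel_measurable (lebesgue_on ?T)"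
        using N.meas_on_chart(2)[OF T.U_meas_on[OF c] d open_UNIV] by simp
      show "?D z \<in> fst (bilin_chart M N c d)" if z: "z \<in> ?T" for z
      proof -
        have "z \<in> chart_image c" "u (?x z) \<in> fst d" using z by blast+
        then show ?thesis
          using K_comp_bilin[OF A.chart_inv_points[OF c]] chart_inv_image(1)[of z c]
          by (subst D_eq) (simp add: bilin_chart_dom)
      qed
      let ?a = "\<lambda>z. \<chi> i. hom_mat M c d (?x z) (snd (K (A (?x z, tvec_of M c (?x z) (axis i 1)))))"
      have id: "(\<lambda>z. z) \<in> borel_measurable (lebesgue_on ?T)"
        by (intro measurable_restrict_space1 measurable_completion) simp
      have am: "?a \<in> borel_measurable (lebesgue_on ?T)"
        by (rule borel_measurable_vec) (simp add: K_comp_coordinate_measurable[OF c d])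
      have gm: "(\<lambda>z. ((z, snd d (u (?x z))), ?a z)) \<in> borel_measurable (lebesgue_on ?T)"
        by (rule borel_measurable_Pair[OF borel_measurable_Pair[OF id um] am])
      show "(\<lambda>z. snd (bilin_chart M N c d) (?D z)) \<in> borel_measurable (lebesgue_on ?T)"
      proof (rule borel_measurable_lebesgue_on_cong_ae[OF T gm])
        have N: "negligible {z \<in> chart_image c. \<not> good A (?x z)}" using ae_good c unfolding M.ae_on_iff by blast
        have eq: "((z, snd d (u (?x z))), ?a z) = snd (bilin_chart M N c d) (?D z)"
          if z: "z \<in> chart_image c" and g: "good A (?x z)" for z
          using chart_inv_image[OF z] M.tvec_of_in[OF c chart_inv_image(1)[OF z]] g
          by (subst D_eq) (simp add: bilin_chart_map K_comp_def)
        show "negligible {z \<in> ?T. ((z, snd d (u (?x z))), ?a z) \<noteq> snd (bilin_chart M N c d) (?D z)}"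
          by (rule negligible_subset[OF N]) (use eq in blast)
      qed
    qed
  qed
qed

text \<open>At a good point the base component is right, so
  \<open>vertical_horizontal_decomposition\<close> splits the value of \<open>A\<close> into the
  vertical lift of its image under \<open>K\<close> and the horizontal lift along \<open>Tu\<close>.
  The defining equation is the chain rule for \<open>A\<close> with the two differentials
  separated.\<close>

lemma K_comp_cov: "cov (K_comp A)"
  unfolding has_colocal_weak_covariant_derivative_def
proof (intro conjI ballI allI impI)
  show "colocally_weakly_differentiable M (bundle_total E) U" using U_differentiable by simp
  show "measurable_map M (bilin_atlas M N) (K_comp A)" by (rule K_comp_measurable)
  show "ae_on M (\<lambda>x. fst (K_comp A x) = (x, u x))" by (rule ae_onI) (simp add: K_comp_def)
  fix f \<omega> assume "f \<in> C1c (bundle_total E)" and \<omega>: "has_weak_derivative M (f \<circ> U) \<omega>"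
  then have f: "f \<in> C1c H" by simp
  from ae_on_conj[OF ae_good A.A_deriv[OF f \<omega>]]
  have "ae_on M (\<lambda>x. \<forall>e\<in>tangent_space M x. dreal H f (vert (K_comp A) x e) = \<omega> (x, e) - dreal H f (hor x e))"
  proof (rule ae_on_mono, intro ballI)
    fix x e assume x: "x \<in> points M" and e: "e \<in> tangent_space M x"
      and ae: "good A x \<and> (\<forall>v\<in>tangent_space M x. \<omega> (x, v) = dreal H f (A (x, v)))"
    let ?W = "snd (A (x, e))"
    have Aeq: "A (x, e) = (((x, u x), L x), ?W)" and W: "?W \<in> tangent_space H ((x, u x), L x)"
      using A.A_eq[OF x e] A.A_snd[OF x e] by (simp_all add: U_eq)
    have "base_ok x e ?W" using ae e by (simp add: good_def)
    then obtain Z Y where Z: "vertical_lift E ((x, u x), L x) (K (((x, u x), L x), ?W)) = (((x, u x), L x), Z)"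
      and Y: "horizontal_lift E K ((x, u x), L x) (tvec_pair M N (x, e) (u x, L x e)) = (((x, u x), L x), Y)"
      and sum: "?W = tvec_add Z Y"
      using vertical_horizontal_decomposition[OF U_H[OF x] W e hom_spaceD(1)[OF L_hom[OF x] e] charts[OF x]]
      unfolding base_ok_def by metis
    have "contract (K_comp A) x e = K (A (x, e))"
      using ae e KA(1)[OF x e] by (simp add: contract_def K_comp_def)
    then have "vert (K_comp A) x e = (U x, Z)" using Z Aeq by (simp add: vert_comp_def U_eq)
    moreover have "hor x e = (U x, Y)" using Y by (simp add: hor_def' U_eq)
    moreover have "\<omega> (x, e) = dreal H f (U x, tvec_add Z Y)" using ae e Aeq sum U_eq by metis
    ultimately show "dreal H f (vert (K_comp A) x e) = \<omega> (x, e) - dreal H f (hor x e)"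
      using H.dreal_add[OF H.C1c_imp_C1_fun[OF f] U_points[OF x], of Z Y] by simp
  qed
  then show "ae_on M (\<lambda>x. \<forall>e\<in>tangent_space M x. dreal (bundle_total E) f (vert (K_comp A) x e) =
      \<omega> (x, e) - dreal (bundle_total E) f (hor x e))" by simp
qed

end

end

theorem proposition1:
  fixes M :: "('p, real^'m::finite) atlas"
    and N :: "('q, real^'n::finite) atlas"
    and K :: "('p, 'm, 'q, 'n) hom_tangent \<Rightarrow>
      ('p, real^'m, 'q, real^'n) hom_point"
    and u :: "'p \<Rightarrow> 'q"
    and Tu :: "'p \<times> ('p, real^'m) tvec \<Rightarrow> 'q \<times> ('q, real^'n) tvec"
  assumes "manifold 2 M" and "manifold 2 N"
    and "connection (hom_bundle M N) K"
    and "twice_colocally_weakly_differentiable M N u Tu"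
  shows "let E = hom_bundle M N; U = hom_section M N u Tu in
     ((\<exists>D. has_colocal_weak_covariant_derivative M N K u U D) \<longleftrightarrow>
      (\<exists>T2u. has_colocal_weak_derivative M (bundle_total E) U T2u)) \<and>
     (\<forall>D D'. has_colocal_weak_covariant_derivative M N K u U D \<and>
        has_colocal_weak_covariant_derivative M N K u U D' \<longrightarrow> ae_on M (\<lambda>x. D x = D' x)) \<and>
     (\<forall>T2u T2u'. has_colocal_weak_derivative M (bundle_total E) U T2u \<and>
        has_colocal_weak_derivative M (bundle_total E) U T2u' \<longrightarrow>
        ae_on M (\<lambda>x. \<forall>e\<in>tangent_space M x. T2u (x, e) = T2u' (x, e))) \<and>
     (\<forall>D T2u. has_colocal_weak_covariant_derivative M N K u U D \<and>
        has_colocal_weak_derivative M (bundle_total E) U T2u \<longrightarrow>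
        ae_on M (\<lambda>x. \<forall>e\<in>tangent_space M x.
          T2u (x, e) = vadd (tangent_bundle (bundle_total E))
            (vert_comp M N U D x e) (hor_comp M N K U x e)) \<and>
        ae_on M (\<lambda>x. \<forall>e\<in>tangent_space M x. contract D x e = K (T2u (x, e))))"
proof -
  interpret twice_differentiable M N K u Tu
    by unfold_locales (fact assms)+
  \<comment> \<open>The locale recovers measurability and linearity on fibres, so it can replace the
    definition in every clause of the statement.\<close>
  have iff: "has_colocal_weak_derivative M H U A \<longleftrightarrow> colocal_derivative M H U A" for A
    using has_colocal_weak_derivativeD[OF M.C1_manifold_axioms H.C1_manifold_axioms]
      colocal_derivative.has_colocal_weak_derivative by blast
  have ex: "(\<exists>D. cov D) \<longleftrightarrow> (\<exists>A. colocal_derivative M H U A)"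
    using vert_plus_hor_derivative K_comp_cov by blast
  show ?thesis
    unfolding Let_def hom_bundle_simps iff
    using ex cov_unique derivative_unique cov_formulas by blast
qed

end
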